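(* Let $f\in L^1(\Omega)$ with $f\ge0$, $f\not\equiv0$. Then the problem $(-\Delta)^s_{p,\beta}u=f$ in $\Omega$, $u=0$ in $\mathbb R^N\setminus\Omega$, has a unique nonnegative entropy solution $u$. Moreover, if for each $n$ the function $u_n\in W^{s,p}_{\beta,0}(\Omega)$ is the unique energy solution of $(-\Delta)^s_{p,\beta}u_n=T_n(f)$ in $\Omega$, $u_n=0$ in $\mathbb R^N\setminus\Omega$, then $T_k(u_n)\to T_k(u)$ strongly in $W^{s,p}_{\beta,0}(\Omega)$ for every $k>0$.
   Context: Standing assumptions: $s\in(0,1)$, $1<p<N$, $ps<N$, $0\le\beta<\frac{N-ps}{2}$, and $\Omega\subset\mathbb R^N$ is a smooth bounded domain containing the origin. Set $d\mu=|x|^{-2\beta}dx$ and $d\nu=\frac{dx\,dy}{|x-y|^{N+ps}|x|^\beta|y|^\beta}$. $D_\Omega=(\mathbb R^N\times\mathbb R^N)\setminus\big((\mathbb R^N\setminus\Omega)\times(\mathbb R^N\setminus\Omega)\big)$. $W^{s,p}_{\beta,0}(\Omega)$ is the closure of $C_c^\infty(\Omega)$ under the norm $(\int_\Omega|\phi|^pd\mu)^{1/p}+(\int_\Omega\int_\Omega|\phi(x)-\phi(y)|^pd\nu)^{1/p}$; its elements are extended by $0$ outside $\Omega$. The operator is $(-\Delta)^s_{p,\beta}u(x)=\mathrm{P.V.}\int_{\mathbb R^N}\frac{|u(x)-u(y)|^{p-2}(u(x)-u(y))}{|x-y|^{N+ps}}\frac{dy}{|x|^\beta|y|^\beta}$.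 For $k>0$, $T_k(a)=\max\{-k,\min\{k,a\}\}$. For $h\in L^\infty(\Omega)$, the energy solution of $(-\Delta)^s_{p,\beta}w=h$ in $\Omega$, $w=0$ outside $\Omega$, is the unique $w\in W^{s,p}_{\beta,0}(\Omega)$ with $\frac12\iint_{D_\Omega}|w(x)-w(y)|^{p-2}(w(x)-w(y))(\varphi(x)-\varphi(y))d\nu=\int_\Omega h\varphi\,dx$ for all $\varphi\in W^{s,p}_{\beta,0}(\Omega)$. Entropy solution: given $f\in L^1(\Omega)$, a measurable $u$ vanishing outside $\Omega$ with $T_k(u)\in W^{s,p}_{\beta,0}(\Omega)$ for all $k>0$ is an entropy solution if (i) $\iint_{R_h}|u(x)-u(y)|^{p-1}d\nu\to0$ as $h\to\infty$, where $R_h=\{(x,y)\in\mathbb R^N\times\mathbb R^N:\ h+1\le\max\{|u(x)|,|u(y)|\}$ and ($\min\{|u(x)|,|u(y)|\}\le h$ or $u(x)u(y)<0$)$\}$; and (ii) for all $k>0$ and all $\varphi\in W^{s,p}_{\beta,0}(\Omega)\cap L^\infty(\Omega)$, $\frac12\iint_{D_\Omega}|u(x)-u(y)|^{p-2}(u(x)-u(y))[T_k(u(x)-\varphi(x))-T_k(u(y)-\varphi(y))]d\nu\le\int_\Omega f\,T_k(u-\varphi)\,dx$. *)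

theory Defs
  imports "HOL-Analysis.Analysis"
begin

fun dderiv :: "'a::euclidean_space list \<Rightarrow> ('a \<Rightarrow> real) \<Rightarrow> 'a \<Rightarrow> real" where
  "dderiv [] f = f"
| "dderiv (v # vs) f = (\<lambda>x. deriv (\<lambda>t. dderiv vs f (x + t *\<^sub>R v)) 0)"

text \<open>All iterated directional derivatives exist and are continuous (equivalent to C-infinity).\<close>
definition smooth_fun :: "('a::euclidean_space \<Rightarrow> real) \<Rightarrow> bool" where
  "smooth_fun f \<longleftrightarrow>
     (\<forall>vs. continuous_on UNIV (dderiv vs f) \<and>
        (\<forall>v x. (\<lambda>t. dderiv vs f (x + t *\<^sub>R v)) field_differentiable (at 0)))"

definition smooth_bounded_domain :: "'a::euclidean_space set \<Rightarrow> bool" where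
  "smooth_bounded_domain \<Omega> \<longleftrightarrow> open \<Omega> \<and> connected \<Omega> \<and> bounded \<Omega> \<and> \<Omega> \<noteq> {} \<and>
     (\<forall>x\<in>frontier \<Omega>. \<exists>r>0. \<exists>\<rho>. smooth_fun \<rho> \<and> (\<exists>v. dderiv [v] \<rho> x \<noteq> 0) \<and>
        (\<forall>y\<in>ball x r. y \<in> \<Omega> \<longleftrightarrow> \<rho> y < 0))"

definition Cc_inf :: "'a::euclidean_space set \<Rightarrow> ('a \<Rightarrow> real) set" where
  "Cc_inf \<Omega> = {\<phi>. smooth_fun \<phi> \<and> compact (closure {x. \<phi> x \<noteq> 0}) \<and> closure {x. \<phi> x \<noteq> 0} \<subseteq> \<Omega>}"

definition mu_w :: "real \<Rightarrow> 'a::euclidean_space measure" where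
  "mu_w \<beta> = density lebesgue (\<lambda>x. ennreal (1 / (norm x powr (2 * \<beta>))))"

definition nu_w :: "real \<Rightarrow> real \<Rightarrow> real \<Rightarrow> ('a::euclidean_space \<times> 'a) measure" where
  "nu_w s p \<beta> = density (lebesgue \<Otimes>\<^sub>M lebesgue)
     (\<lambda>(x,y). ennreal (1 / (norm (x - y) powr (real DIM('a) + p * s) * norm x powr \<beta> * norm y powr \<beta>)))"

definition D_set :: "'a set \<Rightarrow> ('a \<times> 'a) set" where
  "D_set \<Omega> = UNIV - ((- \<Omega>) \<times> (- \<Omega>))"

definition Lp_part :: "'a::euclidean_space set \<Rightarrow> real \<Rightarrow> real \<Rightarrow> ('a \<Rightarrow> real) \<Rightarrow> ennreal" where
  "Lp_part \<Omega> p \<beta> u = (\<integral>\<^sup>+ x \<in> \<Omega>. ennreal (\<bar>u x\<bar> powr p) \<partial>mu_w \<beta>)"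

definition Gag_part :: "'a::euclidean_space set \<Rightarrow> real \<Rightarrow> real \<Rightarrow> real \<Rightarrow> ('a \<Rightarrow> real) \<Rightarrow> ennreal" where
  "Gag_part \<Omega> s p \<beta> u = (\<integral>\<^sup>+ z \<in> \<Omega> \<times> \<Omega>. ennreal (\<bar>u (fst z) - u (snd z)\<bar> powr p) \<partial>nu_w s p \<beta>)"

text \<open>Norm convergence v_n -> v in the W-norm (the norm tends to 0 iff both p-th powers tend to 0).\<close>
definition W_conv :: "'a::euclidean_space set \<Rightarrow> real \<Rightarrow> real \<Rightarrow> real \<Rightarrow> (nat \<Rightarrow> 'a \<Rightarrow> real) \<Rightarrow> ('a \<Rightarrow> real) \<Rightarrow> bool" where
  "W_conv \<Omega> s p \<beta> vs v \<longleftrightarrow>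
     ((\<lambda>n. Lp_part \<Omega> p \<beta> (\<lambda>x. vs n x - v x)) \<longlonglongrightarrow> 0) \<and>
     ((\<lambda>n. Gag_part \<Omega> s p \<beta> (\<lambda>x. vs n x - v x)) \<longlonglongrightarrow> 0)"

definition Wsp0 :: "'a::euclidean_space set \<Rightarrow> real \<Rightarrow> real \<Rightarrow> real \<Rightarrow> ('a \<Rightarrow> real) set" where
  "Wsp0 \<Omega> s p \<beta> = {u. u \<in> borel_measurable lebesgue \<and> (\<forall>x. x \<notin> \<Omega> \<longrightarrow> u x = 0) \<and>
      Lp_part \<Omega> p \<beta> u < \<infinity> \<and> Gag_part \<Omega> s p \<beta> u < \<infinity> \<and>
      (\<exists>\<phi>. (\<forall>n. \<phi> n \<in> Cc_inf \<Omega>) \<and> W_conv \<Omega> s p \<beta> \<phi> u)}"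

definition Tk :: "real \<Rightarrow> real \<Rightarrow> real" where
  "Tk k a = max (- k) (min k a)"

definition Lp_phi :: "real \<Rightarrow> real \<Rightarrow> real" where
  "Lp_phi p a = \<bar>a\<bar> powr (p - 2) * a"

definition energy_solution ::
  "'a::euclidean_space set \<Rightarrow> real \<Rightarrow> real \<Rightarrow> real \<Rightarrow> ('a \<Rightarrow> real) \<Rightarrow> ('a \<Rightarrow> real) \<Rightarrow> bool" where
  "energy_solution \<Omega> s p \<beta> h w \<longleftrightarrow> w \<in> Wsp0 \<Omega> s p \<beta> \<and>
     (\<forall>\<phi>\<in>Wsp0 \<Omega> s p \<beta>.
        set_integrable (nu_w s p \<beta>) (D_set \<Omega>)
          (\<lambda>z. Lp_phi p (w (fst z) - w (snd z)) * (\<phi> (fst z) - \<phi> (snd z))) \<and>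
        set_integrable lebesgue \<Omega> (\<lambda>x. h x * \<phi> x) \<and>
        (1/2) * (LINT z : D_set \<Omega> | nu_w s p \<beta>.
            Lp_phi p (w (fst z) - w (snd z)) * (\<phi> (fst z) - \<phi> (snd z)))
          = (LINT x : \<Omega> | lebesgue. h x * \<phi> x))"

definition R_set :: "('a \<Rightarrow> real) \<Rightarrow> real \<Rightarrow> ('a \<times> 'a) set" where
  "R_set u h = {(x, y). h + 1 \<le> max \<bar>u x\<bar> \<bar>u y\<bar> \<and>
                        (min \<bar>u x\<bar> \<bar>u y\<bar> \<le> h \<or> u x * u y < 0)}"

definition ess_bounded :: "('a::euclidean_space \<Rightarrow> real) \<Rightarrow> bool" where
  "ess_bounded \<phi> \<longleftrightarrow> (\<exists>C. AE x in lebesgue. \<bar>\<phi> x\<bar> \<le> C)"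

definition entropy_solution ::
  "'a::euclidean_space set \<Rightarrow> real \<Rightarrow> real \<Rightarrow> real \<Rightarrow> ('a \<Rightarrow> real) \<Rightarrow> ('a \<Rightarrow> real) \<Rightarrow> bool" where
  "entropy_solution \<Omega> s p \<beta> f u \<longleftrightarrow>
     u \<in> borel_measurable lebesgue \<and> (\<forall>x. x \<notin> \<Omega> \<longrightarrow> u x = 0) \<and>
     (\<forall>k>0. (\<lambda>x. Tk k (u x)) \<in> Wsp0 \<Omega> s p \<beta>) \<and>
     ((\<lambda>h. \<integral>\<^sup>+ z \<in> R_set u h. ennreal (\<bar>u (fst z) - u (snd z)\<bar> powr (p - 1)) \<partial>nu_w s p \<beta>)
        \<longlongrightarrow> 0) at_top \<and>
     (\<forall>k>0. \<forall>\<phi>\<in>Wsp0 \<Omega> s p \<beta>. ess_bounded \<phi> \<longrightarrow>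
        set_integrable (nu_w s p \<beta>) (D_set \<Omega>)
          (\<lambda>z. Lp_phi p (u (fst z) - u (snd z)) *
                (Tk k (u (fst z) - \<phi> (fst z)) - Tk k (u (snd z) - \<phi> (snd z)))) \<and>
        (1/2) * (LINT z : D_set \<Omega> | nu_w s p \<beta>.
            Lp_phi p (u (fst z) - u (snd z)) *
                (Tk k (u (fst z) - \<phi> (fst z)) - Tk k (u (snd z) - \<phi> (snd z))))
          \<le> (LINT x : \<Omega> | lebesgue. f x * Tk k (u x - \<phi> x)))"

end

theory Submission
  imports Defs
begin

text \<open>
  Existence: for every \<open>M\<close> the energy \<open>(1/2p) \<integral>\<integral> |w(x) - w(y)|\<^sup>p d\<nu> - \<integral> f w\<close> is minimised over
  the functions of finite energy bounded by \<open>M\<close>. The variational inequality of this obstacle problem,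
  tested with \<open>w - T\<^sub>k(w - \<phi>)\<close>, is already the entropy inequality. The minimisers increase with \<open>M\<close>
  (here \<open>f \<ge> 0\<close> enters), and Fatou's lemma carries the entropy inequality to their limit \<open>u\<close>, because its
  integrand is bounded below by \<open>- |\<phi>(x) - \<phi>(y)|\<^sup>p\<close> whatever \<open>u\<close> is. Smooth compactly supported \<open>\<phi>\<close> come
  first; for general \<open>\<phi>\<close> the interaction with the exterior, which need not have finite energy, is
  dominated by the flux \<open>\<integral>\<integral> |u(x) - u(y)|\<^sup>p\<^sup>-\<^sup>1 d\<nu>\<close> into the exterior, which is at most twice the mass of \<open>f\<close>.

  Stability: if \<open>v\<close> satisfies the entropy inequality with datum \<open>g\<close>, testing \<open>v\<close> with the minimiser \<open>w\<close>
  and \<open>w\<close> with \<open>T\<^sub>M v\<close> bounds the monotonicity gap of \<open>v\<close> and \<open>u\<close> along \<open>T\<^sub>k(v - u)\<close> by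
  \<open>2 \<integral> (g - f) T\<^sub>k(v - u)\<close>. With \<open>g = f\<close> this is uniqueness. With \<open>g = T\<^sub>n f\<close> it gives convergence almost
  everywhere; as \<open>u\<close> satisfies the entropy relation for \<open>T\<^sub>k u\<close> with equality, Scheffe's lemma turns this
  into strong convergence of the truncations.
\<close>

section \<open>Pointwise inequalities\<close>

text \<open>The norm of \<open>Wsp0\<close> only sees \<Omega> x \<Omega>, while the weak form also
  contains the pairs with one point outside \<Omega>, and the datum is merely integrable. Hence the
  minimisation runs over bounded functions whose energy over the whole product is finite: there both
  the form and the pairing with f make sense. The minimisers have no uniform bound; that their
  increasing limit is finite almost everywhere comes from the flux into the exterior. Weak
  compactness is replaced by uniform convexity: elements of almost least energy, one from each of a
  decreasing sequence of convex sets, form a Cauchy sequence. This yields the minimisers, and later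
  puts \<open>Tk k u\<close> into the space, the sets there being squeezed between
  \<open>Tk k (sol m)\<close> and \<open>Tk k u\<close>. The energy carries 1/(2p) so that its first
  variation is the form with the factor 1/2; the factors 2 in the estimates clear that 1/2. In the
  stability argument the competitor v may be unbounded, which is why the minimiser is tested with a
  truncation of v; the mismatch is paid by energies of high level bands, and these are bounded by
  tails of g and f.\<close>

lemma Lp_phi_eq_sgn: "Lp_phi p a = sgn a * \<bar>a\<bar> powr (p - 1)"
proof (cases "a = 0")
  case False
  have "\<bar>a\<bar> powr (p - 1) = \<bar>a\<bar> powr (p - 2) * \<bar>a\<bar>"
    using False powr_add[of "\<bar>a\<bar>" "p - 2" 1] by simp
  then show ?thesis
    by (simp add: Lp_phi_def mult.left_commute mult.commute[of "sgn a"] mult_sgn_abs abs_mult_sgn)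
qed (simp add: Lp_phi_def)

lemma Lp_phi_0 [simp]: "Lp_phi p 0 = 0"
  by (simp add: Lp_phi_def)

lemma Lp_phi_minus: "Lp_phi p (- a) = - Lp_phi p a"
  by (simp add: Lp_phi_def)

lemma abs_Lp_phi: "\<bar>Lp_phi p a\<bar> = \<bar>a\<bar> powr (p - 1)"
  by (simp add: Lp_phi_eq_sgn abs_mult abs_sgn_eq)

lemma powr_minus_one_mult_abs: "\<bar>a :: real\<bar> powr (p - 1) * \<bar>a\<bar> = \<bar>a\<bar> powr p"
proof (cases "a = 0")
  case False
  then show ?thesis using powr_add[of "\<bar>a\<bar>" "p - 1" 1] by simp
qed simp

lemma Lp_phi_mult_self: "Lp_phi p a * a = \<bar>a\<bar> powr p"
proof -
  have "Lp_phi p a * a = \<bar>a\<bar> powr (p - 1) * (a * sgn a)" by (simp add: Lp_phi_eq_sgn)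
  also have "a * sgn a = \<bar>a\<bar>" by (simp add: abs_sgn)
  finally show ?thesis by (simp add: powr_minus_one_mult_abs)
qed

lemma Lp_phi_strict_mono:
  assumes "1 < p" "a < b" shows "Lp_phi p a < Lp_phi p b"
proof -
  consider "0 \<le> a" | "b \<le> 0" | "a < 0" "0 < b" using assms by linarith
  then show ?thesis
  proof cases
    case 1
    then show ?thesis using assms powr_less_mono2[of "p - 1" a b]
      by (cases "a = 0") (auto simp: Lp_phi_eq_sgn)
  next
    case 2
    then show ?thesis using assms powr_less_mono2[of "p - 1" "- b" "- a"]
      by (cases "b = 0") (auto simp: Lp_phi_eq_sgn)
  qed (auto simp: Lp_phi_eq_sgn intro: less_trans[of _ 0])
qed

lemma Lp_phi_mono: "1 < p \<Longrightarrow> a \<le> b \<Longrightarrow> Lp_phi p a \<le> Lp_phi p b"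
  using Lp_phi_strict_mono[of p a b] by (cases "a = b") auto

lemma Lp_phi_le_iff: "1 < p \<Longrightarrow> Lp_phi p a \<le> Lp_phi p b \<longleftrightarrow> a \<le> b"
  using Lp_phi_strict_mono[of p b a] Lp_phi_mono[of p a b] by (meson linorder_not_le)

lemma Lp_phi_nonneg_iff: "1 < p \<Longrightarrow> 0 \<le> Lp_phi p a \<longleftrightarrow> 0 \<le> a"
  using Lp_phi_le_iff[of p 0 a] by simp

lemma Lp_phi_fun_eq: "Lp_phi p = (\<lambda>a. \<bar>a\<bar> powr (p - 2) * a)"
  by (rule ext) (rule Lp_phi_def)

lemma isCont_Lp_phi:
  assumes "1 < p" shows "isCont (Lp_phi p) a"
proof (cases "a = 0")
  case False
  then show ?thesis
    unfolding isCont_def Lp_phi_fun_eq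
    by (intro tendsto_mult tendsto_powr tendsto_rabs tendsto_ident_at tendsto_const) auto
next
  \<comment> \<open>For p < 2 the factor \<open>\<bar>a\<bar> powr (p - 2)\<close> is singular at 0,
    so continuity there goes through the absolute value, whose exponent p - 1 is positive.\<close>
  case True
  have "((\<lambda>x::real. \<bar>x\<bar> powr (p - 1)) \<longlongrightarrow> \<bar>0\<bar> powr (p - 1)) (at 0)"
    by (rule tendsto_powr'[OF tendsto_rabs[OF tendsto_ident_at] tendsto_const]) (use assms in auto)
  then have "((\<lambda>x. \<bar>Lp_phi p x\<bar>) \<longlongrightarrow> 0) (at 0)"
    unfolding abs_Lp_phi by simp
  then have "(Lp_phi p \<longlongrightarrow> 0) (at 0)"
    by (rule tendsto_rabs_zero_cancel)
  then show ?thesis unfolding True isCont_def Lp_phi_0 .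
qed

lemma borel_measurable_Lp_phi [measurable]: "Lp_phi p \<in> borel_measurable borel"
  unfolding Lp_phi_fun_eq by measurable

lemma isCont_abs_powr: "1 < p \<Longrightarrow> isCont (\<lambda>a::real. \<bar>a\<bar> powr p) a"
  unfolding isCont_def by (rule tendsto_powr'[OF tendsto_rabs[OF tendsto_ident_at] tendsto_const]) auto

text \<open>A crude Young inequality, by comparison with the larger of x and y. It makes
  \<open>Lp_phi p a * b\<close> integrable as soon as the p-th powers of a and b are.\<close>

lemma powr_minus_one_mult_le:
  fixes x y :: real
  assumes "1 < p" "0 \<le> x" "0 \<le> y"
  shows "x powr (p - 1) * y \<le> x powr p + y powr p"
proof (cases "x \<le> y")
  case True
  have "x powr (p - 1) * y \<le> y powr (p - 1) * y"
    using assms True by (intro mult_right_mono powr_mono2) auto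
  also have "\<dots> = y powr p" using powr_minus_one_mult_abs[of y p] assms by simp
  finally show ?thesis by (smt (verit) powr_ge_zero)
next
  case False
  have "x powr (p - 1) * y \<le> x powr (p - 1) * x"
    using False by (intro mult_left_mono) auto
  also have "\<dots> = x powr p" using powr_minus_one_mult_abs[of x p] assms by simp
  finally show ?thesis by (smt (verit) powr_ge_zero)
qed

lemma abs_powr_add_le:
  fixes a b :: real
  assumes "0 < p"
  shows "\<bar>a + b\<bar> powr p \<le> 2 powr p * (\<bar>a\<bar> powr p + \<bar>b\<bar> powr p)"
proof -
  define m where "m = max \<bar>a\<bar> \<bar>b\<bar>"
  have "\<bar>a + b\<bar> powr p \<le> (2 * m) powr p"
    using assms by (intro powr_mono2) (auto simp: m_def)
  also have "\<dots> = 2 powr p * m powr p" by (simp add: m_def powr_mult)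
  also have "m powr p \<le> \<bar>a\<bar> powr p + \<bar>b\<bar> powr p" by (auto simp: m_def max_def)
  finally show ?thesis by simp
qed

lemma abs_powr_diff_le:
  fixes a b :: real
  assumes "0 < p"
  shows "\<bar>a - b\<bar> powr p \<le> 2 powr p * (\<bar>a\<bar> powr p + \<bar>b\<bar> powr p)"
  using abs_powr_add_le[OF assms, of a "- b"] by simp

text \<open>Convexity of the p-th power in tangent form: Young's inequality with the conjugate
  exponent q splits the cross term into p-th powers.\<close>

lemma abs_powr_tangent:
  assumes p: "1 < p"
  shows "\<bar>c\<bar> powr p + p * Lp_phi p c * (a - c) \<le> \<bar>a\<bar> powr p"
proof -
  define q where "q = p / (p - 1)"
  have q: "q > 1" "1 / p + 1 / q = 1" "(p - 1) * q = p" using p by (auto simp: q_def field_simps)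
  have "\<bar>a\<bar> * \<bar>c\<bar> powr (p - 1) \<le> \<bar>a\<bar> powr p / p + (\<bar>c\<bar> powr (p - 1)) powr q / q"
    using p q by (intro Youngs_inequality) auto
  also have "(\<bar>c\<bar> powr (p - 1)) powr q = \<bar>c\<bar> powr p" using q by (simp add: powr_powr)
  finally have "p * (\<bar>a\<bar> * \<bar>c\<bar> powr (p - 1)) \<le> p * (\<bar>a\<bar> powr p / p + \<bar>c\<bar> powr p / q)"
    using p by (intro mult_left_mono) auto
  also have "\<dots> = \<bar>a\<bar> powr p + (p - 1) * \<bar>c\<bar> powr p" using p by (simp add: q_def field_simps)
  finally have *: "p * (\<bar>a\<bar> * \<bar>c\<bar> powr (p - 1)) \<le> \<bar>a\<bar> powr p + (p - 1) * \<bar>c\<bar> powr p" .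
  have "p * (Lp_phi p c * a) \<le> p * (\<bar>a\<bar> * \<bar>c\<bar> powr (p - 1))"
    using p abs_Lp_phi[of p c] by (intro mult_left_mono) (metis abs_ge_self abs_mult mult.commute, simp)
  then have "p * Lp_phi p c * (a - c) \<le> p * (\<bar>a\<bar> * \<bar>c\<bar> powr (p - 1)) - p * \<bar>c\<bar> powr p"
    using Lp_phi_mult_self[of p c] by (simp add: algebra_simps)
  then show ?thesis using * by (simp add: algebra_simps)
qed

text \<open>The tangent at c, taken up to the midpoint m, is chained with the tangent at m;
  strictness comes from \<open>Lp_phi\<close> being strictly increasing between c and m.\<close>

lemma abs_powr_tangent_strict:
  assumes p: "1 < p" and "a \<noteq> c"
  shows "\<bar>c\<bar> powr p + p * Lp_phi p c * (a - c) < \<bar>a\<bar> powr p"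
proof -
  define m where "m = (a + c) / 2"
  have "Lp_phi p c * (a - c) < Lp_phi p m * (a - c)"
  proof (cases "c < a")
    case True
    then show ?thesis using Lp_phi_strict_mono[OF p, of c m] by (simp add: m_def)
  next
    case False
    then show ?thesis using assms Lp_phi_strict_mono[OF p, of m c] by (simp add: m_def)
  qed
  then have "p * (Lp_phi p c * (a - c)) < p * (Lp_phi p m * (a - c))" using p by simp
  moreover have "\<bar>m\<bar> powr p + p * Lp_phi p m * (a - m) \<le> \<bar>a\<bar> powr p"
    "\<bar>c\<bar> powr p + p * Lp_phi p c * (m - c) \<le> \<bar>m\<bar> powr p"
    by (rule abs_powr_tangent[OF p])+
  ultimately show ?thesis by (simp add: m_def field_simps)
qed

lemma abs_powr_midpoint_strict:
  fixes a b :: real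
  assumes "1 < p" "a \<noteq> b"
  shows "\<bar>(a + b) / 2\<bar> powr p < (\<bar>a\<bar> powr p + \<bar>b\<bar> powr p) / 2"
  using abs_powr_tangent_strict[of p a "(a + b) / 2"] abs_powr_tangent_strict[of p b "(a + b) / 2"] assms
  by (simp add: field_simps)

lemma abs_powr_midpoint:
  fixes a b :: real
  assumes "1 < p"
  shows "\<bar>(a + b) / 2\<bar> powr p \<le> (\<bar>a\<bar> powr p + \<bar>b\<bar> powr p) / 2"
  using abs_powr_midpoint_strict[of p a b] assms by (cases "a = b") auto

text \<open>Compactness gives uniform convexity for every p > 1 at once. Both sides are homogeneous
  of degree p; on the compact set T of normalised pairs that are far apart, the convexity defect E
  is continuous and positive, hence at least some \<delta> > 0. Pairs that are close together are
  absorbed by the \<epsilon> term.\<close>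

lemma abs_powr_uniformly_convex:
  fixes p \<epsilon> :: real
  assumes p: "1 < p" and e: "0 < \<epsilon>"
  obtains C where "0 < C"
    "\<And>a b. \<bar>a - b\<bar> powr p \<le> \<epsilon> * (\<bar>a\<bar> powr p + \<bar>b\<bar> powr p) +
       C * ((\<bar>a\<bar> powr p + \<bar>b\<bar> powr p) / 2 - \<bar>(a + b) / 2\<bar> powr p)"
proof -
  define E where "E = (\<lambda>z. (\<bar>fst z\<bar> powr p + \<bar>snd z\<bar> powr p) / 2 - \<bar>(fst z + snd z) / 2\<bar> powr p)"
  define T where "T = {z :: real \<times> real. max \<bar>fst z\<bar> \<bar>snd z\<bar> = 1 \<and> \<epsilon> \<le> \<bar>fst z - snd z\<bar> powr p}"
  have cont: "continuous_on UNIV (\<lambda>z. \<bar>g z\<bar> powr p)" if "continuous_on UNIV g" for g :: "real \<times> real \<Rightarrow> real"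
    using that p by (intro continuous_on_powr' continuous_intros) auto
  have contE: "continuous_on T E"
    unfolding E_def by (rule continuous_on_subset[of UNIV]) (intro continuous_intros cont, auto)
  have "closed T" unfolding T_def
    by (intro closed_Collect_conj closed_Collect_eq closed_Collect_le cont continuous_intros)
  moreover have "T \<subseteq> cbox (-1, -1) (1, 1)"
    by (auto simp: T_def cbox_Pair_eq)
  ultimately have "compact T" by (meson bounded_cbox bounded_subset compact_eq_bounded_closed)
  obtain \<delta> where d: "0 < \<delta>" "\<And>z. z \<in> T \<Longrightarrow> \<delta> \<le> E z"
  proof (cases "T = {}")
    case False
    then obtain z where z: "z \<in> T" "\<And>y. y \<in> T \<Longrightarrow> E z \<le> E y"
      using continuous_attains_inf[OF \<open>compact T\<close> _ contE] by blast
    have "fst z \<noteq> snd z" using z(1) e by (auto simp: T_def)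
    then have "0 < E z" using abs_powr_midpoint_strict[OF p, of "fst z" "snd z"] by (simp add: E_def)
    then show ?thesis using that z by blast
  \<comment> \<open>T may be empty, since normalised pairs differ by at most 2; any \<delta> then
    serves.\<close>
  qed (use that[of 1] in auto)
  \<comment> \<open>The constant relates the trivial bound \<open>2 * t\<close> for the difference
    to the lower bound \<open>t powr p * \<delta>\<close> for the defect.\<close>
  show ?thesis
  proof (rule that[of "2 powr p / \<delta>"])
    show "0 < 2 powr p / \<delta>" using d by simp
    fix a b :: real
    define t where "t = max \<bar>a\<bar> \<bar>b\<bar>"
    have Enn: "0 \<le> (\<bar>a\<bar> powr p + \<bar>b\<bar> powr p) / 2 - \<bar>(a + b) / 2\<bar> powr p"
      using abs_powr_midpoint[OF p, of a b] by simp
    have tle: "t powr p \<le> \<bar>a\<bar> powr p + \<bar>b\<bar> powr p" by (auto simp: t_def max_def)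
    show "\<bar>a - b\<bar> powr p \<le> \<epsilon> * (\<bar>a\<bar> powr p + \<bar>b\<bar> powr p) +
       2 powr p / \<delta> * ((\<bar>a\<bar> powr p + \<bar>b\<bar> powr p) / 2 - \<bar>(a + b) / 2\<bar> powr p)"
    proof (cases "\<bar>a - b\<bar> powr p \<le> \<epsilon> * t powr p")
      case True
      have "\<epsilon> * t powr p \<le> \<epsilon> * (\<bar>a\<bar> powr p + \<bar>b\<bar> powr p)" using tle e by simp
      moreover have "0 \<le> 2 powr p / \<delta> * ((\<bar>a\<bar> powr p + \<bar>b\<bar> powr p) / 2 - \<bar>(a + b) / 2\<bar> powr p)"
        using Enn d by simp
      ultimately show ?thesis using True by linarith
    next
      case False
      have t: "t > 0"
      proof (rule ccontr)
        assume "\<not> t > 0"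
        then have "a = 0" "b = 0" by (auto simp: t_def)
        then show False using False e by simp
      qed
      have sc: "\<bar>t * c\<bar> powr p = t powr p * \<bar>c\<bar> powr p" for c
        using t by (simp add: abs_mult powr_mult)
      define x y where "x = a / t" and "y = b / t"
      have a: "a = t * x" and b: "b = t * y" using t by (auto simp: x_def y_def)
      have d1: "a - b = t * (x - y)" and d2: "(a + b) / 2 = t * ((x + y) / 2)"
        by (auto simp: a b field_simps)
      have "(x, y) \<in> T"
      proof -
        have "max \<bar>x\<bar> \<bar>y\<bar> = 1"
        proof -
          have "t * max \<bar>x\<bar> \<bar>y\<bar> = max \<bar>a\<bar> \<bar>b\<bar>"
            unfolding a b using t by (simp add: abs_mult max_mult_distrib_left)
          then show ?thesis using t by (simp add: t_def)
        qed
        moreover have "\<epsilon> * t powr p < t powr p * \<bar>x - y\<bar> powr p"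
          using False unfolding d1 sc by simp
        ultimately show ?thesis using t by (simp add: T_def mult.commute)
      qed
      then have "t powr p * \<delta> \<le> t powr p * E (x, y)" using d(2) by (intro mult_left_mono) auto
      also have "\<dots> = (\<bar>a\<bar> powr p + \<bar>b\<bar> powr p) / 2 - \<bar>(a + b) / 2\<bar> powr p"
        unfolding d2 sc unfolding a b sc E_def by (simp add: algebra_simps)
      finally have 1: "2 powr p / \<delta> * (t powr p * \<delta>) \<le>
          2 powr p / \<delta> * ((\<bar>a\<bar> powr p + \<bar>b\<bar> powr p) / 2 - \<bar>(a + b) / 2\<bar> powr p)"
        using d by (intro mult_left_mono) auto
      have "\<bar>a - b\<bar> powr p \<le> (2 * t) powr p" using p by (intro powr_mono2) (auto simp: t_def)
      also have "\<dots> = 2 powr p / \<delta> * (t powr p * \<delta>)" using d t by (simp add: powr_mult)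
      also note 1
      moreover have "0 \<le> \<epsilon> * (\<bar>a\<bar> powr p + \<bar>b\<bar> powr p)" using e by simp
      ultimately show ?thesis by linarith
    qed
  qed
qed

section \<open>Truncations and excesses above a level\<close>

lemma Tk_0: "0 \<le> k \<Longrightarrow> Tk k 0 = 0"
  by (auto simp: Tk_def)

lemma abs_Tk_le: "0 \<le> k \<Longrightarrow> \<bar>Tk k a\<bar> \<le> k"
  by (auto simp: Tk_def)

lemma abs_Tk_le_abs: "0 \<le> k \<Longrightarrow> \<bar>Tk k a\<bar> \<le> \<bar>a\<bar>"
  by (auto simp: Tk_def)

lemma Tk_minus: "0 \<le> k \<Longrightarrow> Tk k (- a) = - Tk k a"
  by (auto simp: Tk_def)

lemma Tk_mono: "a \<le> b \<Longrightarrow> Tk k a \<le> Tk k b"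
  by (auto simp: Tk_def)

lemma Tk_diff_le: "a \<le> b \<Longrightarrow> Tk k b - Tk k a \<le> b - a"
  by (auto simp: Tk_def)

lemma abs_Tk_diff_le: "\<bar>Tk k a - Tk k b\<bar> \<le> \<bar>a - b\<bar>"
  by (auto simp: Tk_def)

text \<open>A combination of two maps a -> |a + c| - |c|, each vanishing at 0. For these maps alone
  is invariance of the energy space proved by approximation.\<close>

lemma Tk_eq_abs: "0 \<le> k \<Longrightarrow> Tk k a = ((\<bar>a + k\<bar> - \<bar>k\<bar>) - (\<bar>a + - k\<bar> - \<bar>- k\<bar>)) / 2"
  by (auto simp: Tk_def)

lemma Tk_id: "\<bar>a\<bar> \<le> k \<Longrightarrow> Tk k a = a"
  by (auto simp: Tk_def)

lemma Tk_fun_eq: "Tk k = (\<lambda>a. max (- k) (min k a))"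
  by (rule ext) (rule Tk_def)

lemma isCont_Tk: "isCont (Tk k) a"
  unfolding Tk_fun_eq isCont_def by (intro tendsto_max tendsto_min tendsto_const tendsto_ident_at)

lemma borel_measurable_Tk [measurable]: "Tk k \<in> borel_measurable borel"
  unfolding Tk_fun_eq by measurable

text \<open>A truncation increment is a sub-increment of its argument, so only the size of the increment of
  the test function can make the left-hand side negative; no information on \<open>u\<close> enters.\<close>
lemma Lp_phi_mult_Tk_shift_ge:
  assumes p: "1 < p"
  shows "- (\<bar>c - d\<bar> powr p) \<le> Lp_phi p (u - v) * (Tk k (u - c) - Tk k (v - d))"
proof -
  have *: "- (\<bar>c - d\<bar> powr p) \<le> Lp_phi p (u - v) * (Tk k (u - c) - Tk k (v - d))"
    if uv: "v \<le> u" for u v c d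
  proof (cases "v - d \<le> u - c")
    case True
    then have "0 \<le> Lp_phi p (u - v) * (Tk k (u - c) - Tk k (v - d))"
      using uv p by (intro mult_nonneg_nonneg) (auto simp: Lp_phi_nonneg_iff Tk_mono)
    then show ?thesis by (smt (verit) powr_ge_zero)
  next
    case False
    \<comment> \<open>The truncated increment has the sign opposite to u - v. This forces u - v
      below c - d, so both factors are controlled by powers of c - d.\<close>
    have le: "Tk k (v - d) - Tk k (u - c) \<le> (c - d) - (u - v)" "u - v \<le> c - d"
      using Tk_diff_le[of "u - c" "v - d" k] False by auto
    have "Lp_phi p (u - v) * (Tk k (v - d) - Tk k (u - c)) \<le> \<bar>c - d\<bar> powr (p - 1) * \<bar>c - d\<bar>"
    proof (intro mult_mono)
      show "Lp_phi p (u - v) \<le> \<bar>c - d\<bar> powr (p - 1)"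
        using abs_Lp_phi[of p "u - v"] uv le p powr_mono2[of "p - 1" "\<bar>u - v\<bar>" "\<bar>c - d\<bar>"] by auto
    qed (use le uv False Tk_mono[of "u - c" "v - d" k] in auto)
    also have "\<dots> = \<bar>c - d\<bar> powr p" by (rule powr_minus_one_mult_abs)
    finally show ?thesis by (simp add: algebra_simps)
  qed
  show ?thesis
  proof (cases "v \<le> u")
    case False
    have "- (\<bar>d - c\<bar> powr p) \<le> Lp_phi p (v - u) * (Tk k (v - d) - Tk k (u - c))"
      using *[of u v d c] False by simp
    moreover have "Lp_phi p (v - u) = - Lp_phi p (u - v)" using Lp_phi_minus[of p "u - v"] by simp
    ultimately show ?thesis by (simp add: abs_minus_commute algebra_simps)
  qed (rule *)
qed

text \<open>As t powr (p - 1) is increasing, an increment of the right sign that does not exceed the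
  full one can replace it inside \<open>Lp_phi\<close>. This is the source of all energy bounds:
  testing with a truncation or an excess controls the energy of that test function.\<close>

lemma Lp_phi_mult_subincrement_ge:
  assumes p: "1 < p" and "0 \<le> (a - b) * (c - d)" "\<bar>c - d\<bar> \<le> \<bar>a - b\<bar>"
  shows "\<bar>c - d\<bar> powr p \<le> Lp_phi p (a - b) * (c - d)"
proof -
  have "Lp_phi p (a - b) * (c - d) = \<bar>Lp_phi p (a - b)\<bar> * \<bar>c - d\<bar>"
    using assms by (auto simp: Lp_phi_eq_sgn abs_mult zero_le_mult_iff sgn_if)
  also have "\<dots> = \<bar>a - b\<bar> powr (p - 1) * \<bar>c - d\<bar>" by (simp add: abs_Lp_phi)
  also have "\<dots> \<ge> \<bar>c - d\<bar> powr (p - 1) * \<bar>c - d\<bar>"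
    using assms by (intro mult_right_mono powr_mono2) auto
  finally show ?thesis by (simp add: powr_minus_one_mult_abs)
qed

lemma Lp_phi_mult_Tk_ge:
  assumes p: "1 < p"
  shows "\<bar>Tk k a - Tk k b\<bar> powr p \<le> Lp_phi p (a - b) * (Tk k a - Tk k b)"
proof (rule Lp_phi_mult_subincrement_ge[OF p _ abs_Tk_diff_le])
  show "0 \<le> (a - b) * (Tk k a - Tk k b)"
    using Tk_mono[of a b k] Tk_mono[of b a k] by (cases "a \<le> b") (auto simp: zero_le_mult_iff)
qed

lemma Tk_excess_mono: "0 \<le> k \<Longrightarrow> a \<le> b \<Longrightarrow> Tk k (a - Tk h a) \<le> Tk k (b - Tk h b)"
  using Tk_diff_le[of a b h] by (intro Tk_mono) auto

lemma abs_Tk_excess_diff_le: "0 \<le> k \<Longrightarrow> \<bar>Tk k (a - Tk h a) - Tk k (b - Tk h b)\<bar> \<le> \<bar>a - b\<bar>"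
  using Tk_excess_mono[of k a b h] Tk_excess_mono[of k b a h] Tk_mono[of a b h] Tk_mono[of b a h]
    Tk_diff_le[of a b h] Tk_diff_le[of b a h] abs_Tk_diff_le[of k "a - Tk h a" "b - Tk h b"] by linarith

lemma Tk_excess_incr_nonneg: "0 \<le> k \<Longrightarrow> 0 \<le> (a - b) * (Tk k (a - Tk h a) - Tk k (b - Tk h b))"
  using Tk_excess_mono[of k a b h] Tk_excess_mono[of k b a h]
  by (cases "a \<le> b") (auto simp: zero_le_mult_iff)

lemma Lp_phi_mult_Tk_excess_ge:
  assumes p: "1 < p" and k: "0 \<le> k"
  shows "\<bar>Tk k (a - Tk h a) - Tk k (b - Tk h b)\<bar> powr p \<le>
    Lp_phi p (a - b) * (Tk k (a - Tk h a) - Tk k (b - Tk h b))"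
  by (rule Lp_phi_mult_subincrement_ge[OF p Tk_excess_incr_nonneg[OF k] abs_Tk_excess_diff_le[OF k]])

lemma Lp_phi_diff_mult_nonneg:
  assumes p: "1 < p" and "0 \<le> ((a - b) - (c - d)) * e"
  shows "0 \<le> (Lp_phi p (a - b) - Lp_phi p (c - d)) * e"
  using assms Lp_phi_mono[OF p, of "a - b" "c - d"] Lp_phi_mono[OF p, of "c - d" "a - b"]
  by (auto simp: zero_le_mult_iff)

lemma Lp_phi_monotone_Tk:
  assumes p: "1 < p"
  shows "0 \<le> (Lp_phi p (a - b) - Lp_phi p (c - d)) * (Tk k (a - c) - Tk k (b - d))"
proof (rule Lp_phi_diff_mult_nonneg[OF p])
  show "0 \<le> ((a - b) - (c - d)) * (Tk k (a - c) - Tk k (b - d))"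
    using Tk_mono[of "a - c" "b - d" k] Tk_mono[of "b - d" "a - c" k]
    by (cases "a - c \<le> b - d") (auto simp: zero_le_mult_iff)
qed

lemma Lp_phi_monotone_pos_part:
  assumes p: "1 < p"
  shows "0 \<le> (Lp_phi p (a - b) - Lp_phi p (c - d)) * (max 0 (a - c) - max 0 (b - d))"
  by (rule Lp_phi_diff_mult_nonneg[OF p]) (auto simp: zero_le_mult_iff max_def)

text \<open>Testing \<open>v\<close> with \<open>w\<close> but \<open>w\<close> only with \<open>T\<^sub>M v\<close> costs errors supported in high level bands.\<close>
lemma truncated_test_error:
  assumes p: "1 < p" and k: "0 < k" "k \<le> M" and w: "0 \<le> w" "w \<le> M" "0 \<le> w'" "w' \<le> M"
  shows "(Lp_phi p (v - v') - Lp_phi p (w - w')) * (Tk k (v - w) - Tk k (v' - w'))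
      - 3 * (\<bar>Tk k (v - Tk M v) - Tk k (v' - Tk M v')\<bar> powr p
           + \<bar>Tk k (w - Tk (M - k) w) - Tk k (w' - Tk (M - k) w')\<bar> powr p)
    \<le> Lp_phi p (v - v') * (Tk k (v - w) - Tk k (v' - w'))
      + Lp_phi p (w - w') * (Tk k (w - Tk M v) - Tk k (w' - Tk M v'))"
proof -
  \<comment> \<open>If w were tested with v itself, the two test functions would cancel. r and r'
    record the failure to cancel at the two points, and the claim reduces to a lower bound for
    \<open>Lp_phi p (w - w') * (r - r')\<close>.\<close>
  define r where "r = Tk k (v - w) + Tk k (w - Tk M v)"
  define r' where "r' = Tk k (v' - w') + Tk k (w' - Tk M v')"
  define \<tau> where "\<tau> = \<bar>Tk k (v - Tk M v) - Tk k (v' - Tk M v')\<bar>"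
  define \<sigma> where "\<sigma> = \<bar>Tk k (w - Tk (M - k) w) - Tk k (w' - Tk (M - k) w')\<bar>"
  have nn: "0 \<le> 3 * (\<tau> powr p + \<sigma> powr p)" by simp
  have "- (3 * (\<tau> powr p + \<sigma> powr p)) \<le> Lp_phi p (w - w') * (r - r')"
  proof -
    \<comment> \<open>r vanishes when w is at most M - k and is nonnegative when w lies above. In
      the mixed cases r - r' therefore has the sign of w - w', and only pairs with both values above
      M - k cost anything.\<close>
    consider "w \<le> M - k" "w' \<le> M - k" | "w' \<le> M - k" "M - k < w" | "w \<le> M - k" "M - k < w'"
      | "M - k < w" "M - k < w'" by linarith
    then show ?thesis
    proof cases
      case 1
      then have "r = 0" "r' = 0" using k w by (auto simp: r_def r'_def Tk_def)
      then have "Lp_phi p (w - w') * (r - r') = 0" by simp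
      then show ?thesis using nn by linarith
    next
      case 2
      then have "r' = 0" "0 \<le> r" using k w by (auto simp: r_def r'_def Tk_def)
      then have "0 \<le> Lp_phi p (w - w') * (r - r')" using p 2 by (simp add: Lp_phi_nonneg_iff)
      then show ?thesis using nn by linarith
    next
      case 3
      then have "r = 0" "0 \<le> r'" using k w by (auto simp: r_def r'_def Tk_def)
      then have "Lp_phi p (w' - w) * r' \<ge> 0" using p 3 by (simp add: Lp_phi_nonneg_iff)
      then have "0 \<le> Lp_phi p (w - w') * (r - r')"
        using Lp_phi_minus[of p "w - w'"] \<open>r = 0\<close> by simp
      then show ?thesis using nn by linarith
    next
      case 4
      have s: "\<bar>w - w'\<bar> = \<sigma>" using 4 w k by (auto simp: \<sigma>_def Tk_def)
      \<comment> \<open>For y above M - k the sum depends on x only through the positive excess over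
        M, cut at k. Its increments are thus at most \<tau> plus twice those of w, and the latter
        equal \<sigma> because no truncation acts there.\<close>
      have "Tk k (x - y) + Tk k (y - Tk M x) = Tk k (M + max 0 (Tk k (x - Tk M x)) - y) - Tk k (M - y)"
        if "M - k < y" "y \<le> M" "0 \<le> y" for x y
      proof -
        consider "M < x" "x - M \<le> k" | "M < x" "k < x - M" | "\<bar>x\<bar> \<le> M" | "x < - M" by linarith
        then show ?thesis
        proof cases
          case 1
          then have "Tk M x = M" "Tk k (x - M) = x - M" using k by (auto simp: Tk_def)
          then show ?thesis using Tk_minus[of k "M - y"] k 1 by simp
        next
          case 2
          then have "Tk M x = M" "Tk k (x - M) = k" "Tk k (x - y) = k" "Tk k (M + k - y) = k"
            using k that by (auto simp: Tk_def)
          then show ?thesis using Tk_minus[of k "M - y"] k 2 by simp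
        next
          case 3
          then show ?thesis using Tk_minus[of k "x - y"] k by (simp add: Tk_id Tk_0)
        next
          case 4
          then have "Tk M x = - M" "Tk k (x + M) \<le> 0" "Tk k (x - y) = - k" "Tk k (y + M) = k"
            using k that by (auto simp: Tk_def)
          then show ?thesis by simp
        qed
      qed
      then have eqs: "r = Tk k (M + max 0 (Tk k (v - Tk M v)) - w) - Tk k (M - w)"
        "r' = Tk k (M + max 0 (Tk k (v' - Tk M v')) - w') - Tk k (M - w')"
        using 4 w by (auto simp: r_def r'_def)
      define x x' where "x = max 0 (Tk k (v - Tk M v))" and "x' = max 0 (Tk k (v' - Tk M v'))"
      have x: "\<bar>x - x'\<bar> \<le> \<tau>" unfolding x_def x'_def \<tau>_def by linarith
      have "\<bar>Tk k (M + x - w) - Tk k (M + x' - w')\<bar> \<le> \<bar>(M + x - w) - (M + x' - w')\<bar>"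
        "\<bar>Tk k (M - w) - Tk k (M - w')\<bar> \<le> \<bar>(M - w) - (M - w')\<bar>"
        by (rule abs_Tk_diff_le)+
      moreover have "\<bar>(M + x - w) - (M + x' - w')\<bar> \<le> \<tau> + \<bar>w - w'\<bar>"
        "\<bar>(M - w) - (M - w')\<bar> = \<bar>w - w'\<bar>" using x by linarith+
      ultimately have "\<bar>Tk k (M + x - w) - Tk k (M + x' - w')\<bar> \<le> \<tau> + \<bar>w - w'\<bar>"
        "\<bar>Tk k (M - w) - Tk k (M - w')\<bar> \<le> \<bar>w - w'\<bar>" by linarith+
      moreover have "\<bar>(e - f) - (e' - f')\<bar> \<le> \<bar>e - e'\<bar> + \<bar>f - f'\<bar>" for e f e' f' :: real
        by linarith
      ultimately have r: "\<bar>r - r'\<bar> \<le> \<tau> + 2 * \<bar>w - w'\<bar>"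
        unfolding eqs x_def[symmetric] x'_def[symmetric] by (smt (verit))
      have "\<bar>Lp_phi p (w - w') * (r - r')\<bar> \<le> \<sigma> powr (p - 1) * (\<tau> + 2 * \<sigma>)"
        using r by (simp add: abs_mult abs_Lp_phi s mult_left_mono)
      also have "\<dots> = \<sigma> powr (p - 1) * \<tau> + 2 * \<sigma> powr p"
        using powr_minus_one_mult_abs[of \<sigma> p] by (simp add: \<sigma>_def algebra_simps)
      also have "\<dots> \<le> 3 * (\<tau> powr p + \<sigma> powr p)"
      proof -
        have "0 \<le> \<sigma>" "0 \<le> \<tau>" by (auto simp: \<sigma>_def \<tau>_def)
        then show ?thesis using powr_minus_one_mult_le[OF p, of \<sigma> \<tau>] powr_ge_zero[of \<tau> p]
          unfolding distrib_left by linarith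
      qed
      finally show ?thesis by linarith
    qed
  qed
  then show ?thesis unfolding r_def r'_def \<tau>_def \<sigma>_def by (simp add: algebra_simps)
qed

section \<open>Smooth functions\<close>

text \<open>\<open>smooth_fun\<close> quantifies over all lists of directions. A set of continuous
  functions closed under directional derivatives treats all lists at once, without formulas for the
  higher derivatives.\<close>

lemma smooth_fun_coinduct:
  assumes "f \<in> S" and "\<And>g. g \<in> S \<Longrightarrow> continuous_on UNIV g"
    and "\<And>g v. g \<in> S \<Longrightarrow>
      \<exists>D\<in>S. \<forall>x. ((\<lambda>t. g (x + t *\<^sub>R v)) has_field_derivative D x) (at 0)"
  shows "smooth_fun f"
proof -
  have "dderiv vs f \<in> S" for vs
  proof (induction vs)
    case (Cons v vs)
    then obtain D where D: "D \<in> S" "\<And>x. ((\<lambda>t. dderiv vs f (x + t *\<^sub>R v)) has_field_derivative D x) (at 0)"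
      using assms(3) by blast
    then have "dderiv (v # vs) f = D" by (auto simp: fun_eq_iff intro!: DERIV_imp_deriv)
    then show ?case using D by simp
  qed (use assms in simp)
  then show ?thesis
    unfolding smooth_fun_def using assms(2,3) by (meson field_differentiable_def)
qed

text \<open>The algebra generated by the derivatives of functions \<open>g\<close> in \<open>B\<close> and the powers of
  \<open>sqrt ((g + c)\<^sup>2 + e\<^sup>2)\<close> with exponents \<open>1\<close> and \<open>-1\<close> is closed under differentiation.\<close>
inductive_set sqrt_algebra :: "('a::euclidean_space \<Rightarrow> real) set \<Rightarrow> real \<Rightarrow> real \<Rightarrow> ('a \<Rightarrow> real) set"
  for B c e where
  base: "g \<in> B \<Longrightarrow> dderiv vs g \<in> sqrt_algebra B c e"
| const: "(\<lambda>_. a) \<in> sqrt_algebra B c e"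
| root: "g \<in> B \<Longrightarrow> (\<lambda>x. sqrt ((g x + c)\<^sup>2 + e\<^sup>2)) \<in> sqrt_algebra B c e"
| inv: "g \<in> B \<Longrightarrow> (\<lambda>x. inverse (sqrt ((g x + c)\<^sup>2 + e\<^sup>2))) \<in> sqrt_algebra B c e"
| add: "g \<in> sqrt_algebra B c e \<Longrightarrow> h \<in> sqrt_algebra B c e \<Longrightarrow> (\<lambda>x. g x + h x) \<in> sqrt_algebra B c e"
| mult: "g \<in> sqrt_algebra B c e \<Longrightarrow> h \<in> sqrt_algebra B c e \<Longrightarrow> (\<lambda>x. g x * h x) \<in> sqrt_algebra B c e"

lemma sqrt_algebra_mem: "g \<in> B \<Longrightarrow> g \<in> sqrt_algebra B c e"
  using sqrt_algebra.base[of g B "[]"] by simp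

lemma smooth_fun_dderiv:
  assumes "smooth_fun g"
  shows "((\<lambda>t. dderiv vs g (x + t *\<^sub>R v)) has_field_derivative dderiv (v # vs) g x) (at 0)"
  using assms by (auto simp: smooth_fun_def intro: field_differentiable_derivI)

lemma smooth_fun_has_derivative:
  assumes "smooth_fun g"
  shows "((\<lambda>t. g (x + t *\<^sub>R v)) has_field_derivative dderiv [v] g x) (at 0)"
  using smooth_fun_dderiv[OF assms, of "[]"] by simp

lemma sqrt_sum_pos: "0 < e \<Longrightarrow> 0 < (a::real)\<^sup>2 + e\<^sup>2"
  by (simp add: sum_power2_gt_zero_iff)

lemma has_derivative_sqrt_square_sum:
  assumes e: "0 < e" and g: "(g has_field_derivative d) (at 0)"
  shows "((\<lambda>t::real. sqrt ((g t + c)\<^sup>2 + e\<^sup>2)) has_field_derivative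
    ((g 0 + c) * d) * inverse (sqrt ((g 0 + c)\<^sup>2 + e\<^sup>2))) (at 0)"
proof -
  have "((\<lambda>t. (g t + c)\<^sup>2 + e\<^sup>2) has_field_derivative 2 * ((g 0 + c) * d)) (at 0)"
    by (rule derivative_eq_intros refl g)+ simp
  moreover have "(sqrt has_field_derivative inverse (sqrt ((g 0 + c)\<^sup>2 + e\<^sup>2)) / 2) (at ((g 0 + c)\<^sup>2 + e\<^sup>2))"
    using sqrt_sum_pos[OF e] by (rule DERIV_real_sqrt)
  ultimately have "((\<lambda>t. sqrt ((g t + c)\<^sup>2 + e\<^sup>2)) has_field_derivative
      inverse (sqrt ((g 0 + c)\<^sup>2 + e\<^sup>2)) / 2 * (2 * ((g 0 + c) * d))) (at 0)"
    by (rule DERIV_chain2[rotated])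
  moreover have "i / 2 * (2 * ((g 0 + c) * d)) = ((g 0 + c) * d) * i" for i :: real by simp
  ultimately show ?thesis by (simp only:)
qed

lemma smooth_fun_sqrt_algebra:
  assumes B: "\<And>g. g \<in> B \<Longrightarrow> smooth_fun g" and e: "0 < e" and f: "f \<in> sqrt_algebra B c e"
  shows "smooth_fun f"
proof (rule smooth_fun_coinduct[OF f])
  have contB: "continuous_on UNIV g" if "g \<in> B" for g
    using B[OF that] unfolding smooth_fun_def by (metis dderiv.simps(1))
  fix g assume "g \<in> sqrt_algebra B c e"
  then show "continuous_on UNIV g"
  proof induction
    case (base g vs)
    then show ?case using B by (simp add: smooth_fun_def)
  next
    case (inv g)
    then show ?case using contB sqrt_sum_pos[OF e] by (intro continuous_intros) (auto simp: less_imp_neq[symmetric])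
  next
    case (root g)
    then show ?case using contB[OF root] by (intro continuous_intros)
  qed (auto intro!: continuous_intros)
next
  fix g v assume "g \<in> sqrt_algebra B c e"
  then show "\<exists>D\<in>sqrt_algebra B c e. \<forall>x. ((\<lambda>t. g (x + t *\<^sub>R v)) has_field_derivative D x) (at 0)"
  proof induction
    case (base g vs)
    then show ?case using smooth_fun_dderiv[OF B[OF base]] sqrt_algebra.base by blast
  next
    case (const a)
    show ?case by (intro bexI[of _ "\<lambda>_. 0"] sqrt_algebra.const) auto
  next
    case (root g)
    let ?D = "\<lambda>x. ((g x + c) * dderiv [v] g x) * inverse (sqrt ((g x + c)\<^sup>2 + e\<^sup>2))"
    have "((\<lambda>t. sqrt ((g (x + t *\<^sub>R v) + c)\<^sup>2 + e\<^sup>2)) has_field_derivative ?D x) (at 0)" for x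
      using has_derivative_sqrt_square_sum[OF e smooth_fun_has_derivative[OF B[OF root]], of x v c]
      by (simp del: dderiv.simps)
    moreover have "?D \<in> sqrt_algebra B c e"
      using root by (intro sqrt_algebra.intros(2-) sqrt_algebra.base sqrt_algebra_mem)
    ultimately show ?case by (intro bexI[of _ ?D] allI)
  next
    case (inv g)
    let ?q = "\<lambda>x. inverse (sqrt ((g x + c)\<^sup>2 + e\<^sup>2))"
    let ?D = "\<lambda>x. - 1 * (((g x + c) * dderiv [v] g x) * (?q x * (?q x * ?q x)))"
    have "((\<lambda>t. inverse (sqrt ((g (x + t *\<^sub>R v) + c)\<^sup>2 + e\<^sup>2))) has_field_derivative ?D x) (at 0)" for x
    proof -
      have "sqrt ((g (x + 0 *\<^sub>R v) + c)\<^sup>2 + e\<^sup>2) \<noteq> 0" using e by simp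
      from DERIV_inverse'[OF has_derivative_sqrt_square_sum[OF e smooth_fun_has_derivative[OF B[OF inv]], of x v c] this]
      show ?thesis by (simp del: dderiv.simps add: mult_ac)
    qed
    moreover have "?D \<in> sqrt_algebra B c e"
      using inv by (intro sqrt_algebra.mult sqrt_algebra.add sqrt_algebra.const sqrt_algebra.inv
          sqrt_algebra.base sqrt_algebra_mem)
    ultimately show ?case by (intro bexI[of _ ?D] allI)
  next
    case (add g h)
    then obtain D D' where "D \<in> sqrt_algebra B c e" "D' \<in> sqrt_algebra B c e"
      "\<And>x. ((\<lambda>t. g (x + t *\<^sub>R v)) has_field_derivative D x) (at 0)"
      "\<And>x. ((\<lambda>t. h (x + t *\<^sub>R v)) has_field_derivative D' x) (at 0)" by blast
    then show ?case
      by (intro bexI[of _ "\<lambda>x. D x + D' x"]) (auto intro!: derivative_eq_intros sqrt_algebra.add)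
  next
    case (mult g h)
    then obtain D D' where D: "D \<in> sqrt_algebra B c e" "D' \<in> sqrt_algebra B c e"
      "\<And>x. ((\<lambda>t. g (x + t *\<^sub>R v)) has_field_derivative D x) (at 0)"
      "\<And>x. ((\<lambda>t. h (x + t *\<^sub>R v)) has_field_derivative D' x) (at 0)" by blast
    have "((\<lambda>t. g (x + t *\<^sub>R v) * h (x + t *\<^sub>R v)) has_field_derivative D x * h x + D' x * g x) (at 0)" for x
      using DERIV_mult[OF D(3)[of x] D(4)[of x]] by simp
    moreover have "(\<lambda>x. D x * h x + D' x * g x) \<in> sqrt_algebra B c e"
      using D mult by (intro sqrt_algebra.add sqrt_algebra.mult)
    ultimately show ?case by (intro bexI[of _ "\<lambda>x. D x * h x + D' x * g x"] allI)
  qed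
qed

lemma Cc_infI:
  assumes "smooth_fun f" "\<phi> \<in> Cc_inf \<Omega>" "\<psi> \<in> Cc_inf \<Omega>" "\<And>x. \<phi> x = 0 \<Longrightarrow> \<psi> x = 0 \<Longrightarrow> f x = 0"
  shows "f \<in> Cc_inf \<Omega>"
proof -
  have "closure {x. f x \<noteq> 0} \<subseteq> closure ({x. \<phi> x \<noteq> 0} \<union> {x. \<psi> x \<noteq> 0})"
    using assms(4) by (intro closure_mono) auto
  then have *: "closure {x. f x \<noteq> 0} \<subseteq> closure {x. \<phi> x \<noteq> 0} \<union> closure {x. \<psi> x \<noteq> 0}"
    by (simp add: closure_Un)
  moreover have "compact (closure {x. \<phi> x \<noteq> 0} \<union> closure {x. \<psi> x \<noteq> 0})"
    using assms(2,3) by (auto simp: Cc_inf_def)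
  ultimately have "compact (closure {x. f x \<noteq> 0})"
    using compact_Int_closed[OF _ closed_closure[of "{x. f x \<noteq> 0}"]] by (metis Int_absorb1)
  then show ?thesis using assms(1-3) * by (auto simp: Cc_inf_def)
qed

lemma smooth_fun_linear_combination:
  assumes "smooth_fun g" "smooth_fun h"
  shows "smooth_fun (\<lambda>x. a * g x + b * h x)"
proof (rule smooth_fun_sqrt_algebra[of "{g, h}" 1 _ 0])
  show "(\<lambda>x. a * g x + b * h x) \<in> sqrt_algebra {g, h} 0 1"
    by (intro sqrt_algebra.add sqrt_algebra.mult sqrt_algebra.const sqrt_algebra_mem) auto
qed (use assms in auto)

lemma Cc_inf_linear_combination:
  assumes "\<phi> \<in> Cc_inf \<Omega>" "\<psi> \<in> Cc_inf \<Omega>"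
  shows "(\<lambda>x. a * \<phi> x + b * \<psi> x) \<in> Cc_inf \<Omega>"
  using assms by (intro Cc_infI[OF smooth_fun_linear_combination assms]) (auto simp: Cc_inf_def)

lemma smooth_fun_0: "smooth_fun (\<lambda>_. 0)"
  by (rule smooth_fun_sqrt_algebra[of "{}" 1 _ 0]) (auto intro: sqrt_algebra.const)

lemma Cc_inf_0: "(\<lambda>_. 0) \<in> Cc_inf \<Omega>"
  by (simp add: Cc_inf_def smooth_fun_0)

text \<open>A smooth substitute for a -> |a + c| - |c|, recovered as e tends to 0. Subtracting the
  value at 0 preserves compact supports.\<close>

definition abs_reg :: "real \<Rightarrow> real \<Rightarrow> real \<Rightarrow> real" where
  "abs_reg c e a = sqrt ((a + c)\<^sup>2 + e\<^sup>2) - sqrt (c\<^sup>2 + e\<^sup>2)"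

lemma abs_reg_0: "abs_reg c e 0 = 0"
  by (simp add: abs_reg_def)

text \<open>The triangle inequality in the plane for (a, e) = (a - b, 0) + (b, e). The Lipschitz
  constant 1 does not depend on e.\<close>

lemma sqrt_diff_le: "\<bar>sqrt ((a::real)\<^sup>2 + e\<^sup>2) - sqrt (b\<^sup>2 + e\<^sup>2)\<bar> \<le> \<bar>a - b\<bar>"
proof -
  have *: "sqrt (a\<^sup>2 + e\<^sup>2) \<le> \<bar>a - b\<bar> + sqrt (b\<^sup>2 + e\<^sup>2)" for a b :: real
    using real_sqrt_sum_squares_triangle_ineq[of "a - b" b 0 e] by simp
  show ?thesis using *[of a b] *[of b a] by linarith
qed

lemma abs_reg_diff_le: "\<bar>abs_reg c e a - abs_reg c e b\<bar> \<le> \<bar>a - b\<bar>"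
  using sqrt_diff_le[of "a + c" e "b + c"] by (simp add: abs_reg_def)

lemma abs_reg_tendsto:
  assumes "a \<longlonglongrightarrow> l" "e \<longlonglongrightarrow> 0"
  shows "(\<lambda>n. abs_reg c (e n) (a n)) \<longlonglongrightarrow> \<bar>l + c\<bar> - \<bar>c\<bar>"
proof -
  have "(\<lambda>n. abs_reg c (e n) (a n)) \<longlonglongrightarrow> sqrt ((l + c)\<^sup>2 + 0\<^sup>2) - sqrt (c\<^sup>2 + 0\<^sup>2)"
    unfolding abs_reg_def by (intro tendsto_intros assms)
  then show ?thesis by simp
qed

lemma Cc_inf_abs_reg:
  assumes "\<phi> \<in> Cc_inf \<Omega>" "0 < e"
  shows "(\<lambda>x. abs_reg c e (\<phi> x)) \<in> Cc_inf \<Omega>"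
proof (rule Cc_infI[OF _ assms(1) assms(1)])
  have "(\<lambda>x. sqrt ((\<phi> x + c)\<^sup>2 + e\<^sup>2) + - sqrt (c\<^sup>2 + e\<^sup>2)) \<in> sqrt_algebra {\<phi>} c e"
    by (intro sqrt_algebra.add sqrt_algebra.const sqrt_algebra.root) simp
  then show "smooth_fun (\<lambda>x. abs_reg c e (\<phi> x))"
    unfolding abs_reg_def using assms
    by - (rule smooth_fun_sqrt_algebra[of "{\<phi>}" e], auto simp: Cc_inf_def)
qed (simp add: abs_reg_0)

section \<open>Integrability of powers of the norm\<close>

lemma dyadic_sum_finite:
  assumes "0 \<le> C" "0 \<le> q" "q < 1"
  shows "(\<Sum>j. ennreal (C * q ^ j)) < \<infinity>"
proof -
  have "summable (\<lambda>j. C * q ^ j)" using assms by (intro summable_mult summable_geometric) auto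
  then have "(\<Sum>j. ennreal (C * q ^ j)) \<noteq> top" using assms by (intro ennreal_suminf_neq_top) auto
  then show ?thesis by (simp add: less_top)
qed

text \<open>Shared by the two estimates below: t = 1/2 resolves the singularity at the origin, t = 2
  the tail at infinity. Volumes scale with the power DIM('a), so the series is geometric with ratio
  \<open>t powr (real DIM('a) - a)\<close>, which is below 1 in both uses.\<close>

lemma nn_integral_dyadic_balls:
  fixes x :: "'a::euclidean_space"
  assumes "0 < R" "0 < t"
  shows "(\<integral>\<^sup>+y. (\<Sum>j. ennreal ((R * t ^ j) powr (- a)) * indicator (ball x (L * (R * t ^ j))) y) \<partial>lebesgue)
    \<le> (\<Sum>j. ennreal (R powr (- a) * (unit_ball_vol (real DIM('a)) * (\<bar>L\<bar> * R) ^ DIM('a)) * (t powr (real DIM('a) - a)) ^ j))"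
proof -
  let ?u = "unit_ball_vol (real DIM('a))"
  have "(\<integral>\<^sup>+y. (\<Sum>j. ennreal ((R * t ^ j) powr (- a)) * indicator (ball x (L * (R * t ^ j))) y) \<partial>lebesgue)
      = (\<Sum>j. \<integral>\<^sup>+y. ennreal ((R * t ^ j) powr (- a)) * indicator (ball x (L * (R * t ^ j))) y \<partial>lebesgue)"
    by (intro nn_integral_suminf borel_measurable_times_ennreal borel_measurable_const
        borel_measurable_indicator fmeasurableD lmeasurable_ball)
  also have "\<dots> = (\<Sum>j. ennreal ((R * t ^ j) powr (- a)) * emeasure lborel (ball x (L * (R * t ^ j))))"
    by (simp add: nn_integral_cmult_indicator)
  also have "\<dots> \<le> (\<Sum>j. ennreal (R powr (- a) * (?u * (\<bar>L\<bar> * R) ^ DIM('a)) * (t powr (real DIM('a) - a)) ^ j))"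
  proof (intro suminf_le summableI)
    fix j
    have tj: "(t ^ j) powr (- a) * (t ^ j) ^ DIM('a) = (t powr (real DIM('a) - a)) ^ j"
    proof -
      have "(t ^ j) powr (- a) * (t ^ j) ^ DIM('a) = (t ^ j) powr (- a) * (t ^ j) powr (real DIM('a))"
        using powr_realpow[of "t ^ j" "DIM('a)"] assms by simp
      also have "\<dots> = (t ^ j) powr (- a + real DIM('a))" by (rule powr_add[symmetric])
      also have "\<dots> = (t powr real j) powr (real DIM('a) - a)" using powr_realpow[of t j] assms by simp
      also have "\<dots> = (t powr (real DIM('a) - a)) powr real j" by (simp only: powr_powr mult.commute)
      also have "\<dots> = (t powr (real DIM('a) - a)) ^ j" using assms by (intro powr_realpow) simp
      finally show ?thesis .
    qed
    have "emeasure lborel (ball x (L * (R * t ^ j))) \<le> emeasure lborel (ball x (\<bar>L\<bar> * (R * t ^ j)))"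
      using assms by (intro emeasure_mono subset_ball mult_right_mono) auto
    also have "\<dots> = ennreal (?u * (\<bar>L\<bar> * (R * t ^ j)) ^ DIM('a))"
      using assms by (intro emeasure_ball) auto
    finally have "ennreal ((R * t ^ j) powr (- a)) * emeasure lborel (ball x (L * (R * t ^ j))) \<le>
        ennreal ((R * t ^ j) powr (- a)) * ennreal (?u * (\<bar>L\<bar> * (R * t ^ j)) ^ DIM('a))"
      by (intro mult_left_mono) auto
    also have "\<dots> = ennreal ((R * t ^ j) powr (- a) * (?u * (\<bar>L\<bar> * (R * t ^ j)) ^ DIM('a)))"
      by (simp add: ennreal_mult')
    also have "(R * t ^ j) powr (- a) * (?u * (\<bar>L\<bar> * (R * t ^ j)) ^ DIM('a)) =
        R powr (- a) * (?u * (\<bar>L\<bar> * R) ^ DIM('a)) * ((t ^ j) powr (- a) * (t ^ j) ^ DIM('a))"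
      using assms by (simp add: powr_mult power_mult_distrib mult_ac)
    finally show "ennreal ((R * t ^ j) powr (- a)) * emeasure lborel (ball x (L * (R * t ^ j))) \<le>
        ennreal (R powr (- a) * (?u * (\<bar>L\<bar> * R) ^ DIM('a)) * (t powr (real DIM('a) - a)) ^ j)"
      unfolding tj .
  qed
  finally show ?thesis .
qed

lemma suminf_ge_term_ennreal: "f i \<le> (\<Sum>j. f j :: ennreal)"
  using sum_le_suminf[of f "{i}"] by simp

lemma nn_integral_norm_powr_ball_finite:
  fixes a R :: real
  assumes "0 \<le> a" "a < real DIM('a::euclidean_space)" "0 < R"
  shows "(\<integral>\<^sup>+x\<in>ball (0::'a) R. ennreal (1 / norm x powr a) \<partial>lebesgue) < \<infinity>"
proof -
  have "ennreal (1 / norm x powr a) * indicator (ball 0 R) x \<le>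
      (\<Sum>j. ennreal ((R / 2 * (1/2) ^ j) powr (- a)) * indicator (ball 0 (2 * (R / 2 * (1/2) ^ j))) x)" for x :: 'a
  proof (cases "x \<noteq> 0 \<and> norm x < R")
    case True
    define P where "P j \<longleftrightarrow> norm x \<ge> R / 2 * (1/2) ^ j" for j :: nat
    have "\<exists>j. P j"
    proof -
      have "0 < norm x / (R / 2)" using True assms by simp
      then obtain j where "(1/2) ^ j < norm x / (R / 2)"
        using real_arch_pow_inv[of "norm x / (R / 2)" "1/2"] by auto
      then show ?thesis using assms by (intro exI[of _ j]) (simp add: P_def field_simps)
    qed
    \<comment> \<open>Minimality puts x into the dyadic shell with radii R/2 and R times
      (1/2)^j.\<close>
    define j where "j = (LEAST j. P j)"
    have j: "P j" unfolding j_def using \<open>\<exists>j. P j\<close> by (rule LeastI_ex)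
    have up: "norm x < 2 * (R / 2 * (1/2) ^ j)"
    proof (cases j)
      case (Suc i)
      then have "\<not> P i" using not_less_Least[of i P] by (simp add: j_def)
      then show ?thesis using Suc by (simp add: P_def)
    qed (use True in simp)
    have "1 / norm x powr a \<le> (R / 2 * (1/2) ^ j) powr (- a)"
    proof -
      have "(R / 2 * (1/2) ^ j) powr a \<le> norm x powr a"
        using j assms by (intro powr_mono2) (auto simp: P_def)
      moreover have "0 < (R / 2 * (1/2) ^ j) powr a" using assms by simp
      ultimately show ?thesis unfolding powr_minus inverse_eq_divide[symmetric] by (rule le_imp_inverse_le)
    qed
    then have "ennreal (1 / norm x powr a) * indicator (ball 0 R) x \<le>
      ennreal ((R / 2 * (1/2) ^ j) powr (- a)) * indicator (ball 0 (2 * (R / 2 * (1/2) ^ j))) x"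
      using up True by (simp add: ennreal_leI)
    also have "\<dots> \<le> (\<Sum>j. ennreal ((R / 2 * (1/2) ^ j) powr (- a)) * indicator (ball 0 (2 * (R / 2 * (1/2) ^ j))) x)"
      by (rule suminf_ge_term_ennreal)
    finally show ?thesis .
  qed auto
  then have "(\<integral>\<^sup>+x\<in>ball (0::'a) R. ennreal (1 / norm x powr a) \<partial>lebesgue) \<le>
    (\<integral>\<^sup>+x. (\<Sum>j. ennreal ((R / 2 * (1/2) ^ j) powr (- a)) * indicator (ball 0 (2 * (R / 2 * (1/2) ^ j))) x) \<partial>(lebesgue :: 'a measure))"
    by (intro nn_integral_mono) auto
  also have "\<dots> \<le> (\<Sum>j. ennreal ((R/2) powr (- a) * (unit_ball_vol (real DIM('a)) * (\<bar>2\<bar> * (R/2)) ^ DIM('a)) * ((1/2) powr (real DIM('a) - a)) ^ j))"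
    using assms by (intro nn_integral_dyadic_balls) auto
  also have "\<dots> < \<infinity>"
    using assms powr_less_one[of "1/2" "real DIM('a) - a"] unit_ball_vol_nonneg[of "real DIM('a)"]
    by (intro dyadic_sum_finite) (auto simp: powr01_less_one)
  finally show ?thesis .
qed

text \<open>The dyadic balls are centred at x, so the bound is uniform in x. It is applied to points
  of a compact support that stays at distance d from the exterior.\<close>

lemma nn_integral_norm_powr_tail_bounded:
  fixes b d :: real
  assumes "real DIM('a::euclidean_space) < b" "0 < d"
  obtains C where "C < \<infinity>"
    "\<And>x :: 'a. (\<integral>\<^sup>+y\<in>{y. d \<le> norm (x - y)}. ennreal (1 / norm (x - y) powr b) \<partial>lebesgue) \<le> C"
proof -
  define C where "C = (\<Sum>j. ennreal (d powr (- b) * (unit_ball_vol (real DIM('a)) * (\<bar>2\<bar> * d) ^ DIM('a)) * (2 powr (real DIM('a) - b)) ^ j))"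
  have "C < \<infinity>" unfolding C_def
    using assms by (intro dyadic_sum_finite) (auto simp: powr_less_one)
  moreover have "(\<integral>\<^sup>+y\<in>{y. d \<le> norm (x - y)}. ennreal (1 / norm (x - y) powr b) \<partial>lebesgue) \<le> C" for x :: 'a
  proof -
    have "ennreal (1 / norm (x - y) powr b) * indicator {y. d \<le> norm (x - y)} y \<le>
        (\<Sum>j. ennreal ((d * 2 ^ j) powr (- b)) * indicator (ball x (2 * (d * 2 ^ j))) y)" for y
    proof (cases "d \<le> norm (x - y)")
      case True
      define P where "P j \<longleftrightarrow> norm (x - y) < 2 * (d * 2 ^ j)" for j :: nat
      have "\<exists>j. P j"
      proof -
        obtain j where "norm (x - y) / d < 2 ^ j" using real_arch_pow[of 2 "norm (x - y) / d"] by auto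
        then have "norm (x - y) < d * 2 ^ j" using assms by (simp add: field_simps)
        moreover have "0 < d * 2 ^ j" using assms by simp
        ultimately show ?thesis unfolding P_def by (intro exI[of _ j]) linarith
      qed
      define j where "j = (LEAST j. P j)"
      have j: "P j" unfolding j_def using \<open>\<exists>j. P j\<close> by (rule LeastI_ex)
      have low: "d * 2 ^ j \<le> norm (x - y)"
      proof (cases j)
        case (Suc i)
        then have "\<not> P i" using not_less_Least[of i P] by (simp add: j_def)
        then show ?thesis using Suc by (simp add: P_def)
      qed (use True in simp)
      have "1 / norm (x - y) powr b \<le> (d * 2 ^ j) powr (- b)"
      proof -
        have "(d * 2 ^ j) powr b \<le> norm (x - y) powr b"
          using low assms by (intro powr_mono2) auto
        moreover have "0 < (d * 2 ^ j) powr b" using assms by simp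
        ultimately show ?thesis unfolding powr_minus inverse_eq_divide[symmetric] by (rule le_imp_inverse_le)
      qed
      then have "ennreal (1 / norm (x - y) powr b) * indicator {y. d \<le> norm (x - y)} y \<le>
        ennreal ((d * 2 ^ j) powr (- b)) * indicator (ball x (2 * (d * 2 ^ j))) y"
        using j True by (simp add: ennreal_leI P_def dist_norm)
      also have "\<dots> \<le> (\<Sum>j. ennreal ((d * 2 ^ j) powr (- b)) * indicator (ball x (2 * (d * 2 ^ j))) y)"
        by (rule suminf_ge_term_ennreal)
      finally show ?thesis .
    qed auto
    then have "(\<integral>\<^sup>+y\<in>{y. d \<le> norm (x - y)}. ennreal (1 / norm (x - y) powr b) \<partial>lebesgue) \<le>
        (\<integral>\<^sup>+y. (\<Sum>j. ennreal ((d * 2 ^ j) powr (- b)) * indicator (ball x (2 * (d * 2 ^ j))) y) \<partial>lebesgue)"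
      by (intro nn_integral_mono) auto
    also have "\<dots> \<le> C" unfolding C_def using assms by (intro nn_integral_dyadic_balls) auto
    finally show ?thesis .
  qed
  ultimately show ?thesis using that by blast
qed

section \<open>Convergence of integrals\<close>

lemma tendsto_subseq_principle:
  fixes X :: "nat \<Rightarrow> 'b::first_countable_topology"
  assumes "\<And>r :: nat \<Rightarrow> nat. strict_mono r \<Longrightarrow> \<exists>q :: nat \<Rightarrow> nat. strict_mono q \<and> (\<lambda>n. X (r (q n))) \<longlonglongrightarrow> l"
  shows "X \<longlonglongrightarrow> l"
proof (rule ccontr)
  assume "\<not> X \<longlonglongrightarrow> l"
  then obtain S where S: "open S" "l \<in> S" "\<not> (\<forall>\<^sub>F n in sequentially. X n \<in> S)"
    unfolding tendsto_def by blast
  then have inf: "infinite {n. X n \<notin> S}"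
    by (simp add: cofinite_eq_sequentially[symmetric] eventually_cofinite)
  define r where "r = enumerate {n. X n \<notin> S}"
  have r: "strict_mono r" unfolding r_def using inf by (rule strict_mono_enumerate)
  have rS: "X (r n) \<notin> S" for n
    using enumerate_in_set[OF inf, of n] by (simp add: r_def)
  obtain q where "(\<lambda>n. X (r (q n))) \<longlonglongrightarrow> l" using assms[OF r] by blast
  then have "\<forall>\<^sub>F n in sequentially. X (r (q n)) \<in> S" using S(1,2) by (rule topological_tendstoD)
  then show False using rS by auto
qed

text \<open>Dominated convergence with a bound that itself varies by an error vanishing in L^1:
  \<open>min (h n x) (g x)\<close> is dominated by g, and what it cuts off from \<open>h n x\<close>
  is at most \<open>e n x\<close>.\<close>

lemma nn_integral_tendsto_0_dominated:
  fixes h e :: "nat \<Rightarrow> 'b \<Rightarrow> real" and g :: "'b \<Rightarrow> real"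
  assumes meas: "\<And>n. h n \<in> borel_measurable M" "\<And>n. e n \<in> borel_measurable M"
    and g: "integrable M g" "\<And>x. 0 \<le> g x"
    and h: "\<And>n x. 0 \<le> h n x" and e: "\<And>n x. 0 \<le> e n x"
    and le: "\<And>n x. h n x \<le> g x + e n x"
    and lim: "AE x in M. (\<lambda>n. h n x) \<longlonglongrightarrow> 0"
    and e0: "(\<lambda>n. \<integral>\<^sup>+x. ennreal (e n x) \<partial>M) \<longlonglongrightarrow> 0"
  shows "(\<lambda>n. \<integral>\<^sup>+x. ennreal (h n x) \<partial>M) \<longlonglongrightarrow> 0"
proof -
  note meas[measurable] borel_measurable_integrable[OF g(1), measurable]
  have "(\<lambda>n. \<integral>\<^sup>+x. ennreal (min (h n x) (g x)) \<partial>M) \<longlonglongrightarrow> (\<integral>\<^sup>+x. 0 \<partial>M)"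
  proof (rule nn_integral_dominated_convergence[where w = "\<lambda>x. ennreal (g x)"])
    show "(\<integral>\<^sup>+x. ennreal (g x) \<partial>M) < \<infinity>"
      using g by (simp add: nn_integral_eq_integral)
    show "AE x in M. (\<lambda>n. ennreal (min (h n x) (g x))) \<longlonglongrightarrow> 0"
      using lim
    proof eventually_elim
      case (elim x)
      have "(\<lambda>n. min (h n x) (g x)) \<longlonglongrightarrow> 0"
        by (rule tendsto_sandwich[OF _ _ tendsto_const elim]) (use h g in auto)
      then have "(\<lambda>n. ennreal (min (h n x) (g x))) \<longlonglongrightarrow> ennreal 0" by (rule tendsto_ennrealI)
      then show ?case by simp
    qed
  qed (auto intro!: ennreal_leI)
  then have "(\<lambda>n. (\<integral>\<^sup>+x. ennreal (min (h n x) (g x)) \<partial>M) + (\<integral>\<^sup>+x. ennreal (e n x) \<partial>M)) \<longlonglongrightarrow> 0 + 0"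
    using e0 by (intro tendsto_add) auto
  then have lim2: "(\<lambda>n. (\<integral>\<^sup>+x. ennreal (min (h n x) (g x)) \<partial>M) + (\<integral>\<^sup>+x. ennreal (e n x) \<partial>M)) \<longlonglongrightarrow> 0"
    by simp
  show ?thesis
  proof (rule tendsto_sandwich[OF _ _ tendsto_const lim2])
    have "(\<integral>\<^sup>+x. ennreal (h n x) \<partial>M) \<le> (\<integral>\<^sup>+x. ennreal (min (h n x) (g x)) \<partial>M) + (\<integral>\<^sup>+x. ennreal (e n x) \<partial>M)" for n
    proof -
      have "(\<integral>\<^sup>+x. ennreal (h n x) \<partial>M) \<le> (\<integral>\<^sup>+x. ennreal (min (h n x) (g x)) + ennreal (e n x) \<partial>M)"
        using h g e le by (intro nn_integral_mono) (auto simp: ennreal_plus[symmetric] min_def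
            simp del: ennreal_plus intro!: ennreal_leI)
      also have "\<dots> = (\<integral>\<^sup>+x. ennreal (min (h n x) (g x)) \<partial>M) + (\<integral>\<^sup>+x. ennreal (e n x) \<partial>M)"
        by (intro nn_integral_add) auto
      finally show ?thesis .
    qed
    then show "\<forall>\<^sub>F n in sequentially. (\<integral>\<^sup>+x. ennreal (h n x) \<partial>M) \<le>
      (\<integral>\<^sup>+x. ennreal (min (h n x) (g x)) \<partial>M) + (\<integral>\<^sup>+x. ennreal (e n x) \<partial>M)" by simp
  qed simp
qed

lemma nn_integral_tendsto_0_AE_subseq:
  fixes h :: "nat \<Rightarrow> 'b \<Rightarrow> real"
  assumes meas: "\<And>n. h n \<in> borel_measurable M" and h: "\<And>n x. 0 \<le> h n x"
    and lim: "(\<lambda>n. \<integral>\<^sup>+x. ennreal (h n x) \<partial>M) \<longlonglongrightarrow> 0"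
  obtains r where "strict_mono r" "AE x in M. (\<lambda>n. h (r n) x) \<longlonglongrightarrow> 0"
proof -
  note meas[measurable]
  have "\<forall>\<^sub>F n in sequentially. (\<integral>\<^sup>+x. ennreal (h n x) \<partial>M) < 1"
    using lim by (rule order_tendstoD) simp
  \<comment> \<open>The first terms may have infinite integral, so the sequence is shifted past them
    before L^1 results are applied.\<close>
  then obtain m where m: "\<And>n. m \<le> n \<Longrightarrow> (\<integral>\<^sup>+x. ennreal (h n x) \<partial>M) < 1"
    by (auto simp: eventually_sequentially)
  have int: "integrable M (h (n + m))" for n
    using m[of "n + m"] h by (intro integrableI_nonneg) (auto intro: less_trans)
  have "(\<lambda>n. ennreal (\<integral>x. norm (h (n + m) x) \<partial>M)) \<longlonglongrightarrow> ennreal 0"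
    using LIMSEQ_ignore_initial_segment[OF lim, of m] int h by (simp add: nn_integral_eq_integral)
  then have "(\<lambda>n. \<integral>x. norm (h (n + m) x) \<partial>M) \<longlonglongrightarrow> 0"
    by (subst (asm) tendsto_ennreal_iff) auto
  from tendsto_L1_AE_subseq[OF int this] obtain r where
    r: "strict_mono r" "AE x in M. (\<lambda>n. h (r n + m) x) \<longlonglongrightarrow> 0" by blast
  then show ?thesis
    by (intro that[of "\<lambda>n. r n + m"]) (auto simp: strict_mono_def)
qed

text \<open>The Riesz-Fischer argument phrased with p-th powers instead of norms. A weighted sum of
  the increments along the subsequence has finite integral, so almost everywhere the increments
  decay geometrically.\<close>

lemma Lp_Cauchy_AE_Cauchy_subseq:
  fixes h :: "nat \<Rightarrow> 'b \<Rightarrow> real" and p :: real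
  assumes p: "0 < p" and meas: "\<And>n. h n \<in> borel_measurable M"
    and cau: "\<And>\<epsilon>. 0 < \<epsilon> \<Longrightarrow> \<exists>N. \<forall>m\<ge>N. \<forall>n\<ge>N. (\<integral>\<^sup>+x. ennreal (\<bar>h m x - h n x\<bar> powr p) \<partial>M) \<le> ennreal \<epsilon>"
  obtains r where "strict_mono r" "AE x in M. Cauchy (\<lambda>n. h (r n) x)"
proof -
  note meas[measurable]
  \<comment> \<open>The second factor cancels the weight \<open>2 powr (p * real i)\<close> put on
    the i-th increment; the first leaves a convergent geometric series.\<close>
  define \<epsilon> where "\<epsilon> i = (1/2 :: real) ^ i * (1/2) powr (p * real i)" for i :: nat
  have eps: "0 < \<epsilon> i" for i by (simp add: \<epsilon>_def)
  have "\<exists>r. \<forall>i. (\<forall>m\<ge>r i. \<forall>n\<ge>r i. (\<integral>\<^sup>+x. ennreal (\<bar>h m x - h n x\<bar> powr p) \<partial>M) \<le> ennreal (\<epsilon> i)) \<and> r i < r (Suc i)"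
  proof (intro dependent_nat_choice, goal_cases)
    case 1
    show ?case using cau[OF eps[of 0]] by blast
  next
    case (2 x n)
    obtain N where "\<forall>m\<ge>N. \<forall>k\<ge>N. (\<integral>\<^sup>+x. ennreal (\<bar>h m x - h k x\<bar> powr p) \<partial>M) \<le> ennreal (\<epsilon> (Suc n))"
      using cau[OF eps[of "Suc n"]] by blast
    then show ?case by (intro exI[of _ "max (Suc x) N"]) auto
  qed
  then obtain r where r: "\<And>i m n. r i \<le> m \<Longrightarrow> r i \<le> n \<Longrightarrow> (\<integral>\<^sup>+x. ennreal (\<bar>h m x - h n x\<bar> powr p) \<partial>M) \<le> ennreal (\<epsilon> i)"
    "\<And>i. r i < r (Suc i)" by blast
  have mono: "strict_mono r" using r(2) by (simp add: strict_mono_Suc_iff)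
  define d where "d i x = \<bar>h (r (Suc i)) x - h (r i) x\<bar>" for i x
  have [measurable]: "d i \<in> borel_measurable M" for i unfolding d_def by measurable
  have "(\<integral>\<^sup>+x. (\<Sum>i. ennreal (2 powr (p * real i) * d i x powr p)) \<partial>M) =
      (\<Sum>i. \<integral>\<^sup>+x. ennreal (2 powr (p * real i) * d i x powr p) \<partial>M)"
    by (intro nn_integral_suminf) measurable
  also have "\<dots> \<le> (\<Sum>i. ennreal (1 * (1/2) ^ i))"
  proof (intro suminf_le summableI)
    fix i
    have "(\<integral>\<^sup>+x. ennreal (2 powr (p * real i) * d i x powr p) \<partial>M) =
        ennreal (2 powr (p * real i)) * (\<integral>\<^sup>+x. ennreal (d i x powr p) \<partial>M)"
      by (subst nn_integral_cmult[symmetric]) (auto simp: ennreal_mult)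
    also have "\<dots> \<le> ennreal (2 powr (p * real i)) * ennreal (\<epsilon> i)"
      using r(1)[of i "r (Suc i)" "r i"] r(2)[of i] by (intro mult_left_mono) (auto simp: d_def)
    also have "\<dots> = ennreal (2 powr (p * real i) * \<epsilon> i)"
      using eps[of i] by (subst ennreal_mult) (auto simp: less_imp_le)
    also have "2 powr (p * real i) * \<epsilon> i = (1/2) ^ i * (2 powr (p * real i) * (1/2) powr (p * real i))"
      by (simp add: \<epsilon>_def)
    also have "2 powr (p * real i) * (1/2) powr (p * real i) = 1"
      by (simp add: powr_mult[symmetric])
    finally show "(\<integral>\<^sup>+x. ennreal (2 powr (p * real i) * d i x powr p) \<partial>M) \<le> ennreal (1 * (1/2) ^ i)"
      by simp
  qed
  also have "\<dots> < \<infinity>" by (rule dyadic_sum_finite) auto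
  finally have "AE x in M. (\<Sum>i. ennreal (2 powr (p * real i) * d i x powr p)) \<noteq> \<infinity>"
    by (intro nn_integral_PInf_AE) auto
  then have "AE x in M. Cauchy (\<lambda>n. h (r n) x)"
  proof eventually_elim
    case (elim x)
    moreover have "\<exists>B\<ge>0. S = ennreal B" if "S \<noteq> \<infinity>" for S :: ennreal
      using that by (cases S rule: ennreal_cases) auto
    ultimately obtain B where B: "0 \<le> B" "(\<Sum>i. ennreal (2 powr (p * real i) * d i x powr p)) = ennreal B"
      by blast
    have "d i x \<le> B powr (1 / p) * (1/2) ^ i" for i
    proof -
      have "ennreal (2 powr (p * real i) * d i x powr p) \<le> ennreal B"
        using suminf_ge_term_ennreal[of "\<lambda>i. ennreal (2 powr (p * real i) * d i x powr p)" i] unfolding B .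
      then have "2 powr (p * real i) * d i x powr p \<le> B" using ennreal_le_iff[OF B(1)] by blast
      then have "(2 powr (p * real i) * d i x powr p) powr (1 / p) \<le> B powr (1 / p)"
        using p by (intro powr_mono2) auto
      moreover have "(2 powr (p * real i) * d i x powr p) powr (1 / p) = 2 ^ i * d i x"
      proof -
        have "(2 powr (p * real i) * d i x powr p) powr (1 / p) =
            (2 powr (p * real i)) powr (1 / p) * (d i x powr p) powr (1 / p)"
          by (rule powr_mult)
        also have "\<dots> = 2 powr real i * d i x" using p by (simp add: powr_powr d_def)
        finally show ?thesis by (simp add: powr_realpow)
      qed
      ultimately show ?thesis by (simp add: field_simps power_one_over)
    qed
    then have le: "norm (h (r (Suc i)) x - h (r i) x) \<le> B powr (1 / p) * (1/2) ^ i" for i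
      by (simp add: d_def)
    have "summable (\<lambda>i. (1/2 :: real) ^ i)" by (rule summable_geometric) simp
    then have "summable (\<lambda>i. B powr (1 / p) * (1/2) ^ i)" by (rule summable_mult)
    then have "summable (\<lambda>i. h (r (Suc i)) x - h (r i) x)"
      by (rule summable_comparison_test'[where N = 0]) (rule le)
    then have "convergent (\<lambda>n. \<Sum>i<n. h (r (Suc i)) x - h (r i) x)"
      by (simp add: summable_iff_convergent)
    then have "convergent (\<lambda>n. h (r n) x - h (r 0) x)"
      using sum_lessThan_telescope[of "\<lambda>n. h (r n) x"] by simp
    then have "convergent (\<lambda>n. h (r n) x)"
      using convergent_add_const_iff[of "- h (r 0) x" "\<lambda>n. h (r n) x"] by simp
    then show ?case by (rule convergent_Cauchy)
  qed
  with mono show ?thesis by (rule that)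
qed

text \<open>Fatou's lemma for functions bounded below by - (G + H n), where H n varies but vanishes
  in the limit. H is 0 in most uses; a nonzero H absorbs the error of approximating a test function.
  Integrability of the limit is part of the conclusion.\<close>

lemma integral_fatou_le:
  fixes F H :: "nat \<Rightarrow> 'b \<Rightarrow> real" and G F0 :: "'b \<Rightarrow> real"
  assumes int: "\<And>n. integrable M (F n)" "integrable M G" "\<And>n. integrable M (H n)"
    and meas: "F0 \<in> borel_measurable M"
    and ge: "\<And>n. AE x in M. 0 \<le> F n x + G x + H n x"
    and lim: "AE x in M. (\<lambda>n. F n x) \<longlonglongrightarrow> F0 x" "AE x in M. (\<lambda>n. H n x) \<longlonglongrightarrow> 0"
    and H0: "(\<lambda>n. \<integral>x. H n x \<partial>M) \<longlonglongrightarrow> 0"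
    and le: "\<And>n. (\<integral>x. F n x \<partial>M) \<le> c n" and c: "c \<longlonglongrightarrow> c0"
  shows "integrable M F0" "(\<integral>x. F0 x \<partial>M) \<le> c0"
proof -
  note meas[measurable] int[THEN borel_measurable_integrable, measurable]
  have intZ: "integrable M (\<lambda>x. F n x + G x + H n x)" for n using int by auto
  have limZ: "AE x in M. (\<lambda>n. F n x + G x + H n x) \<longlonglongrightarrow> F0 x + G x"
    using lim by eventually_elim (auto intro!: tendsto_eq_intros)
  have nonneg: "AE x in M. 0 \<le> F0 x + G x"
  proof -
    have "AE x in M. \<forall>n. 0 \<le> F n x + G x + H n x" using ge by (simp add: AE_all_countable)
    with limZ show ?thesis by eventually_elim (rule LIMSEQ_le_const, auto)
  qed
  have clim: "(\<lambda>n. ennreal (c n + (\<integral>x. G x \<partial>M) + (\<integral>x. H n x \<partial>M))) \<longlonglongrightarrow> ennreal (c0 + (\<integral>x. G x \<partial>M) + 0)"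
    by (intro tendsto_ennrealI tendsto_intros c H0)
  have "(\<integral>\<^sup>+x. ennreal (F0 x + G x) \<partial>M) = (\<integral>\<^sup>+x. liminf (\<lambda>n. ennreal (F n x + G x + H n x)) \<partial>M)"
  proof (rule nn_integral_cong_AE)
    show "AE x in M. ennreal (F0 x + G x) = liminf (\<lambda>n. ennreal (F n x + G x + H n x))"
      using limZ by eventually_elim (intro lim_imp_Liminf[symmetric] tendsto_ennrealI, auto)
  qed
  also have "\<dots> \<le> liminf (\<lambda>n. \<integral>\<^sup>+x. ennreal (F n x + G x + H n x) \<partial>M)"
    by (intro nn_integral_liminf) measurable
  also have "\<dots> \<le> liminf (\<lambda>n. ennreal (c n + (\<integral>x. G x \<partial>M) + (\<integral>x. H n x \<partial>M)))"
  proof (intro Liminf_mono always_eventually allI)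
    fix n
    have "(\<integral>\<^sup>+x. ennreal (F n x + G x + H n x) \<partial>M) = ennreal (\<integral>x. F n x + G x + H n x \<partial>M)"
      using intZ ge by (rule nn_integral_eq_integral)
    also have "(\<integral>x. F n x + G x + H n x \<partial>M) = (\<integral>x. F n x \<partial>M) + (\<integral>x. G x \<partial>M) + (\<integral>x. H n x \<partial>M)"
      using int by simp
    finally show "(\<integral>\<^sup>+x. ennreal (F n x + G x + H n x) \<partial>M) \<le> ennreal (c n + (\<integral>x. G x \<partial>M) + (\<integral>x. H n x \<partial>M))"
      using le[of n] by (simp add: ennreal_leI)
  qed
  also have "\<dots> = ennreal (c0 + (\<integral>x. G x \<partial>M) + 0)"
    using clim by (intro lim_imp_Liminf) auto
  finally have fin: "(\<integral>\<^sup>+x. ennreal (F0 x + G x) \<partial>M) \<le> ennreal (c0 + (\<integral>x. G x \<partial>M))" by simp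
  have int0: "integrable M (\<lambda>x. F0 x + G x)"
    using fin nonneg by (intro integrableI_nonneg) (auto intro: le_less_trans)
  then have "integrable M (\<lambda>x. (F0 x + G x) - G x)" using int by (intro Bochner_Integration.integrable_diff)
  then show int1: "integrable M F0" by simp
  have nn: "0 \<le> c0 + (\<integral>x. G x \<partial>M)"
  proof (rule LIMSEQ_le_const)
    show "(\<lambda>n. c n + (\<integral>x. G x \<partial>M) + (\<integral>x. H n x \<partial>M)) \<longlonglongrightarrow> c0 + (\<integral>x. G x \<partial>M)"
      using c H0 by (auto intro!: tendsto_eq_intros)
    have "0 \<le> c n + (\<integral>x. G x \<partial>M) + (\<integral>x. H n x \<partial>M)" for n
    proof -
      have "0 \<le> (\<integral>x. F n x + G x + H n x \<partial>M)" using ge by (intro integral_nonneg_AE)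
      then show ?thesis using int le[of n] by simp
    qed
    then show "\<exists>N. \<forall>n\<ge>N. 0 \<le> c n + (\<integral>x. G x \<partial>M) + (\<integral>x. H n x \<partial>M)" by blast
  qed
  have "ennreal (\<integral>x. F0 x + G x \<partial>M) \<le> ennreal (c0 + (\<integral>x. G x \<partial>M))"
    using fin nn_integral_eq_integral[OF int0 nonneg] by simp
  then have "(\<integral>x. F0 x + G x \<partial>M) \<le> c0 + (\<integral>x. G x \<partial>M)" using nn by (simp add: ennreal_le_iff)
  then show "(\<integral>x. F0 x \<partial>M) \<le> c0" using int1 int by simp
qed

section \<open>The weighted measures and the energy space\<close>

lemma sigma_finite_lebesgue: "sigma_finite_measure (lebesgue :: 'a::euclidean_space measure)"
proof
  show "\<exists>A. countable A \<and> A \<subseteq> sets (lebesgue :: 'a measure) \<and> \<Union>A = space lebesgue \<and>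
      (\<forall>a\<in>A. emeasure lebesgue a \<noteq> \<infinity>)"
  proof (intro exI[of _ "range (\<lambda>n. ball 0 (real n))"] conjI ballI)
    show "\<Union> (range (\<lambda>n. ball (0::'a) (real n))) = space lebesgue"
      by (auto simp: reals_Archimedean2)
    show "emeasure lebesgue a \<noteq> \<infinity>" if "a \<in> range (\<lambda>n. ball (0::'a) (real n))" for a
      using that emeasure_lborel_ball_finite[of "0 :: 'a"] by (auto simp: less_top[symmetric])
  qed auto
qed

interpretation lebesgue_pair: pair_sigma_finite
  "lebesgue :: 'a::euclidean_space measure" "lebesgue :: 'b::euclidean_space measure"
  by (intro pair_sigma_finite.intro sigma_finite_lebesgue)

lemma measurable_id_lebesgue_borel [measurable]: "(\<lambda>x. x) \<in> lebesgue \<rightarrow>\<^sub>M borel"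
  by (rule measurable_completion) simp

definition nu_kernel :: "real \<Rightarrow> real \<Rightarrow> real \<Rightarrow> 'a::euclidean_space \<times> 'a \<Rightarrow> ennreal" where
  "nu_kernel s p \<beta> = (\<lambda>(x,y). ennreal (1 / (norm (x - y) powr (real DIM('a) + p * s) * norm x powr \<beta> * norm y powr \<beta>)))"

lemma nu_w_eq_density: "nu_w s p \<beta> = density (lebesgue \<Otimes>\<^sub>M lebesgue) (nu_kernel s p \<beta>)"
  by (simp add: nu_w_def nu_kernel_def)

lemma borel_measurable_nu_kernel [measurable]:
  "(nu_kernel s p \<beta> :: 'a::euclidean_space \<times> 'a \<Rightarrow> ennreal) \<in> borel_measurable (lebesgue \<Otimes>\<^sub>M lebesgue)"
proof -
  have [measurable]: "(\<lambda>z. fst z) \<in> lebesgue \<Otimes>\<^sub>M (lebesgue :: 'a measure) \<rightarrow>\<^sub>M (borel :: 'a measure)"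
    "(\<lambda>z. snd z) \<in> (lebesgue :: 'a measure) \<Otimes>\<^sub>M lebesgue \<rightarrow>\<^sub>M (borel :: 'a measure)"
    using measurable_compose[OF measurable_fst measurable_id_lebesgue_borel]
      measurable_compose[OF measurable_snd measurable_id_lebesgue_borel] by auto
  show ?thesis unfolding nu_kernel_def split_beta' by measurable
qed

lemma nu_kernel_pos: "x \<noteq> y \<Longrightarrow> x \<noteq> 0 \<Longrightarrow> y \<noteq> 0 \<Longrightarrow> 0 < nu_kernel s p \<beta> (x, y)"
  by (simp add: nu_kernel_def)

lemma sets_nu_w [measurable_cong]:
  "sets (nu_w s p \<beta> :: ('a::euclidean_space \<times> 'a) measure) = sets (lebesgue \<Otimes>\<^sub>M lebesgue)"
  by (simp add: nu_w_eq_density)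

lemma measurable_nu_w_fst [measurable]: "fst \<in> nu_w s p \<beta> \<rightarrow>\<^sub>M lebesgue"
  and measurable_nu_w_snd [measurable]: "snd \<in> nu_w s p \<beta> \<rightarrow>\<^sub>M lebesgue"
  by (simp_all add: measurable_cong_sets[OF sets_nu_w refl])

lemma measurable_mu_w_eq: "borel_measurable (mu_w \<beta>) = borel_measurable lebesgue"
  by (rule measurable_cong_sets) (simp_all add: mu_w_def)

lemma AE_lebesgue_neq: "AE y in lebesgue. y \<noteq> (c :: 'a::euclidean_space)"
  by (rule AE_completion) (rule AE_lborel_singleton)

lemma AE_nu_w_fst_snd:
  fixes P :: "'a::euclidean_space \<Rightarrow> bool"
  assumes "AE x in lebesgue. P x"
  shows "AE z in nu_w s p \<beta>. P (fst z) \<and> P (snd z)"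
proof -
  obtain N where N: "{x \<in> space lebesgue. \<not> P x} \<subseteq> N" "emeasure lebesgue N = 0" "N \<in> sets lebesgue"
    using assms by (rule AE_E)
  have AEN: "AE x in lebesgue. x \<notin> N" using N by (intro AE_not_in) auto
  have [measurable]: "N \<in> sets lebesgue" by fact
  have "AE z in lebesgue \<Otimes>\<^sub>M lebesgue. fst z \<notin> N \<and> snd z \<notin> N"
  proof (rule lebesgue_pair.AE_pair_measure)
    show "{z \<in> space (lebesgue \<Otimes>\<^sub>M lebesgue). fst z \<notin> N \<and> snd z \<notin> N} \<in> sets (lebesgue \<Otimes>\<^sub>M lebesgue)"
      by measurable
    show "AE x in lebesgue. AE y in lebesgue. fst (x, y) \<notin> N \<and> snd (x, y) \<notin> N"
      using AEN by eventually_elim (use AEN in auto)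
  qed
  then have "AE z in lebesgue \<Otimes>\<^sub>M lebesgue. P (fst z) \<and> P (snd z)"
    by eventually_elim (use N in auto)
  then show ?thesis
    unfolding nu_w_eq_density by (subst AE_density) auto
qed

lemma AE_mu_w_iff:
  fixes P :: "'a::euclidean_space \<Rightarrow> bool"
  shows "(AE x in mu_w \<beta>. P x) \<longleftrightarrow> (AE x in lebesgue. P x)"
proof -
  have "(AE x in mu_w \<beta>. P x) \<longleftrightarrow> (AE x in lebesgue. 0 < ennreal (1 / norm x powr (2 * \<beta>)) \<longrightarrow> P x)"
    unfolding mu_w_def by (subst AE_density) auto
  also have "\<dots> \<longleftrightarrow> (AE x in lebesgue. P x)"
  proof
    \<comment> \<open>At the origin the density is 0, as \<open>0 powr x\<close> and division by 0
      both give 0. A single point is negligible, so the measures have the same null sets.\<close>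
    assume "AE x in lebesgue. 0 < ennreal (1 / norm x powr (2 * \<beta>)) \<longrightarrow> P x"
    with AE_lebesgue_neq[of "0 :: 'a"] show "AE x in lebesgue. P x" by eventually_elim auto
  qed auto
  finally show ?thesis .
qed

locale weighted_domain =
  fixes \<Omega> :: "'a::euclidean_space set" and s p \<beta> :: real
  assumes s_pos: "0 < s" and p_gt_1: "1 < p" and beta_nonneg: "0 \<le> \<beta>"
    and beta_less: "2 * \<beta> < real DIM('a)"
    and open_dom: "open \<Omega>" and bounded_dom: "bounded \<Omega>" and zero_in_dom: "0 \<in> \<Omega>"
begin

abbreviation "\<nu> \<equiv> (nu_w s p \<beta> :: ('a \<times> 'a) measure)"
abbreviation "W \<equiv> Wsp0 \<Omega> s p \<beta>"
abbreviation incr :: "('a \<Rightarrow> real) \<Rightarrow> 'a \<times> 'a \<Rightarrow> real" where "incr w z \<equiv> w (fst z) - w (snd z)"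
abbreviation flux :: "('a \<Rightarrow> real) \<Rightarrow> ('a \<Rightarrow> real) \<Rightarrow> 'a \<times> 'a \<Rightarrow> real" where
  "flux w v z \<equiv> Lp_phi p (incr w z) * incr v z"
abbreviation epow :: "('a \<Rightarrow> real) \<Rightarrow> 'a \<times> 'a \<Rightarrow> real" where "epow w z \<equiv> \<bar>incr w z\<bar> powr p"

lemma p_pos: "0 < p" using p_gt_1 by simp

lemma dom_lebesgue [measurable]: "\<Omega> \<in> sets lebesgue"
  using open_dom by simp

lemma dom_times_nu [measurable]: "\<Omega> \<times> \<Omega> \<in> sets \<nu>"
  by (simp add: nu_w_eq_density)

lemma not_AE_in_dom: "\<not> (AE y in lebesgue. y \<in> \<Omega>)"
proof
  assume "AE y in lebesgue. y \<in> \<Omega>"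
  then have "emeasure lebesgue (- \<Omega>) = 0" by (subst (asm) AE_iff_measurable[of "- \<Omega>"]) (auto simp: Compl_in_sets_lebesgue)
  moreover have "emeasure lebesgue (\<Omega> \<union> - \<Omega>) \<le> emeasure lebesgue \<Omega> + emeasure lebesgue (- \<Omega>)"
    by (rule emeasure_subadditive) (auto simp: Compl_in_sets_lebesgue)
  moreover have "emeasure lebesgue \<Omega> < \<infinity>"
    using lmeasurable_open[OF bounded_dom open_dom] by (simp add: fmeasurable_def)
  ultimately show False by (simp add: emeasure_lborel_UNIV)
qed

text \<open>Every interior point interacts with the exterior, which has positive measure; this replaces
  all Poincare and Hardy type inequalities.\<close>
lemma AE_dom_if_AE_exterior:
  assumes "AE z in \<nu>. fst z \<in> \<Omega> \<and> snd z \<notin> \<Omega> \<longrightarrow> P (fst z)"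
  shows "AE x in lebesgue. x \<in> \<Omega> \<longrightarrow> P x"
proof -
  have "AE z in lebesgue \<Otimes>\<^sub>M lebesgue. 0 < nu_kernel s p \<beta> z \<longrightarrow> fst z \<in> \<Omega> \<and> snd z \<notin> \<Omega> \<longrightarrow> P (fst z)"
    using assms unfolding nu_w_eq_density by (subst (asm) AE_density) auto
  then have "AE x in lebesgue. AE y in lebesgue. 0 < nu_kernel s p \<beta> (x, y) \<longrightarrow> x \<in> \<Omega> \<and> y \<notin> \<Omega> \<longrightarrow> P x"
    using lebesgue_pair.AE_pair by fastforce
  with AE_lebesgue_neq[of 0] show ?thesis
  proof eventually_elim
    case (elim x)
    show ?case
    proof (rule impI, rule ccontr)
      assume "x \<in> \<Omega>" "\<not> P x"
      have "AE y in lebesgue. y \<in> \<Omega>"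
        using elim(2) AE_lebesgue_neq[of 0] AE_lebesgue_neq[of x]
      proof eventually_elim
        case (elim y)
        have "0 < nu_kernel s p \<beta> (x, y)"
          using elim(2,3) \<open>x \<noteq> 0\<close> by (intro nu_kernel_pos) auto
        then show ?case using elim(1) \<open>x \<in> \<Omega>\<close> \<open>\<not> P x\<close> by blast
      qed
      then show False using not_AE_in_dom by blast
    qed
  qed
qed

text \<open>The p-th powers of the two parts of the norm, added in \<open>ennreal\<close>. The sum
  tends to 0 exactly when the norm does, and the quasi-triangle inequality
  \<open>Wpow_add_le\<close> stands in for Minkowski's.\<close>

definition Wpow :: "('a \<Rightarrow> real) \<Rightarrow> ennreal" where
  "Wpow u = (\<integral>\<^sup>+x. ennreal (\<bar>u x\<bar> powr p * indicator \<Omega> x) \<partial>mu_w \<beta>) +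
    (\<integral>\<^sup>+z. ennreal (epow u z * indicator (\<Omega> \<times> \<Omega>) z) \<partial>\<nu>)"

lemma Lp_part_eq: "Lp_part \<Omega> p \<beta> u = (\<integral>\<^sup>+x. ennreal (\<bar>u x\<bar> powr p * indicator \<Omega> x) \<partial>mu_w \<beta>)"
  unfolding Lp_part_def by (intro nn_integral_cong) (auto split: split_indicator)

lemma Gag_part_eq: "Gag_part \<Omega> s p \<beta> u = (\<integral>\<^sup>+z. ennreal (epow u z * indicator (\<Omega> \<times> \<Omega>) z) \<partial>\<nu>)"
  unfolding Gag_part_def by (intro nn_integral_cong) (auto split: split_indicator)

lemma Wpow_eq: "Wpow u = Lp_part \<Omega> p \<beta> u + Gag_part \<Omega> s p \<beta> u"
  by (simp add: Wpow_def Lp_part_eq Gag_part_eq)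

lemma W_conv_iff: "W_conv \<Omega> s p \<beta> vs v \<longleftrightarrow> (\<lambda>n. Wpow (\<lambda>x. vs n x - v x)) \<longlonglongrightarrow> 0"
proof
  assume "W_conv \<Omega> s p \<beta> vs v"
  then have "(\<lambda>n. Wpow (\<lambda>x. vs n x - v x)) \<longlonglongrightarrow> 0 + 0"
    unfolding W_conv_def Wpow_eq by (intro tendsto_add) auto
  then show "(\<lambda>n. Wpow (\<lambda>x. vs n x - v x)) \<longlonglongrightarrow> 0" by simp
next
  assume *: "(\<lambda>n. Wpow (\<lambda>x. vs n x - v x)) \<longlonglongrightarrow> 0"
  show "W_conv \<Omega> s p \<beta> vs v"
    unfolding W_conv_def
    by (intro conjI; rule tendsto_sandwich[OF _ _ tendsto_const *]) (auto simp: Wpow_eq)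
qed

lemma W_iff: "u \<in> W \<longleftrightarrow> u \<in> borel_measurable lebesgue \<and> (\<forall>x. x \<notin> \<Omega> \<longrightarrow> u x = 0) \<and> Wpow u < \<infinity> \<and>
    (\<exists>\<phi>. (\<forall>n. \<phi> n \<in> Cc_inf \<Omega>) \<and> (\<lambda>n. Wpow (\<lambda>x. \<phi> n x - u x)) \<longlonglongrightarrow> 0)"
  unfolding Wsp0_def mem_Collect_eq W_conv_iff by (auto simp: Wpow_eq)

lemma W_measurable: "u \<in> W \<Longrightarrow> u \<in> borel_measurable lebesgue"
  and W_zero: "u \<in> W \<Longrightarrow> x \<notin> \<Omega> \<Longrightarrow> u x = 0"
  and W_Wpow: "u \<in> W \<Longrightarrow> Wpow u < \<infinity>"
  by (auto simp: W_iff)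

lemma W_approx:
  assumes "u \<in> W"
  obtains \<phi> where "\<And>n. \<phi> n \<in> Cc_inf \<Omega>" "(\<lambda>n. Wpow (\<lambda>x. \<phi> n x - u x)) \<longlonglongrightarrow> 0"
  using assms by (auto simp: W_iff)

lemma borel_measurable_mu_if: "u \<in> borel_measurable lebesgue \<Longrightarrow> u \<in> borel_measurable (mu_w \<beta>)"
  by (simp add: measurable_mu_w_eq)

lemma dom_mu [measurable]: "\<Omega> \<in> sets (mu_w \<beta>)"
  by (simp add: mu_w_def)

lemma nn_integral_le_combination:
  fixes f g h :: "'b \<Rightarrow> real"
  assumes [measurable]: "g \<in> borel_measurable M" "h \<in> borel_measurable M"
    and "0 \<le> C" "\<And>x. 0 \<le> g x" "\<And>x. 0 \<le> h x" "\<And>x. f x \<le> C * (g x + h x)"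
  shows "(\<integral>\<^sup>+x. ennreal (f x) \<partial>M) \<le> ennreal C * ((\<integral>\<^sup>+x. ennreal (g x) \<partial>M) + (\<integral>\<^sup>+x. ennreal (h x) \<partial>M))"
proof -
  have "(\<integral>\<^sup>+x. ennreal (f x) \<partial>M) \<le> (\<integral>\<^sup>+x. ennreal C * (ennreal (g x) + ennreal (h x)) \<partial>M)"
    using assms by (intro nn_integral_mono) (simp add: ennreal_mult[symmetric] ennreal_plus[symmetric] ennreal_leI del: ennreal_plus)
  also have "\<dots> = ennreal C * ((\<integral>\<^sup>+x. ennreal (g x) \<partial>M) + (\<integral>\<^sup>+x. ennreal (h x) \<partial>M))"
    by (subst nn_integral_cmult, measurable, subst nn_integral_add, measurable)
  finally show ?thesis .
qed

lemma Wpow_le: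
  assumes [measurable]: "v \<in> borel_measurable lebesgue" "w \<in> borel_measurable lebesgue" and C: "0 \<le> C"
    and le: "\<And>x. \<bar>u x\<bar> powr p \<le> C * (\<bar>v x\<bar> powr p + \<bar>w x\<bar> powr p)"
      "\<And>x y. \<bar>u x - u y\<bar> powr p \<le> C * (\<bar>v x - v y\<bar> powr p + \<bar>w x - w y\<bar> powr p)"
  shows "Wpow u \<le> ennreal C * (Wpow v + Wpow w)"
proof -
  note borel_measurable_mu_if[measurable]
  have "Wpow u \<le> ennreal C * ((\<integral>\<^sup>+x. ennreal (\<bar>v x\<bar> powr p * indicator \<Omega> x) \<partial>mu_w \<beta>) +
        (\<integral>\<^sup>+x. ennreal (\<bar>w x\<bar> powr p * indicator \<Omega> x) \<partial>mu_w \<beta>)) +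
      ennreal C * ((\<integral>\<^sup>+z. ennreal (epow v z * indicator (\<Omega> \<times> \<Omega>) z) \<partial>\<nu>) +
        (\<integral>\<^sup>+z. ennreal (epow w z * indicator (\<Omega> \<times> \<Omega>) z) \<partial>\<nu>))"
    unfolding Wpow_def
    by (intro add_mono nn_integral_le_combination) (use C le in \<open>auto split: split_indicator\<close>)
  also have "\<dots> = ennreal C * (Wpow v + Wpow w)"
    unfolding Wpow_def by (simp add: distrib_left add_ac)
  finally show ?thesis .
qed

lemma Wpow_0: "Wpow (\<lambda>_. 0) = 0"
  by (simp add: Wpow_def)

lemma Wpow_add_le:
  assumes "v \<in> borel_measurable lebesgue" "w \<in> borel_measurable lebesgue"
  shows "Wpow (\<lambda>x. v x + w x) \<le> ennreal (2 powr p) * (Wpow v + Wpow w)"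
proof (rule Wpow_le[OF assms])
  show "\<bar>(v x + w x) - (v y + w y)\<bar> powr p \<le> 2 powr p * (\<bar>v x - v y\<bar> powr p + \<bar>w x - w y\<bar> powr p)" for x y
    using abs_powr_add_le[OF p_pos, of "v x - v y" "w x - w y"] by (simp add: algebra_simps)
qed (use abs_powr_add_le[OF p_pos] in auto)

lemma Wpow_scale_le:
  assumes "v \<in> borel_measurable lebesgue"
  shows "Wpow (\<lambda>x. a * v x) \<le> ennreal (\<bar>a\<bar> powr p) * Wpow v"
proof -
  have "Wpow (\<lambda>x. a * v x) \<le> ennreal (\<bar>a\<bar> powr p) * (Wpow v + Wpow (\<lambda>_. 0))"
  proof (rule Wpow_le[OF assms])
    show "\<bar>a * v x - a * v y\<bar> powr p \<le> \<bar>a\<bar> powr p * (\<bar>v x - v y\<bar> powr p + \<bar>0 - 0\<bar> powr p)" for x y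
      by (simp add: right_diff_distrib[symmetric] abs_mult powr_mult)
  qed (auto simp: abs_mult powr_mult)
  then show ?thesis by (simp add: Wpow_0)
qed

lemma Wpow_cong_AE:
  assumes "AE x in lebesgue. u x = v x" shows "Wpow u = Wpow v"
proof -
  have "AE x in mu_w \<beta>. u x = v x" using assms by (simp add: AE_mu_w_iff)
  moreover have "AE z in \<nu>. u (fst z) = v (fst z) \<and> u (snd z) = v (snd z)"
    by (rule AE_nu_w_fst_snd[OF assms])
  ultimately show ?thesis
    unfolding Wpow_def by (intro arg_cong2[where f = "(+)"] nn_integral_cong_AE) (auto elim!: AE_mp)
qed

lemma Cc_inf_continuous:
  assumes "\<phi> \<in> Cc_inf \<Omega>" shows "continuous_on UNIV \<phi>"
proof -
  have "continuous_on UNIV (dderiv [] \<phi>)"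
    using assms unfolding Cc_inf_def smooth_fun_def by blast
  then show ?thesis by simp
qed

lemma Cc_inf_measurable: "\<phi> \<in> Cc_inf \<Omega> \<Longrightarrow> \<phi> \<in> borel_measurable lebesgue"
  by (rule measurable_completion) (simp add: borel_measurable_continuous_onI Cc_inf_continuous)

lemma Cc_inf_zero:
  assumes "\<phi> \<in> Cc_inf \<Omega>" "x \<notin> \<Omega>" shows "\<phi> x = 0"
proof -
  have "{x. \<phi> x \<noteq> 0} \<subseteq> \<Omega>"
    using assms(1) order_trans[OF closure_subset[of "{x. \<phi> x \<noteq> 0}"]] by (simp add: Cc_inf_def)
  then show ?thesis using assms(2) by blast
qed

text \<open>A diagonal choice: the n-th test function is taken within 1/(n+1) of
  \<open>vs n\<close>.\<close>

lemma W_closed: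
  assumes vs: "\<And>n. vs n \<in> W" and v: "v \<in> borel_measurable lebesgue" "\<And>x. x \<notin> \<Omega> \<Longrightarrow> v x = 0"
    and lim: "(\<lambda>n. Wpow (\<lambda>x. vs n x - v x)) \<longlonglongrightarrow> 0"
  shows "v \<in> W"
proof -
  note meas = W_measurable[OF vs] v(1)
  have "\<exists>\<phi>\<in>Cc_inf \<Omega>. Wpow (\<lambda>x. \<phi> x - vs n x) < ennreal (1 / real (Suc n))" for n
  proof -
    obtain \<phi> where "\<And>m. \<phi> m \<in> Cc_inf \<Omega>" "(\<lambda>m. Wpow (\<lambda>x. \<phi> m x - vs n x)) \<longlonglongrightarrow> 0"
      using W_approx[OF vs[of n]] by blast
    moreover from this(2) have "\<forall>\<^sub>F m in sequentially. Wpow (\<lambda>x. \<phi> m x - vs n x) < ennreal (1 / real (Suc n))"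
      by (rule order_tendstoD) simp
    ultimately show ?thesis by (meson eventually_happens trivial_limit_sequentially)
  qed
  then obtain \<phi> where phi: "\<And>n. \<phi> n \<in> Cc_inf \<Omega>" "\<And>n. Wpow (\<lambda>x. \<phi> n x - vs n x) < ennreal (1 / real (Suc n))"
    by metis
  have "(\<lambda>n. ennreal (1 / real (Suc n))) \<longlonglongrightarrow> ennreal 0"
    by (intro tendsto_ennrealI LIMSEQ_Suc lim_1_over_n)
  then have "(\<lambda>n. ennreal (2 powr p) * (ennreal (1 / real (Suc n)) + Wpow (\<lambda>x. vs n x - v x))) \<longlonglongrightarrow> ennreal (2 powr p) * (0 + 0)"
    using lim by (intro ennreal_tendsto_cmult tendsto_add) auto
  then have up: "(\<lambda>n. ennreal (2 powr p) * (ennreal (1 / real (Suc n)) + Wpow (\<lambda>x. vs n x - v x))) \<longlonglongrightarrow> 0" by simp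
  have "(\<lambda>n. Wpow (\<lambda>x. \<phi> n x - v x)) \<longlonglongrightarrow> 0"
  proof (rule tendsto_sandwich[OF _ _ tendsto_const up]; (intro always_eventually allI)?)
    fix n
    have "Wpow (\<lambda>x. \<phi> n x - v x) = Wpow (\<lambda>x. (\<phi> n x - vs n x) + (vs n x - v x))" by simp
    also have "\<dots> \<le> ennreal (2 powr p) * (Wpow (\<lambda>x. \<phi> n x - vs n x) + Wpow (\<lambda>x. vs n x - v x))"
      using meas Cc_inf_measurable[OF phi(1)] by (intro Wpow_add_le borel_measurable_diff)
    also have "\<dots> \<le> ennreal (2 powr p) * (ennreal (1 / real (Suc n)) + Wpow (\<lambda>x. vs n x - v x))"
      using phi(2)[of n] by (intro mult_left_mono add_right_mono) auto
    finally show "Wpow (\<lambda>x. \<phi> n x - v x) \<le> ennreal (2 powr p) * (ennreal (1 / real (Suc n)) + Wpow (\<lambda>x. vs n x - v x))" .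
  qed simp
  moreover have "Wpow v < \<infinity>"
  proof -
    have "\<forall>\<^sub>F n in sequentially. Wpow (\<lambda>x. vs n x - v x) < 1"
      using lim by (rule order_tendstoD) simp
    then obtain n where n: "Wpow (\<lambda>x. vs n x - v x) < 1" by (auto simp: eventually_sequentially)
    have "Wpow v = Wpow (\<lambda>x. vs n x + (- 1) * (vs n x - v x))" by simp
    also have "\<dots> \<le> ennreal (2 powr p) * (Wpow (vs n) + Wpow (\<lambda>x. (- 1) * (vs n x - v x)))"
      using meas by (intro Wpow_add_le borel_measurable_times borel_measurable_const borel_measurable_diff)
    also have "\<dots> \<le> ennreal (2 powr p) * (Wpow (vs n) + ennreal (\<bar>- 1\<bar> powr p) * Wpow (\<lambda>x. vs n x - v x))"
      using meas by (intro mult_left_mono add_left_mono Wpow_scale_le borel_measurable_diff) auto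
    also have "\<dots> < \<infinity>"
      using W_Wpow[OF vs[of n]] n by (auto simp: ennreal_mult_less_top intro: less_trans)
    finally show ?thesis .
  qed
  ultimately show ?thesis using v phi(1) by (auto simp: W_iff)
qed

text \<open>\<open>Wsp0\<close> consists of functions, not classes, while limits are identified only
  almost everywhere. A constant sequence in \<open>W_closed\<close> performs the change of
  representative.\<close>

lemma W_cong_AE:
  assumes "u \<in> W" "AE x in lebesgue. v x = u x" "v \<in> borel_measurable lebesgue" "\<And>x. x \<notin> \<Omega> \<Longrightarrow> v x = 0"
  shows "v \<in> W"
proof (rule W_closed[of "\<lambda>_. u"])
  have "Wpow (\<lambda>x. u x - v x) = Wpow (\<lambda>_. 0)"
    using assms(2) by (intro Wpow_cong_AE) (auto elim: AE_mp)
  then show "(\<lambda>n. Wpow (\<lambda>x. u x - v x)) \<longlonglongrightarrow> 0" by (simp add: Wpow_def)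
qed (use assms in auto)

lemma Cc_inf_in_W:
  assumes "\<phi> \<in> Cc_inf \<Omega>" "Wpow \<phi> < \<infinity>" shows "\<phi> \<in> W"
  using assms Cc_inf_measurable Cc_inf_zero
  by (auto simp: W_iff intro!: exI[of _ "\<lambda>_. \<phi>"]) (simp add: Wpow_def)

lemma W_0: "(\<lambda>_. 0) \<in> W"
  by (intro Cc_inf_in_W Cc_inf_0) (simp add: Wpow_def)

lemma W_linear_combination:
  assumes u: "u \<in> W" and v: "v \<in> W"
  shows "(\<lambda>x. a * u x + b * v x) \<in> W"
proof -
  obtain \<phi> where phi: "\<And>n. \<phi> n \<in> Cc_inf \<Omega>" "(\<lambda>n. Wpow (\<lambda>x. \<phi> n x - u x)) \<longlonglongrightarrow> 0"
    using W_approx[OF u] by blast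
  obtain \<psi> where psi: "\<And>n. \<psi> n \<in> Cc_inf \<Omega>" "(\<lambda>n. Wpow (\<lambda>x. \<psi> n x - v x)) \<longlonglongrightarrow> 0"
    using W_approx[OF v] by blast
  have le: "Wpow (\<lambda>x. a * f x + b * g x) \<le>
      ennreal (2 powr p) * (ennreal (\<bar>a\<bar> powr p) * Wpow f + ennreal (\<bar>b\<bar> powr p) * Wpow g)"
    if "f \<in> borel_measurable lebesgue" "g \<in> borel_measurable lebesgue" for f g
    using that by (intro order_trans[OF Wpow_add_le] mult_left_mono add_mono Wpow_scale_le) auto
  note meas = W_measurable[OF u] W_measurable[OF v]
  have "Wpow (\<lambda>x. a * u x + b * v x) < \<infinity>"
    using le[OF meas] W_Wpow[OF u] W_Wpow[OF v]
    by (auto intro: le_less_trans simp: ennreal_mult_less_top)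
  moreover have "(\<lambda>n. Wpow (\<lambda>x. (a * \<phi> n x + b * \<psi> n x) - (a * u x + b * v x))) \<longlonglongrightarrow> 0"
  proof -
    have "(\<lambda>n. ennreal (2 powr p) * (ennreal (\<bar>a\<bar> powr p) * Wpow (\<lambda>x. \<phi> n x - u x) +
        ennreal (\<bar>b\<bar> powr p) * Wpow (\<lambda>x. \<psi> n x - v x))) \<longlonglongrightarrow>
        ennreal (2 powr p) * (ennreal (\<bar>a\<bar> powr p) * 0 + ennreal (\<bar>b\<bar> powr p) * 0)"
      by (intro ennreal_tendsto_cmult tendsto_add phi psi) auto
    then have up: "(\<lambda>n. ennreal (2 powr p) * (ennreal (\<bar>a\<bar> powr p) * Wpow (\<lambda>x. \<phi> n x - u x) +
        ennreal (\<bar>b\<bar> powr p) * Wpow (\<lambda>x. \<psi> n x - v x))) \<longlonglongrightarrow> 0" by simp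
    show ?thesis
    proof (rule tendsto_sandwich[OF _ _ tendsto_const up]; (intro always_eventually allI)?)
      fix n
      have "(\<lambda>x. (a * \<phi> n x + b * \<psi> n x) - (a * u x + b * v x)) =
          (\<lambda>x. a * (\<phi> n x - u x) + b * (\<psi> n x - v x))" by (auto simp: algebra_simps)
      then show "Wpow (\<lambda>x. (a * \<phi> n x + b * \<psi> n x) - (a * u x + b * v x)) \<le>
          ennreal (2 powr p) * (ennreal (\<bar>a\<bar> powr p) * Wpow (\<lambda>x. \<phi> n x - u x) +
          ennreal (\<bar>b\<bar> powr p) * Wpow (\<lambda>x. \<psi> n x - v x))"
        using le[of "\<lambda>x. \<phi> n x - u x" "\<lambda>x. \<psi> n x - v x"] meas Cc_inf_measurable[OF phi(1)] Cc_inf_measurable[OF psi(1)]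
        by simp
    qed simp
  qed
  moreover have "(\<lambda>x. a * \<phi> n x + b * \<psi> n x) \<in> Cc_inf \<Omega>" for n
    by (rule Cc_inf_linear_combination[OF phi(1) psi(1)])
  ultimately show ?thesis
    using meas W_zero[OF u] W_zero[OF v] unfolding W_iff
    by (auto intro!: exI[of _ "\<lambda>n x. a * \<phi> n x + b * \<psi> n x"])
qed

lemma AE_lebesgue_if_dom:
  assumes "AE x in lebesgue. x \<in> \<Omega> \<longrightarrow> P x" "\<And>x. x \<notin> \<Omega> \<Longrightarrow> P x"
  shows "AE x in lebesgue. P x"
  using assms(1) by eventually_elim (use assms(2) in blast)

lemma Wpow_tendsto_0_AE_subseq:
  assumes meas: "\<And>n. v n \<in> borel_measurable lebesgue" and zero: "\<And>n x. x \<notin> \<Omega> \<Longrightarrow> v n x = 0"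
    and lim: "(\<lambda>n. Wpow (v n)) \<longlonglongrightarrow> 0"
  obtains r where "strict_mono r" "AE x in lebesgue. (\<lambda>n. v (r n) x) \<longlonglongrightarrow> 0"
proof -
  note meas[measurable] borel_measurable_mu_if[measurable]
  have "(\<lambda>n. \<integral>\<^sup>+x. ennreal (\<bar>v n x\<bar> powr p * indicator \<Omega> x) \<partial>mu_w \<beta>) \<longlonglongrightarrow> 0"
    by (rule tendsto_sandwich[OF _ _ tendsto_const lim]) (auto simp: Wpow_def)
  then obtain r where r: "strict_mono r" "AE x in mu_w \<beta>. (\<lambda>n. \<bar>v (r n) x\<bar> powr p * indicator \<Omega> x) \<longlonglongrightarrow> 0"
    by (rule nn_integral_tendsto_0_AE_subseq[rotated 2]) auto
  have "AE x in lebesgue. x \<in> \<Omega> \<longrightarrow> (\<lambda>n. v (r n) x) \<longlonglongrightarrow> 0"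
    using r(2) unfolding AE_mu_w_iff
  proof eventually_elim
    case (elim x)
    show ?case
    proof
      assume "x \<in> \<Omega>"
      then have "(\<lambda>n. \<bar>v (r n) x\<bar> powr p) \<longlonglongrightarrow> 0" using elim by simp
      then have "(\<lambda>n. (\<bar>v (r n) x\<bar> powr p) powr (1 / p)) \<longlonglongrightarrow> 0 powr (1 / p)"
        by (rule tendsto_powr'[OF _ tendsto_const]) (use p_pos in auto)
      then have "(\<lambda>n. \<bar>v (r n) x\<bar>) \<longlonglongrightarrow> 0" using p_pos by (simp add: powr_powr)
      then show "(\<lambda>n. v (r n) x) \<longlonglongrightarrow> 0" by (rule tendsto_rabs_zero_cancel)
    qed
  qed
  then have "AE x in lebesgue. (\<lambda>n. v (r n) x) \<longlonglongrightarrow> 0"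
    by (rule AE_lebesgue_if_dom) (simp add: zero)
  with r(1) show ?thesis by (rule that)
qed

text \<open>A fixed term in b plus an error in a - b, the shape that
  \<open>nn_integral_tendsto_0_dominated\<close> asks for.\<close>

lemma powr_diff_dominated:
  fixes A B a b :: real
  assumes "\<bar>A\<bar> \<le> \<bar>a\<bar>" "\<bar>B\<bar> \<le> \<bar>b\<bar>"
  shows "\<bar>A - B\<bar> powr p \<le> 2 powr p * (2 powr p + 1) * \<bar>b\<bar> powr p + 2 powr p * 2 powr p * \<bar>a - b\<bar> powr p"
proof -
  have "\<bar>A - B\<bar> powr p \<le> 2 powr p * (\<bar>A\<bar> powr p + \<bar>B\<bar> powr p)" by (rule abs_powr_diff_le[OF p_pos])
  also have "\<dots> \<le> 2 powr p * (\<bar>a\<bar> powr p + \<bar>b\<bar> powr p)"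
    using assms p_pos by (intro mult_left_mono add_mono powr_mono2) auto
  also have "\<dots> \<le> 2 powr p * (2 powr p * (\<bar>a - b\<bar> powr p + \<bar>b\<bar> powr p) + \<bar>b\<bar> powr p)"
    using abs_powr_add_le[OF p_pos, of "a - b" b] by (intro mult_left_mono add_mono) auto
  finally show ?thesis by (simp add: algebra_simps)
qed

text \<open>The seminorm of G(\<phi>) - G(u) is not controlled by that of \<phi> - u, even for a
  contraction G, so no direct estimate is available. What contractions do give is a bound of the
  increments of each term separately; with convergence almost everywhere, dominated convergence
  concludes.\<close>

lemma Wpow_tendsto_0_contraction:
  assumes phi: "\<And>n. \<phi> n \<in> borel_measurable lebesgue" and u: "u \<in> borel_measurable lebesgue" "Wpow u < \<infinity>"
    and lim: "(\<lambda>n. Wpow (\<lambda>x. \<phi> n x - u x)) \<longlonglongrightarrow> 0"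
    and G: "\<And>n a b. \<bar>G n a - G n b\<bar> \<le> \<bar>a - b\<bar>" "\<And>n. G n 0 = 0" "\<And>n. G n \<in> borel_measurable borel"
    and G': "\<And>a b. \<bar>G' a - G' b\<bar> \<le> \<bar>a - b\<bar>" "G' 0 = 0" "G' \<in> borel_measurable borel"
    and AE: "AE x in lebesgue. (\<lambda>n. G n (\<phi> n x)) \<longlonglongrightarrow> G' (u x)"
  shows "(\<lambda>n. Wpow (\<lambda>x. G n (\<phi> n x) - G' (u x))) \<longlonglongrightarrow> 0"
proof -
  note phi[measurable] u(1)[measurable] G(3)[measurable] G'(3)[measurable] borel_measurable_mu_if[measurable]
  define C where "C = 2 powr p * (2 powr p + 1)"
  define C' where "C' = 2 powr p * 2 powr p"
  have C: "0 \<le> C" "0 \<le> C'" by (auto simp: C_def C'_def)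
  have lim0: "(\<lambda>n. \<bar>a n - b\<bar> powr p) \<longlonglongrightarrow> 0" if "a \<longlonglongrightarrow> b" for a :: "nat \<Rightarrow> real" and b
  proof -
    have "(\<lambda>n. \<bar>a n - b\<bar>) \<longlonglongrightarrow> 0" using that by (auto intro!: tendsto_eq_intros)
    then have "(\<lambda>n. \<bar>a n - b\<bar> powr p) \<longlonglongrightarrow> 0 powr p"
      by (rule tendsto_powr'[OF _ tendsto_const]) (use p_pos in auto)
    then show ?thesis by simp
  qed
  have split: "(\<lambda>n. \<integral>\<^sup>+x. ennreal (\<bar>\<phi> n x - u x\<bar> powr p * indicator \<Omega> x) \<partial>mu_w \<beta>) \<longlonglongrightarrow> 0"
    "(\<lambda>n. \<integral>\<^sup>+z. ennreal (\<bar>(\<phi> n (fst z) - u (fst z)) - (\<phi> n (snd z) - u (snd z))\<bar> powr p * indicator (\<Omega> \<times> \<Omega>) z) \<partial>\<nu>) \<longlonglongrightarrow> 0"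
    by (rule tendsto_sandwich[OF _ _ tendsto_const lim]; simp add: Wpow_def)+
  have scale: "(\<lambda>n. \<integral>\<^sup>+x. ennreal (C' * e n x) \<partial>M) \<longlonglongrightarrow> 0"
    if "(\<lambda>n. \<integral>\<^sup>+x. ennreal (e n x) \<partial>M) \<longlonglongrightarrow> 0" "\<And>n. e n \<in> borel_measurable M"
    for e :: "nat \<Rightarrow> 'b \<Rightarrow> real" and M
  proof -
    have "(\<lambda>n. ennreal C' * (\<integral>\<^sup>+x. ennreal (e n x) \<partial>M)) \<longlonglongrightarrow> ennreal C' * 0"
      by (intro ennreal_tendsto_cmult that) auto
    moreover have "(\<integral>\<^sup>+x. ennreal (C' * e n x) \<partial>M) = ennreal C' * (\<integral>\<^sup>+x. ennreal (e n x) \<partial>M)" for n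
    proof -
      have "(\<integral>\<^sup>+x. ennreal (C' * e n x) \<partial>M) = (\<integral>\<^sup>+x. ennreal C' * ennreal (e n x) \<partial>M)"
        using C by (intro nn_integral_cong ennreal_mult')
      also have "\<dots> = ennreal C' * (\<integral>\<^sup>+x. ennreal (e n x) \<partial>M)"
        by (rule nn_integral_cmult) (rule measurable_compose[OF that(2) measurable_ennreal])
      finally show ?thesis .
    qed
    ultimately show ?thesis by simp
  qed
  have fin: "integrable (mu_w \<beta>) (\<lambda>x. C * (\<bar>u x\<bar> powr p * indicator \<Omega> x))"
    "integrable \<nu> (\<lambda>z. C * (epow u z * indicator (\<Omega> \<times> \<Omega>) z))"
    using u(2) unfolding Wpow_def
    by (intro integrable_mult_right integrableI_nonneg; auto)+
  have 1: "(\<lambda>n. \<integral>\<^sup>+x. ennreal (\<bar>G n (\<phi> n x) - G' (u x)\<bar> powr p * indicator \<Omega> x) \<partial>mu_w \<beta>) \<longlonglongrightarrow> 0"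
  proof (rule nn_integral_tendsto_0_dominated[OF _ _ fin(1) _ _ _ _ _ scale[OF split(1)]])
    show "AE x in mu_w \<beta>. (\<lambda>n. \<bar>G n (\<phi> n x) - G' (u x)\<bar> powr p * indicator \<Omega> x) \<longlonglongrightarrow> 0"
      unfolding AE_mu_w_iff using AE
    proof eventually_elim
      case (elim x)
      from tendsto_mult[OF lim0[OF elim] tendsto_const[of "indicator \<Omega> x"]] show ?case by simp
    qed
    show "\<bar>G n (\<phi> n x) - G' (u x)\<bar> powr p * indicator \<Omega> x \<le>
        C * (\<bar>u x\<bar> powr p * indicator \<Omega> x) + C' * (\<bar>\<phi> n x - u x\<bar> powr p * indicator \<Omega> x)" for n x
      using powr_diff_dominated[of "G n (\<phi> n x)" "\<phi> n x" "G' (u x)" "u x"]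
        G(1)[of n "\<phi> n x" 0] G'(1)[of "u x" 0]
      by (auto simp: G(2) G'(2) C_def C'_def split: split_indicator)
  qed (use C in auto)
  have 2: "(\<lambda>n. \<integral>\<^sup>+z. ennreal (\<bar>(G n (\<phi> n (fst z)) - G' (u (fst z))) - (G n (\<phi> n (snd z)) - G' (u (snd z)))\<bar> powr p *
      indicator (\<Omega> \<times> \<Omega>) z) \<partial>\<nu>) \<longlonglongrightarrow> 0"
  proof (rule nn_integral_tendsto_0_dominated[OF _ _ fin(2) _ _ _ _ _ scale[OF split(2)]])
    show "AE z in \<nu>. (\<lambda>n. \<bar>(G n (\<phi> n (fst z)) - G' (u (fst z))) - (G n (\<phi> n (snd z)) - G' (u (snd z)))\<bar> powr p *
      indicator (\<Omega> \<times> \<Omega>) z) \<longlonglongrightarrow> 0"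
      using AE_nu_w_fst_snd[OF AE]
    proof eventually_elim
      case (elim z)
      then have "(\<lambda>n. G n (\<phi> n (fst z)) - G n (\<phi> n (snd z))) \<longlonglongrightarrow> G' (u (fst z)) - G' (u (snd z))"
        by (intro tendsto_diff) auto
      from tendsto_mult[OF lim0[OF this] tendsto_const[of "indicator (\<Omega> \<times> \<Omega>) z"]]
      show ?case by (simp add: algebra_simps)
    qed
    show "\<bar>(G n (\<phi> n (fst z)) - G' (u (fst z))) - (G n (\<phi> n (snd z)) - G' (u (snd z)))\<bar> powr p * indicator (\<Omega> \<times> \<Omega>) z \<le>
        C * (epow u z * indicator (\<Omega> \<times> \<Omega>) z) +
        C' * (\<bar>(\<phi> n (fst z) - u (fst z)) - (\<phi> n (snd z) - u (snd z))\<bar> powr p * indicator (\<Omega> \<times> \<Omega>) z)" for n z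
    proof (cases "z \<in> \<Omega> \<times> \<Omega>")
      case True
      have eq: "(G n (\<phi> n (fst z)) - G' (u (fst z))) - (G n (\<phi> n (snd z)) - G' (u (snd z))) =
          (G n (\<phi> n (fst z)) - G n (\<phi> n (snd z))) - (G' (u (fst z)) - G' (u (snd z)))"
        "(\<phi> n (fst z) - u (fst z)) - (\<phi> n (snd z) - u (snd z)) = (\<phi> n (fst z) - \<phi> n (snd z)) - incr u z"
        by auto
      show ?thesis
        using powr_diff_dominated[OF G(1)[of n "\<phi> n (fst z)" "\<phi> n (snd z)"] G'(1)[of "u (fst z)" "u (snd z)"]] True
        unfolding eq C_def C'_def by simp
    qed simp
  qed (use C in auto)
  from tendsto_add[OF 1 2] show ?thesis unfolding Wpow_def by simp
qed

text \<open>The approximants apply the smoothed modulus to smooth approximants of u, so they stay in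
  \<open>Cc_inf\<close>. Truncations, maxima and minima then follow by linearity.\<close>

lemma W_abs_shift:
  assumes u: "u \<in> W" shows "(\<lambda>x. \<bar>u x + c\<bar> - \<bar>c\<bar>) \<in> W"
proof -
  obtain \<phi> where phi: "\<And>n. \<phi> n \<in> Cc_inf \<Omega>" "(\<lambda>n. Wpow (\<lambda>x. \<phi> n x - u x)) \<longlonglongrightarrow> 0"
    using W_approx[OF u] by blast
  note um = W_measurable[OF u] and pm = Cc_inf_measurable[OF phi(1)]
  \<comment> \<open>\<open>Wpow_tendsto_0_contraction\<close> requires pointwise convergence, hence
    the passage to a subsequence.\<close>
  obtain r where r: "strict_mono r" "AE x in lebesgue. (\<lambda>n. \<phi> (r n) x - u x) \<longlonglongrightarrow> 0"
    using Wpow_tendsto_0_AE_subseq[OF _ _ phi(2)] um pm Cc_inf_zero[OF phi(1)] W_zero[OF u] by auto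
  have lim: "(\<lambda>n. Wpow (\<lambda>x. \<phi> (r n) x - u x)) \<longlonglongrightarrow> 0"
    using LIMSEQ_subseq_LIMSEQ[OF phi(2) r(1)] by (simp add: o_def)
  define \<epsilon> where "\<epsilon> n = 1 / real (Suc n)" for n
  have eps: "0 < \<epsilon> n" for n by (simp add: \<epsilon>_def)
  have eps0: "\<epsilon> \<longlonglongrightarrow> 0" unfolding \<epsilon>_def[abs_def] by (rule LIMSEQ_Suc[OF lim_1_over_n])
  define v where "v x = \<bar>u x + c\<bar> - \<bar>c\<bar>" for x
  have vm: "v \<in> borel_measurable lebesgue" using um unfolding v_def by measurable
  have "Wpow v \<le> ennreal 1 * (Wpow u + Wpow (\<lambda>_. 0))"
    by (rule Wpow_le[OF um]) (use p_pos in \<open>auto simp: v_def intro!: powr_mono2\<close>)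
  then have fin: "Wpow v < \<infinity>" using W_Wpow[OF u] le_less_trans by (fastforce simp: Wpow_0)
  have "(\<lambda>n. Wpow (\<lambda>x. abs_reg c (\<epsilon> n) (\<phi> (r n) x) - (\<lambda>a. \<bar>a + c\<bar> - \<bar>c\<bar>) (u x))) \<longlonglongrightarrow> 0"
  proof (rule Wpow_tendsto_0_contraction[OF pm um W_Wpow[OF u] lim])
    show "abs_reg c (\<epsilon> n) \<in> borel_measurable borel" for n
      unfolding abs_reg_def[abs_def] by measurable
    show "AE x in lebesgue. (\<lambda>n. abs_reg c (\<epsilon> n) (\<phi> (r n) x)) \<longlonglongrightarrow> \<bar>u x + c\<bar> - \<bar>c\<bar>"
      using r(2) by eventually_elim (intro abs_reg_tendsto eps0, simp add: LIM_zero_iff)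
  qed (auto simp: abs_reg_0 intro: abs_reg_diff_le)
  moreover have "(\<lambda>x. abs_reg c (\<epsilon> n) (\<phi> (r n) x)) \<in> Cc_inf \<Omega>" for n
    by (rule Cc_inf_abs_reg[OF phi(1) eps])
  ultimately have "v \<in> W"
    using vm fin W_zero[OF u] unfolding W_iff
    by (intro conjI exI[of _ "\<lambda>n x. abs_reg c (\<epsilon> n) (\<phi> (r n) x)"]) (auto simp: v_def)
  then show ?thesis by (simp add: v_def[abs_def])
qed

lemma W_add: "u \<in> W \<Longrightarrow> v \<in> W \<Longrightarrow> (\<lambda>x. u x + v x) \<in> W"
  using W_linear_combination[of u v 1 1] by simp

lemma W_diff: "u \<in> W \<Longrightarrow> v \<in> W \<Longrightarrow> (\<lambda>x. u x - v x) \<in> W"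
  using W_linear_combination[of u v 1 "- 1"] by simp

lemma W_Tk:
  assumes "u \<in> W" "0 \<le> k" shows "(\<lambda>x. Tk k (u x)) \<in> W"
proof -
  have "(\<lambda>x. (1/2) * (\<bar>u x + k\<bar> - \<bar>k\<bar>) + (- (1/2)) * (\<bar>u x + - k\<bar> - \<bar>- k\<bar>)) \<in> W"
    by (intro W_linear_combination W_abs_shift assms)
  moreover have "(\<lambda>x. (1/2) * (\<bar>u x + k\<bar> - \<bar>k\<bar>) + (- (1/2)) * (\<bar>u x + - k\<bar> - \<bar>- k\<bar>)) = (\<lambda>x. Tk k (u x))"
    by (rule ext) (simp add: Tk_eq_abs[OF assms(2)] diff_divide_distrib)
  ultimately show ?thesis by simp
qed

lemma W_max:
  assumes "u \<in> W" "v \<in> W" shows "(\<lambda>x. max (u x) (v x)) \<in> W"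
proof -
  have "(\<lambda>x. (1/2) * (u x + v x) + (1/2) * (\<bar>(u x - v x) + 0\<bar> - \<bar>0\<bar>)) \<in> W"
    by (intro W_linear_combination W_abs_shift W_add W_diff assms)
  moreover have "(\<lambda>x. (1/2) * (u x + v x) + (1/2) * (\<bar>(u x - v x) + 0\<bar> - \<bar>0\<bar>)) = (\<lambda>x. max (u x) (v x))"
    by (rule ext) (auto simp: max_def abs_if field_simps)
  ultimately show ?thesis by simp
qed

lemma W_min:
  assumes "u \<in> W" "v \<in> W" shows "(\<lambda>x. min (u x) (v x)) \<in> W"
proof -
  have "(\<lambda>x. (u x + v x) - max (u x) (v x)) \<in> W"
    by (intro W_diff W_add W_max assms)
  moreover have "(\<lambda>x. (u x + v x) - max (u x) (v x)) = (\<lambda>x. min (u x) (v x))" by auto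
  ultimately show ?thesis by simp
qed

end

section \<open>Functions of finite energy on the whole product, and convexity of the energy\<close>

context weighted_domain
begin

lemma incr_measurable:
  assumes "w \<in> borel_measurable lebesgue" shows "incr w \<in> borel_measurable \<nu>"
  using measurable_compose[OF measurable_nu_w_fst assms] measurable_compose[OF measurable_nu_w_snd assms]
  by (rule borel_measurable_diff)

text \<open>Membership in \<open>W\<close> controls the increments on \<Omega> x \<Omega> only; the
  integrability added here also covers the pairs with one point in the exterior, so that the form is
  finite on this class.\<close>

definition En :: "('a \<Rightarrow> real) set" where
  "En = {w \<in> W. integrable \<nu> (\<lambda>z. epow w z)}"

definition Q :: "('a \<Rightarrow> real) \<Rightarrow> real" where
  "Q w = (\<integral>z. epow w z \<partial>\<nu>)"

lemma En_W: "w \<in> En \<Longrightarrow> w \<in> W"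
  and En_integrable: "w \<in> En \<Longrightarrow> integrable \<nu> (\<lambda>z. epow w z)"
  and En_measurable: "w \<in> En \<Longrightarrow> w \<in> borel_measurable lebesgue"
  by (auto simp: En_def W_measurable)

lemma En_incr_measurable: "w \<in> En \<Longrightarrow> incr w \<in> borel_measurable \<nu>"
  by (intro incr_measurable En_measurable)

lemma Q_nonneg: "0 \<le> Q w"
  unfolding Q_def by (intro integral_nonneg_AE) simp

lemma powr_incr_measurable:
  assumes [measurable]: "w \<in> borel_measurable lebesgue"
  shows "(\<lambda>z. epow w z) \<in> borel_measurable \<nu>"
  by measurable

lemma En_I:
  assumes w: "w \<in> W" and uv: "u \<in> En" "v \<in> En"
    and le: "\<And>x y. \<bar>w x - w y\<bar> powr p \<le> C * (\<bar>u x - u y\<bar> powr p + \<bar>v x - v y\<bar> powr p)"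
  shows "w \<in> En"
proof -
  have "integrable \<nu> (\<lambda>z. C * (epow u z + epow v z))"
    by (intro integrable_mult_right Bochner_Integration.integrable_add En_integrable uv)
  then have "integrable \<nu> (\<lambda>z. epow w z)"
  proof (rule Bochner_Integration.integrable_bound)
    show "AE z in \<nu>. norm (epow w z) \<le> norm (C * (epow u z + epow v z))"
      using le by (intro always_eventually allI) (smt (verit) powr_ge_zero real_norm_def)
  qed (rule powr_incr_measurable[OF W_measurable[OF w]])
  then show ?thesis using w by (simp add: En_def)
qed

lemma En_0: "(\<lambda>_. 0) \<in> En"
  by (simp add: En_def W_0)

lemma En_linear_combination:
  assumes "u \<in> En" "v \<in> En" shows "(\<lambda>x. a * u x + b * v x) \<in> En"
proof (rule En_I[OF W_linear_combination[OF assms[THEN En_W]] assms])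
  fix x y
  let ?c = "\<bar>u x - u y\<bar> powr p" and ?d = "\<bar>v x - v y\<bar> powr p"
  have "(a * u x + b * v x) - (a * u y + b * v y) = a * (u x - u y) + b * (v x - v y)"
    by (simp add: algebra_simps)
  then have "\<bar>(a * u x + b * v x) - (a * u y + b * v y)\<bar> powr p \<le>
      2 powr p * (\<bar>a * (u x - u y)\<bar> powr p + \<bar>b * (v x - v y)\<bar> powr p)"
    using abs_powr_add_le[OF p_pos, of "a * (u x - u y)" "b * (v x - v y)"] by (simp only:)
  also have "\<dots> = 2 powr p * (\<bar>a\<bar> powr p * ?c + \<bar>b\<bar> powr p * ?d)"
    by (simp only: abs_mult powr_mult)
  also have "\<dots> \<le> 2 powr p * ((\<bar>a\<bar> powr p + \<bar>b\<bar> powr p) * (?c + ?d))"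
    by (intro mult_left_mono) (simp_all add: distrib_left distrib_right)
  finally show "\<bar>(a * u x + b * v x) - (a * u y + b * v y)\<bar> powr p \<le>
      2 powr p * (\<bar>a\<bar> powr p + \<bar>b\<bar> powr p) * (?c + ?d)" by (simp only: mult.assoc)
qed

lemma En_diff: "u \<in> En \<Longrightarrow> v \<in> En \<Longrightarrow> (\<lambda>x. u x - v x) \<in> En"
  using En_linear_combination[of u v 1 "- 1"] by simp

lemma En_Tk:
  assumes "u \<in> En" "0 \<le> k" shows "(\<lambda>x. Tk k (u x)) \<in> En"
proof (rule En_I[OF W_Tk[OF En_W[OF assms(1)] assms(2)] assms(1) En_0, of 1])
  show "\<bar>Tk k (u x) - Tk k (u y)\<bar> powr p \<le> 1 * (\<bar>u x - u y\<bar> powr p + \<bar>0 - 0\<bar> powr p)" for x y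
    using powr_mono2[OF less_imp_le[OF p_pos] abs_ge_zero abs_Tk_diff_le[of k "u x" "u y"]] by simp
qed

lemma En_lattice:
  assumes "u \<in> En" "v \<in> En"
  shows "(\<lambda>x. max (u x) (v x)) \<in> En" "(\<lambda>x. min (u x) (v x)) \<in> En"
proof -
  have le: "t powr p \<le> 1 * (\<bar>a\<bar> powr p + \<bar>b\<bar> powr p)" if "0 \<le> t" "t \<le> \<bar>a\<bar> \<or> t \<le> \<bar>b\<bar>" for t a b :: real
  proof -
    have "t powr p \<le> \<bar>a\<bar> powr p \<or> t powr p \<le> \<bar>b\<bar> powr p"
      using that p_pos by (auto intro!: powr_mono2)
    then show ?thesis using powr_ge_zero[of "\<bar>a\<bar>" p] powr_ge_zero[of "\<bar>b\<bar>" p]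
      by (elim disjE) (auto intro: add_increasing add_increasing2)
  qed
  show "(\<lambda>x. max (u x) (v x)) \<in> En"
    by (rule En_I[OF W_max[OF assms[THEN En_W]] assms]) (rule le, simp, linarith)
  show "(\<lambda>x. min (u x) (v x)) \<in> En"
    by (rule En_I[OF W_min[OF assms[THEN En_W]] assms]) (rule le, simp, linarith)
qed

lemma integrable_Lp_phi_mult:
  assumes m: "a \<in> borel_measurable M" "b \<in> borel_measurable M"
    and i: "integrable M (\<lambda>z. \<bar>a z\<bar> powr p)" "integrable M (\<lambda>z. \<bar>b z\<bar> powr p)"
  shows "integrable M (\<lambda>z. Lp_phi p (a z) * b z)"
proof (rule Bochner_Integration.integrable_bound[OF Bochner_Integration.integrable_add[OF i]])
  show "(\<lambda>z. Lp_phi p (a z) * b z) \<in> borel_measurable M" using m by measurable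
  show "AE z in M. norm (Lp_phi p (a z) * b z) \<le> norm (\<bar>a z\<bar> powr p + \<bar>b z\<bar> powr p)"
  proof (intro always_eventually allI)
    fix z
    have "norm (Lp_phi p (a z) * b z) = \<bar>a z\<bar> powr (p - 1) * \<bar>b z\<bar>"
      by (simp only: real_norm_def abs_mult abs_Lp_phi)
    also have "\<dots> \<le> \<bar>a z\<bar> powr p + \<bar>b z\<bar> powr p"
      by (rule powr_minus_one_mult_le[OF p_gt_1]) auto
    also have "\<dots> \<le> norm (\<bar>a z\<bar> powr p + \<bar>b z\<bar> powr p)" by simp
    finally show "norm (Lp_phi p (a z) * b z) \<le> norm (\<bar>a z\<bar> powr p + \<bar>b z\<bar> powr p)" .
  qed
qed

lemma En_integrable_Lp_phi:
  "u \<in> En \<Longrightarrow> v \<in> En \<Longrightarrow> integrable \<nu> (\<lambda>z. flux u v z)"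
  by (intro integrable_Lp_phi_mult En_integrable En_incr_measurable)

text \<open>Between an interior and an exterior point the increment is the value itself. A property
  of the increments, such as being a Cauchy sequence, thereby passes to the functions.\<close>

lemma AE_dom_incr:
  assumes "AE z in \<nu>. P (\<lambda>n :: nat. incr (w n) z)" "\<And>n x. x \<notin> \<Omega> \<Longrightarrow> w n x = 0"
  shows "AE x in lebesgue. x \<in> \<Omega> \<longrightarrow> P (\<lambda>n. w n x)"
proof (rule AE_dom_if_AE_exterior)
  show "AE z in \<nu>. fst z \<in> \<Omega> \<and> snd z \<notin> \<Omega> \<longrightarrow> P (\<lambda>n. w n (fst z))"
    using assms(1)
  proof eventually_elim
    case (elim z)
    show ?case
    proof
      assume "fst z \<in> \<Omega> \<and> snd z \<notin> \<Omega>"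
      then have "(\<lambda>n. incr (w n) z) = (\<lambda>n. w n (fst z))" by (simp add: assms(2))
      then show "P (\<lambda>n. w n (fst z))" using elim by simp
    qed
  qed
qed

lemma mu_dom_finite: "integrable (mu_w \<beta>) (\<lambda>x. C * indicator \<Omega> x :: real)"
proof -
  obtain R where R: "0 < R" "\<Omega> \<subseteq> ball 0 R"
    using bounded_subset_ballD[OF bounded_dom, of 0] by blast
  have "emeasure (mu_w \<beta>) \<Omega> = (\<integral>\<^sup>+x\<in>\<Omega>. ennreal (1 / norm x powr (2 * \<beta>)) \<partial>lebesgue)"
    unfolding mu_w_def by (rule emeasure_density) auto
  also have "\<dots> \<le> (\<integral>\<^sup>+x\<in>ball (0::'a) R. ennreal (1 / norm x powr (2 * \<beta>)) \<partial>lebesgue)"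
    using R by (intro nn_integral_mono mult_left_mono) (auto split: split_indicator)
  also have "\<dots> < \<infinity>"
    by (rule nn_integral_norm_powr_ball_finite) (use beta_nonneg beta_less R in auto)
  finally show ?thesis by (intro integrable_mult_right integrable_real_indicator) auto
qed

text \<open>\<Omega> has finite weighted measure, so for uniformly bounded functions the L^p part of
  the norm is settled by convergence almost everywhere.\<close>

lemma Lp_tendsto_0_bounded:
  assumes meas: "\<And>n. v n \<in> borel_measurable lebesgue" and bd: "\<And>n x. \<bar>v n x\<bar> \<le> K"
    and lim: "AE x in lebesgue. (\<lambda>n. v n x) \<longlonglongrightarrow> 0"
  shows "(\<lambda>n. \<integral>\<^sup>+x. ennreal (\<bar>v n x\<bar> powr p * indicator \<Omega> x) \<partial>mu_w \<beta>) \<longlonglongrightarrow> 0"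
proof (rule nn_integral_tendsto_0_dominated[OF _ _ mu_dom_finite[of "K powr p"], where e = "\<lambda>_ _. 0"])
  show "(\<lambda>x. \<bar>v n x\<bar> powr p * indicator \<Omega> x) \<in> borel_measurable (mu_w \<beta>)" for n
    using borel_measurable_mu_if[OF meas[of n]] by measurable
  show "\<bar>v n x\<bar> powr p * indicator \<Omega> x \<le> K powr p * indicator \<Omega> x + 0" for n x
    using powr_mono2[OF less_imp_le[OF p_pos] abs_ge_zero bd[of n x]] by (auto split: split_indicator)
  show "AE x in mu_w \<beta>. (\<lambda>n. \<bar>v n x\<bar> powr p * indicator \<Omega> x) \<longlonglongrightarrow> 0"
    unfolding AE_mu_w_iff using lim
  proof eventually_elim
    case (elim x)
    have "(\<lambda>n. \<bar>v n x\<bar> powr p) \<longlonglongrightarrow> \<bar>0\<bar> powr p"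
      by (rule tendsto_powr'[OF tendsto_rabs[OF elim] tendsto_const]) (use p_pos in auto)
    from tendsto_mult[OF this tendsto_const[of "indicator \<Omega> x"]] show ?case by simp
  qed
qed auto

lemma Wpow_le_Lp_energy:
  assumes "w \<in> borel_measurable lebesgue"
  shows "Wpow w \<le> (\<integral>\<^sup>+x. ennreal (\<bar>w x\<bar> powr p * indicator \<Omega> x) \<partial>mu_w \<beta>) + (\<integral>\<^sup>+z. ennreal (epow w z) \<partial>\<nu>)"
  unfolding Wpow_def
  by (intro add_left_mono nn_integral_mono ennreal_leI) (simp split: split_indicator)

text \<open>The constraint set of the obstacle problem at level k. The bound makes the pairing with
  a merely integrable datum finite.\<close>

definition X :: "real \<Rightarrow> ('a \<Rightarrow> real) set" where
  "X k = {w \<in> En. \<forall>x. \<bar>w x\<bar> \<le> k}"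

lemma X_En: "w \<in> X k \<Longrightarrow> w \<in> En" and X_bound: "w \<in> X k \<Longrightarrow> \<bar>w x\<bar> \<le> k"
  by (auto simp: X_def)

lemma X_zero: "w \<in> X k \<Longrightarrow> x \<notin> \<Omega> \<Longrightarrow> w x = 0"
  by (intro W_zero En_W X_En)

lemma X_measurable: "w \<in> X k \<Longrightarrow> w \<in> borel_measurable lebesgue"
  by (intro En_measurable X_En)

lemma X_0: "0 \<le> k \<Longrightarrow> (\<lambda>_. 0) \<in> X k"
  by (simp add: X_def En_0)

lemma X_mono: "k \<le> l \<Longrightarrow> X k \<subseteq> X l"
  unfolding X_def by (auto intro: order_trans)

lemma X_convex:
  assumes "u \<in> X k" "v \<in> X k" "0 \<le> t" "t \<le> 1"
  shows "(\<lambda>x. (1 - t) * u x + t * v x) \<in> X k"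
proof -
  have "\<bar>(1 - t) * u x + t * v x\<bar> \<le> k" for x
  proof -
    have "\<bar>(1 - t) * u x + t * v x\<bar> \<le> (1 - t) * \<bar>u x\<bar> + t * \<bar>v x\<bar>"
      using assms(3,4) abs_triangle_ineq[of "(1 - t) * u x" "t * v x"] by (simp add: abs_mult)
    also have "\<dots> \<le> (1 - t) * k + t * k"
      using assms X_bound[of _ k x] by (intro add_mono mult_left_mono) auto
    finally show ?thesis by (simp add: algebra_simps)
  qed
  then show ?thesis using assms by (simp add: X_def En_linear_combination)
qed

lemma X_midpoint: "u \<in> X k \<Longrightarrow> v \<in> X k \<Longrightarrow> (\<lambda>x. (u x + v x) / 2) \<in> X k"
  using X_convex[of u k v "1/2"] by (simp add: add_divide_distrib)

lemma Q_midpoint: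
  assumes "u \<in> En" "v \<in> En"
  shows "Q (\<lambda>x. (u x + v x) / 2) \<le> (Q u + Q v) / 2"
proof -
  have mid: "(\<lambda>x. (u x + v x) / 2) \<in> En"
    using En_linear_combination[OF assms, of "1/2" "1/2"] by (simp add: add_divide_distrib)
  have "Q (\<lambda>x. (u x + v x) / 2) \<le> (\<integral>z. (epow u z + epow v z) / 2 \<partial>\<nu>)"
    unfolding Q_def
  proof (rule integral_mono)
    show "integrable \<nu> (\<lambda>z. (epow u z + epow v z) / 2)"
      using assms[THEN En_integrable] by simp
    show "epow (\<lambda>x. (u x + v x) / 2) z \<le> (epow u z + epow v z) / 2" for z
    proof -
      have "incr (\<lambda>x. (u x + v x) / 2) z = (incr u z + incr v z) / 2" by (simp add: field_simps)
      then show ?thesis using abs_powr_midpoint[OF p_gt_1, of "incr u z" "incr v z"] by (simp only:)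
    qed
  qed (rule En_integrable[OF mid])
  also have "\<dots> = (Q u + Q v) / 2" using assms[THEN En_integrable] by (simp add: Q_def)
  finally show ?thesis .
qed

lemma Q_uniformly_convex:
  assumes "0 < \<epsilon>"
  obtains C where "0 < C"
    "\<And>u v. u \<in> En \<Longrightarrow> v \<in> En \<Longrightarrow> Q (\<lambda>x. u x - v x) \<le> \<epsilon> * (Q u + Q v) + C * ((Q u + Q v) / 2 - Q (\<lambda>x. (u x + v x) / 2))"
proof -
  obtain C where C: "0 < C" "\<And>a b. \<bar>a - b\<bar> powr p \<le> \<epsilon> * (\<bar>a\<bar> powr p + \<bar>b\<bar> powr p) +
       C * ((\<bar>a\<bar> powr p + \<bar>b\<bar> powr p) / 2 - \<bar>(a + b) / 2\<bar> powr p)"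
    using abs_powr_uniformly_convex[OF p_gt_1 assms] by blast
  show ?thesis
  proof (rule that[OF C(1)])
    fix u v assume uv: "u \<in> En" "v \<in> En"
    note i = uv[THEN En_integrable]
    have "(\<lambda>x. (u x + v x) / 2) \<in> En"
      using En_linear_combination[OF uv, of "1/2" "1/2"] by (simp add: add_divide_distrib)
    from En_integrable[OF this]
    have mid: "integrable \<nu> (\<lambda>z. \<bar>(incr u z + incr v z) / 2\<bar> powr p)"
      by (simp add: diff_divide_distrib add_divide_distrib algebra_simps)
    have midQ: "Q (\<lambda>x. (u x + v x) / 2) = (\<integral>z. \<bar>(incr u z + incr v z) / 2\<bar> powr p \<partial>\<nu>)"
      unfolding Q_def by (simp add: diff_divide_distrib add_divide_distrib algebra_simps)
    have dif: "integrable \<nu> (\<lambda>z. \<bar>incr u z - incr v z\<bar> powr p)"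
      using En_integrable[OF En_diff[OF uv]] by (simp add: algebra_simps)
    have "Q (\<lambda>x. u x - v x) = (\<integral>z. \<bar>incr u z - incr v z\<bar> powr p \<partial>\<nu>)"
      unfolding Q_def by (simp add: algebra_simps)
    also have "\<dots> \<le> (\<integral>z. \<epsilon> * (epow u z + epow v z) +
       C * ((epow u z + epow v z) / 2 - \<bar>(incr u z + incr v z) / 2\<bar> powr p) \<partial>\<nu>)"
      using C(2) i mid dif by (intro integral_mono) simp_all
    also have "\<dots> = \<epsilon> * (Q u + Q v) + C * ((Q u + Q v) / 2 - Q (\<lambda>x. (u x + v x) / 2))"
      using i mid unfolding midQ by (simp add: Q_def)
    finally show "Q (\<lambda>x. u x - v x) \<le> \<epsilon> * (Q u + Q v) + C * ((Q u + Q v) / 2 - Q (\<lambda>x. (u x + v x) / 2))" .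
  qed
qed

text \<open>Almost minimal elements of a decreasing sequence of convex sets form a Cauchy sequence.\<close>
lemma nested_convex_limit:
  fixes C :: "nat \<Rightarrow> ('a \<Rightarrow> real) set"
  assumes sub: "\<And>m. C m \<subseteq> X k" and dec: "\<And>m. C (Suc m) \<subseteq> C m"
    and mid: "\<And>m u v. u \<in> C m \<Longrightarrow> v \<in> C m \<Longrightarrow> (\<lambda>x. (u x + v x) / 2) \<in> C m"
    and bound: "\<And>m. \<exists>w\<in>C m. Q w \<le> B"
  obtains ws w where "\<And>m. ws m \<in> C m" "w \<in> X k" "AE x in lebesgue. (\<lambda>m. ws m x) \<longlonglongrightarrow> w x"
proof -
  \<comment> \<open>The least energies increase with m and are bounded by B, so they converge. This
    is what makes the convexity defect of two late elements small.\<close>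
  define D where "D m = Inf (Q ` C m)" for m
  have ne: "C m \<noteq> {}" for m using bound by blast
  have bdd: "bdd_below (Q ` C m)" for m by (rule bdd_belowI2) (rule Q_nonneg)
  have D_le: "D m \<le> Q w" if "w \<in> C m" for m w
    unfolding D_def using that bdd by (intro cINF_lower)
  have decC: "C n \<subseteq> C m" if "m \<le> n" for m n
    using lift_Suc_antimono_le[of C m n] dec that by blast
  have incD: "D m \<le> D n" if "m \<le> n" for m n
    unfolding D_def using decC[OF that] ne bdd by (intro cINF_superset_mono) auto
  have DB: "D m \<le> B" for m using bound[of m] D_le[of _ m] by (meson order_trans)
  obtain d where d: "D \<longlonglongrightarrow> d" "\<And>m. D m \<le> d"
    using incseq_convergent[of D B] incD DB by (metis incseq_def)
  have dB: "d \<le> B" by (rule LIMSEQ_le_const2[OF d(1)]) (use DB in blast)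
  have "\<exists>w\<in>C m. Q w < D m + 1 / real (Suc m)" for m
  proof -
    have "Inf (Q ` C m) < D m + 1 / real (Suc m)" by (simp add: D_def)
    then show ?thesis using cInf_lessD[of "Q ` C m"] ne by blast
  qed
  then obtain w where w: "\<And>m. w m \<in> C m" "\<And>m. Q (w m) < D m + 1 / real (Suc m)" by metis
  have wX: "w m \<in> X k" for m using w(1) sub by blast
  note wE = X_En[OF wX]
  note [measurable] = X_measurable[OF wX]
  have cau: "\<exists>N. \<forall>m\<ge>N. \<forall>n\<ge>N. Q (\<lambda>x. w m x - w n x) \<le> \<epsilon>" if e: "0 < \<epsilon>" for \<epsilon>
  proof -
    have B: "0 \<le> B" using bound[of 0] Q_nonneg by (meson order_trans)
    \<comment> \<open>Late elements have energy at most B + 1, so with this choice the first term of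
      the uniform convexity estimate is at most \<epsilon> / 2.\<close>
    define \<epsilon>' where "\<epsilon>' = \<epsilon> / (4 * (B + 1))"
    have e': "0 < \<epsilon>'" using e B by (simp add: \<epsilon>'_def)
    obtain K where K: "0 < K" "\<And>u v. u \<in> En \<Longrightarrow> v \<in> En \<Longrightarrow>
        Q (\<lambda>x. u x - v x) \<le> \<epsilon>' * (Q u + Q v) + K * ((Q u + Q v) / 2 - Q (\<lambda>x. (u x + v x) / 2))"
      using Q_uniformly_convex[OF e'] by blast
    have "(\<lambda>N. K * (d + 1 / real (Suc N) - D N)) \<longlonglongrightarrow> K * (d + 0 - d)"
      by (intro tendsto_intros d LIMSEQ_Suc[OF lim_1_over_n])
    then have "(\<lambda>N. K * (d + 1 / real (Suc N) - D N)) \<longlonglongrightarrow> 0" by simp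
    then have "\<forall>\<^sub>F N in sequentially. K * (d + 1 / real (Suc N) - D N) < \<epsilon> / 2"
      by (rule order_tendstoD) (use e in simp)
    then obtain N where N0: "K * (d + 1 / real (Suc N) - D N) < \<epsilon> / 2" by (auto simp: eventually_sequentially)
    define \<eta> where "\<eta> = 1 / real (Suc N)"
    note N = N0[folded \<eta>_def]
    show ?thesis
    proof (intro exI[of _ N] allI impI)
      fix m n assume mn: "N \<le> m" "N \<le> n"
      have Qd: "Q (w l) \<le> d + \<eta>" if "N \<le> l" for l
      proof -
        have "1 / real (Suc l) \<le> \<eta>" using that unfolding \<eta>_def by (intro divide_left_mono) auto
        then show ?thesis using w(2)[of l] d(2)[of l] by linarith
      qed
      have one: "\<eta> \<le> 1" by (simp add: \<eta>_def)
      \<comment> \<open>The two elements lie in different sets of the sequence, but both in C N,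
        which is closed under midpoints. So the midpoint has energy at least D N, which is close to
        d.\<close>
      have "(\<lambda>x. (w m x + w n x) / 2) \<in> C N"
        using w(1)[of m] w(1)[of n] decC[OF mn(1)] decC[OF mn(2)] by (intro mid) auto
      then have "D N \<le> Q (\<lambda>x. (w m x + w n x) / 2)" by (rule D_le)
      then have "(Q (w m) + Q (w n)) / 2 - Q (\<lambda>x. (w m x + w n x) / 2) \<le> d + \<eta> - D N"
        using Qd[OF mn(1)] Qd[OF mn(2)] by (simp add: field_simps)
      then have "K * ((Q (w m) + Q (w n)) / 2 - Q (\<lambda>x. (w m x + w n x) / 2)) \<le> K * (d + \<eta> - D N)"
        by (rule mult_left_mono[OF _ less_imp_le[OF K(1)]])
      moreover have "\<epsilon>' * (Q (w m) + Q (w n)) \<le> \<epsilon>' * (2 * (B + 1))"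
      proof (rule mult_left_mono[OF _ less_imp_le[OF e']])
        show "Q (w m) + Q (w n) \<le> 2 * (B + 1)"
          using Qd[OF mn(1)] Qd[OF mn(2)] one dB by (smt (verit))
      qed
      moreover have "\<epsilon>' * (2 * (B + 1)) = \<epsilon> / 2" using B by (simp add: \<epsilon>'_def field_simps)
      ultimately show "Q (\<lambda>x. w m x - w n x) \<le> \<epsilon>"
        using K(2)[OF wE[of m] wE[of n]] N by linarith
    qed
  qed
  have nnQ: "(\<integral>\<^sup>+z. ennreal (\<bar>incr (w m) z - incr (w n) z\<bar> powr p) \<partial>\<nu>) = ennreal (Q (\<lambda>x. w m x - w n x))" for m n
  proof -
    have eq: "incr (\<lambda>x. w m x - w n x) z = incr (w m) z - incr (w n) z" for z by simp
    show ?thesis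
      unfolding Q_def eq
      by (rule nn_integral_eq_integral[OF En_integrable[OF En_diff[OF wE[of m] wE[of n]], unfolded eq]]) simp
  qed
  obtain r where r: "strict_mono r" "AE z in \<nu>. Cauchy (\<lambda>n. incr (w (r n)) z)"
  proof (rule Lp_Cauchy_AE_Cauchy_subseq[OF p_pos, of "\<lambda>n. incr (w n)" \<nu>])
    show "\<exists>N. \<forall>m\<ge>N. \<forall>n\<ge>N. (\<integral>\<^sup>+z. ennreal (\<bar>incr (w m) z - incr (w n) z\<bar> powr p) \<partial>\<nu>) \<le> ennreal \<epsilon>"
      if "0 < \<epsilon>" for \<epsilon>
      unfolding nnQ using cau[OF that] by (meson ennreal_leI)
  qed (use En_incr_measurable[OF wE] in auto)
  have AEc: "AE x in lebesgue. Cauchy (\<lambda>n. w (r n) x)"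
  proof (rule AE_lebesgue_if_dom)
    show "AE x in lebesgue. x \<in> \<Omega> \<longrightarrow> Cauchy (\<lambda>n. w (r n) x)"
      by (rule AE_dom_incr[where w = "\<lambda>n. w (r n)" and P = Cauchy, OF r(2)]) (rule X_zero[OF wX])
    show "Cauchy (\<lambda>n. w (r n) x)" if "x \<notin> \<Omega>" for x
      using X_zero[OF wX that] by (simp add: convergent_Cauchy convergent_const)
  qed
  \<comment> \<open>Where the limit exists the truncation has no effect; elsewhere it keeps the
    arbitrary value of \<open>lim\<close> within the pointwise bound of \<open>X k\<close>.\<close>
  define v where "v x = Tk k (lim (\<lambda>n. w (r n) x))" for x
  have k: "0 \<le> k" using X_bound[OF wX[of 0], of undefined] by linarith
  have vm [measurable]: "v \<in> borel_measurable lebesgue"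
    unfolding v_def by measurable
  have vz: "v x = 0" if "x \<notin> \<Omega>" for x
    using X_zero[OF wX that] k by (simp add: v_def lim_const Tk_0)
  have vb: "\<bar>v x\<bar> \<le> k" for x unfolding v_def by (rule abs_Tk_le[OF k])
  have AEl: "AE x in lebesgue. (\<lambda>n. w (r n) x) \<longlonglongrightarrow> v x"
    using AEc
  proof eventually_elim
    case (elim x)
    then have l: "(\<lambda>n. w (r n) x) \<longlonglongrightarrow> lim (\<lambda>n. w (r n) x)"
      by (simp add: Cauchy_convergent_iff convergent_LIMSEQ_iff)
    have "\<bar>lim (\<lambda>n. w (r n) x)\<bar> \<le> k"
      by (rule LIMSEQ_le_const2[OF tendsto_rabs[OF l]]) (use X_bound[OF wX] in blast)
    then show ?case using l by (simp add: v_def Tk_id)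
  qed
  \<comment> \<open>Fatou's lemma lets n tend to infinity in the Cauchy estimate while m stays
    fixed.\<close>
  have Qle: "(\<integral>\<^sup>+z. ennreal (\<bar>incr (w m) z - incr v z\<bar> powr p) \<partial>\<nu>) \<le> ennreal \<epsilon>"
    if "\<forall>n\<ge>N. Q (\<lambda>x. w m x - w n x) \<le> \<epsilon>" for m N \<epsilon>
  proof -
    have "(\<integral>\<^sup>+z. ennreal (\<bar>incr (w m) z - incr v z\<bar> powr p) \<partial>\<nu>) =
        (\<integral>\<^sup>+z. liminf (\<lambda>n. ennreal (\<bar>incr (w m) z - incr (w (r n)) z\<bar> powr p)) \<partial>\<nu>)"
    proof (rule nn_integral_cong_AE)
      show "AE z in \<nu>. ennreal (\<bar>incr (w m) z - incr v z\<bar> powr p) =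
          liminf (\<lambda>n. ennreal (\<bar>incr (w m) z - incr (w (r n)) z\<bar> powr p))"
        using AE_nu_w_fst_snd[OF AEl]
      proof eventually_elim
        case (elim z)
        then have "(\<lambda>n. incr (w m) z - incr (w (r n)) z) \<longlonglongrightarrow> incr (w m) z - incr v z"
          by (intro tendsto_diff tendsto_const) auto
        from isCont_tendsto_compose[OF isCont_abs_powr[OF p_gt_1] this]
        show ?case by (intro lim_imp_Liminf[symmetric] tendsto_ennrealI) auto
      qed
    qed
    also have "\<dots> \<le> liminf (\<lambda>n. \<integral>\<^sup>+z. ennreal (\<bar>incr (w m) z - incr (w (r n)) z\<bar> powr p) \<partial>\<nu>)"
      by (intro nn_integral_liminf) measurable
    also have "\<dots> \<le> liminf (\<lambda>n. ennreal \<epsilon>)"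
    proof (rule Liminf_mono)
      show "\<forall>\<^sub>F n in sequentially. (\<integral>\<^sup>+z. ennreal (\<bar>incr (w m) z - incr (w (r n)) z\<bar> powr p) \<partial>\<nu>) \<le> ennreal \<epsilon>"
        unfolding nnQ eventually_sequentially
      proof (intro exI[of _ N] allI impI ennreal_leI)
        fix n assume "N \<le> n"
        then have "N \<le> r n" using seq_suble[OF r(1), of n] by linarith
        then show "Q (\<lambda>x. w m x - w (r n) x) \<le> \<epsilon>" using that by blast
      qed
    qed
    also have "\<dots> = ennreal \<epsilon>" by (simp add: Liminf_const)
    finally show ?thesis .
  qed
  have lim0: "(\<lambda>n. \<integral>\<^sup>+z. ennreal (\<bar>incr (w (r n)) z - incr v z\<bar> powr p) \<partial>\<nu>) \<longlonglongrightarrow> 0"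
  proof (rule tendsto_zero_ennreal)
    fix \<epsilon> :: real assume e: "0 < \<epsilon>"
    then obtain N where N: "\<forall>m\<ge>N. \<forall>n\<ge>N. Q (\<lambda>x. w m x - w n x) \<le> \<epsilon> / 2" using cau[of "\<epsilon> / 2"] by auto
    show "\<forall>\<^sub>F n in sequentially. (\<integral>\<^sup>+z. ennreal (\<bar>incr (w (r n)) z - incr v z\<bar> powr p) \<partial>\<nu>) < ennreal \<epsilon>"
      unfolding eventually_sequentially
    proof (intro exI[of _ N] allI impI)
      fix n assume "N \<le> n"
      then have "N \<le> r n" using seq_suble[OF r(1), of n] by linarith
      then have "(\<integral>\<^sup>+z. ennreal (\<bar>incr (w (r n)) z - incr v z\<bar> powr p) \<partial>\<nu>) \<le> ennreal (\<epsilon> / 2)"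
        using N by (intro Qle[of N]) blast
      also have "\<dots> < ennreal \<epsilon>" using e by (simp add: ennreal_less_iff)
      finally show "(\<integral>\<^sup>+z. ennreal (\<bar>incr (w (r n)) z - incr v z\<bar> powr p) \<partial>\<nu>) < ennreal \<epsilon>" .
    qed
  qed
  have vW: "v \<in> W"
  proof (rule W_closed[of "\<lambda>n. w (r n)", OF En_W[OF wE] vm vz])
    have "(\<lambda>n. \<integral>\<^sup>+x. ennreal (\<bar>w (r n) x - v x\<bar> powr p * indicator \<Omega> x) \<partial>mu_w \<beta>) \<longlonglongrightarrow> 0"
    proof (rule Lp_tendsto_0_bounded)
      show "(\<lambda>x. w (r n) x - v x) \<in> borel_measurable lebesgue" for n
        using X_measurable[OF wX] vm by (rule borel_measurable_diff)
      show "\<bar>w (r n) x - v x\<bar> \<le> 2 * k" for n x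
        using X_bound[OF wX[of "r n"], of x] vb[of x] by linarith
      show "AE x in lebesgue. (\<lambda>n. w (r n) x - v x) \<longlonglongrightarrow> 0"
        using AEl by eventually_elim (rule LIM_zero)
    qed
    from tendsto_add[OF this lim0]
    have up: "(\<lambda>n. (\<integral>\<^sup>+x. ennreal (\<bar>w (r n) x - v x\<bar> powr p * indicator \<Omega> x) \<partial>mu_w \<beta>) +
        (\<integral>\<^sup>+z. ennreal (\<bar>incr (w (r n)) z - incr v z\<bar> powr p) \<partial>\<nu>)) \<longlonglongrightarrow> 0" by simp
    show "(\<lambda>n. Wpow (\<lambda>x. w (r n) x - v x)) \<longlonglongrightarrow> 0"
    proof (rule tendsto_sandwich[OF _ _ tendsto_const up]; (intro always_eventually allI)?)
      fix n
      have eq: "incr (\<lambda>x. w (r n) x - v x) z = incr (w (r n)) z - incr v z" for z by simp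
      show "Wpow (\<lambda>x. w (r n) x - v x) \<le> (\<integral>\<^sup>+x. ennreal (\<bar>w (r n) x - v x\<bar> powr p * indicator \<Omega> x) \<partial>mu_w \<beta>) +
        (\<integral>\<^sup>+z. ennreal (\<bar>incr (w (r n)) z - incr v z\<bar> powr p) \<partial>\<nu>)"
        using Wpow_le_Lp_energy[of "\<lambda>x. w (r n) x - v x"] X_measurable[OF wX] vm
        unfolding eq by (simp add: borel_measurable_diff)
    qed simp
  qed
  have "integrable \<nu> (\<lambda>z. epow v z)"
  proof -
    obtain N where N: "\<forall>n\<ge>N. Q (\<lambda>x. w N x - w n x) \<le> 1" using cau[of 1] by auto
    have i1: "integrable \<nu> (\<lambda>z. \<bar>incr (w N) z - incr v z\<bar> powr p)"
    proof (rule integrableI_nonneg)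
      show "(\<lambda>z. \<bar>incr (w N) z - incr v z\<bar> powr p) \<in> borel_measurable \<nu>"
        by measurable
      show "(\<integral>\<^sup>+z. ennreal (\<bar>incr (w N) z - incr v z\<bar> powr p) \<partial>\<nu>) < \<infinity>"
        using Qle[OF N] by (rule le_less_trans) simp
    qed simp
    have "integrable \<nu> (\<lambda>z. 2 powr p * (epow (w N) z + \<bar>incr (w N) z - incr v z\<bar> powr p))"
      by (intro integrable_mult_right Bochner_Integration.integrable_add i1 En_integrable wE)
    then show ?thesis
    proof (rule Bochner_Integration.integrable_bound[OF _ powr_incr_measurable[OF vm]], intro always_eventually allI)
      fix z
      have "epow v z = \<bar>incr (w N) z - (incr (w N) z - incr v z)\<bar> powr p" by simp
      also have "\<dots> \<le> 2 powr p * (epow (w N) z + \<bar>incr (w N) z - incr v z\<bar> powr p)"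
        by (rule abs_powr_diff_le[OF p_pos])
      finally show "norm (epow v z) \<le> norm (2 powr p * (epow (w N) z + \<bar>incr (w N) z - incr v z\<bar> powr p))"
        by simp
    qed
  qed
  then have "v \<in> X k" using vW vb by (simp add: X_def En_def)
  moreover have "w (r m) \<in> C m" for m
    using w(1)[of "r m"] decC[OF seq_suble[OF r(1), of m]] by blast
  ultimately show ?thesis using AEl by (intro that[of "\<lambda>m. w (r m)" v])
qed

end

section \<open>Obstacle problems and their limit\<close>

locale entropy_data = weighted_domain +
  fixes f :: "'a \<Rightarrow> real"
  assumes f_integrable: "integrable lebesgue f" and f_nonneg: "0 \<le> f x"
begin

lemma f_measurable [measurable]: "f \<in> borel_measurable lebesgue"
  using f_integrable by auto

definition normf :: real where "normf = (\<integral>x. f x \<partial>lebesgue)"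

lemma f_mult_integrable:
  assumes [measurable]: "w \<in> borel_measurable lebesgue" and "\<And>x. \<bar>w x\<bar> \<le> k"
  shows "integrable lebesgue (\<lambda>x. f x * w x)"
proof (rule Bochner_Integration.integrable_bound[of _ "\<lambda>x. k * f x"])
  show "AE x in lebesgue. norm (f x * w x) \<le> norm (k * f x)"
  proof (intro always_eventually allI)
    fix x
    have "norm (f x * w x) = \<bar>w x\<bar> * f x" using f_nonneg[of x] by (simp add: abs_mult)
    also have "\<dots> \<le> k * f x" by (rule mult_right_mono[OF assms(2) f_nonneg])
    also have "\<dots> \<le> norm (k * f x)" by simp
    finally show "norm (f x * w x) \<le> norm (k * f x)" .
  qed
qed (use f_integrable in auto)

lemma f_mult_integral_le:
  assumes "w \<in> borel_measurable lebesgue" "\<And>x. \<bar>w x\<bar> \<le> k"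
  shows "(\<integral>x. f x * w x \<partial>lebesgue) \<le> k * normf"
proof -
  have "(\<integral>x. f x * w x \<partial>lebesgue) \<le> (\<integral>x. k * f x \<partial>lebesgue)"
  proof (rule integral_mono[OF f_mult_integrable[OF assms]])
    show "f x * w x \<le> k * f x" for x
      using mult_right_mono[OF order_trans[OF abs_ge_self assms(2)[of x]] f_nonneg[of x]]
      by (simp add: mult.commute)
  qed (use f_integrable in auto)
  then show ?thesis by (simp add: normf_def)
qed

lemma f_mult_tendsto:
  assumes meas: "\<And>n. w n \<in> borel_measurable lebesgue" and v: "v \<in> borel_measurable lebesgue"
    and bd: "\<And>n x. \<bar>w n x\<bar> \<le> k" and lim: "AE x in lebesgue. (\<lambda>n. w n x) \<longlonglongrightarrow> v x"
  shows "(\<lambda>n. \<integral>x. f x * w n x \<partial>lebesgue) \<longlonglongrightarrow> (\<integral>x. f x * v x \<partial>lebesgue)"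
proof (rule integral_dominated_convergence[where w = "\<lambda>x. k * f x"])
  note meas[measurable] v[measurable]
  show "AE x in lebesgue. (\<lambda>n. f x * w n x) \<longlonglongrightarrow> f x * v x"
    using lim by eventually_elim (intro tendsto_mult tendsto_const)
  show "AE x in lebesgue. norm (f x * w n x) \<le> k * f x" for n
  proof (intro always_eventually allI)
    fix x
    have "norm (f x * w n x) = \<bar>w n x\<bar> * f x" using f_nonneg[of x] by (simp add: abs_mult)
    also have "\<dots> \<le> k * f x" by (rule mult_right_mono[OF bd f_nonneg])
    finally show "norm (f x * w n x) \<le> k * f x" .
  qed
  show "integrable lebesgue (\<lambda>x. k * f x)" using f_integrable by auto
  show "(\<lambda>x. f x * v x) \<in> borel_measurable lebesgue" by measurable
  show "(\<lambda>x. f x * w n x) \<in> borel_measurable lebesgue" for n by measurable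
qed

text \<open>The derivative of |a|^p is p times \<open>Lp_phi p a\<close>, so the factor 1/(2p)
  produces the form with prefactor 1/2.\<close>

definition J :: "('a \<Rightarrow> real) \<Rightarrow> real" where
  "J w = Q w / (2 * p) - (\<integral>x. f x * w x \<partial>lebesgue)"

lemma X_f_integrable: "w \<in> X k \<Longrightarrow> integrable lebesgue (\<lambda>x. f x * w x)"
  by (rule f_mult_integrable[OF X_measurable]) (auto intro: X_bound)

lemma J_midpoint:
  assumes "u \<in> X k" "v \<in> X k"
  shows "J (\<lambda>x. (u x + v x) / 2) \<le> (J u + J v) / 2"
proof -
  have "Q (\<lambda>x. (u x + v x) / 2) / (2 * p) \<le> ((Q u + Q v) / 2) / (2 * p)"
    using Q_midpoint[OF assms[THEN X_En]] p_pos by (intro divide_right_mono) auto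
  also have "\<dots> = (Q u / (2 * p) + Q v / (2 * p)) / 2" by (simp add: add_divide_distrib)
  finally have 1: "Q (\<lambda>x. (u x + v x) / 2) / (2 * p) \<le> (Q u / (2 * p) + Q v / (2 * p)) / 2" .
  have "(\<integral>x. f x * ((u x + v x) / 2) \<partial>lebesgue) = (\<integral>x. (f x * u x + f x * v x) / 2 \<partial>lebesgue)"
    by (simp add: distrib_left)
  also have "\<dots> = ((\<integral>x. f x * u x \<partial>lebesgue) + (\<integral>x. f x * v x \<partial>lebesgue)) / 2"
    using assms[THEN X_f_integrable] by simp
  finally show ?thesis using 1 unfolding J_def by (simp add: field_simps)
qed

text \<open>The sets of almost minimisers of J are decreasing and closed under midpoints. Their
  energy stays bounded because the linear term is at most \<open>k * normf\<close> on
  \<open>X k\<close>. A limit of elements of these sets is minimal by Fatou's lemma for the energy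
  and dominated convergence for the linear term.\<close>

lemma minimizer_exists:
  assumes k: "0 \<le> k"
  shows "\<exists>w\<in>X k. \<forall>v\<in>X k. J w \<le> J v"
proof -
  have low: "- (k * normf) \<le> J w" if "w \<in> X k" for w
  proof -
    have "0 \<le> Q w / (2 * p)" using Q_nonneg p_pos by simp
    then show ?thesis using f_mult_integral_le[OF X_measurable[OF that] X_bound[OF that]] by (simp add: J_def)
  qed
  define j where "j = Inf (J ` X k)"
  have bdd: "bdd_below (J ` X k)" by (rule bdd_belowI2[of _ "- (k * normf)"]) (rule low)
  have ne: "J ` X k \<noteq> {}" using X_0[OF k] by blast
  have j_le: "j \<le> J w" if "w \<in> X k" for w
    unfolding j_def using that bdd by (intro cINF_lower)
  define C where "C m = {w \<in> X k. J w \<le> j + 1 / real (Suc m)}" for m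
  obtain ws w where w: "\<And>m. ws m \<in> C m" "w \<in> X k" "AE x in lebesgue. (\<lambda>m. ws m x) \<longlonglongrightarrow> w x"
  proof (rule nested_convex_limit[of C k "2 * p * (j + 1 + k * normf)"])
    show "C m \<subseteq> X k" for m by (auto simp: C_def)
    show "C (Suc m) \<subseteq> C m" for m
    proof -
      have "1 / real (Suc (Suc m)) \<le> 1 / real (Suc m)" by (intro divide_left_mono) auto
      then show ?thesis unfolding C_def by (auto intro: order_trans)
    qed
    show "(\<lambda>x. (u x + v x) / 2) \<in> C m" if "u \<in> C m" "v \<in> C m" for m u v
    proof -
      have "J (\<lambda>x. (u x + v x) / 2) \<le> (J u + J v) / 2" using that by (intro J_midpoint) (auto simp: C_def)
      moreover have "J u \<le> j + 1 / real (Suc m)" "J v \<le> j + 1 / real (Suc m)" using that by (auto simp: C_def)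
      moreover have "a \<le> c" if "a \<le> (b + b') / 2" "b \<le> c" "b' \<le> c" for a b b' c :: real
        using that by (simp add: field_simps)
      ultimately have "J (\<lambda>x. (u x + v x) / 2) \<le> j + 1 / real (Suc m)" by blast
      then show ?thesis using that X_midpoint by (simp add: C_def)
    qed
    show "\<exists>w\<in>C m. Q w \<le> 2 * p * (j + 1 + k * normf)" for m
    proof -
      have "Inf (J ` X k) < j + 1 / real (Suc m)" by (simp add: j_def)
      then obtain w where w: "w \<in> X k" "J w < j + 1 / real (Suc m)" using cInf_lessD[OF ne] by blast
      have "1 / real (Suc m) \<le> 1" by simp
      then have "J w \<le> j + 1" using w(2) by linarith
      then have "Q w / (2 * p) \<le> j + 1 + k * normf"
        using f_mult_integral_le[OF X_measurable[OF w(1)] X_bound[OF w(1)]] unfolding J_def by linarith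
      then have "Q w \<le> 2 * p * (j + 1 + k * normf)" using p_pos by (simp add: field_simps)
      then show ?thesis using w by (intro bexI[of _ w]) (auto simp: C_def)
    qed
  qed auto
  have wsX: "ws m \<in> X k" for m using w(1)[of m] by (simp add: C_def)
  note [measurable] = X_measurable[OF wsX] X_measurable[OF w(2)]
  have fl: "(\<lambda>m. \<integral>x. f x * ws m x \<partial>lebesgue) \<longlonglongrightarrow> (\<integral>x. f x * w x \<partial>lebesgue)"
    by (rule f_mult_tendsto[OF X_measurable[OF wsX] X_measurable[OF w(2)] X_bound[OF wsX] w(3)])
  have "(\<integral>z. epow w z \<partial>\<nu>) \<le> 2 * p * (j + 0 + (\<integral>x. f x * w x \<partial>lebesgue))"
  proof (rule integral_fatou_le(2)[where F = "\<lambda>m z. epow (ws m) z" and G = "\<lambda>_. 0" and H = "\<lambda>_ _. 0"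
        and c = "\<lambda>m. 2 * p * (j + 1 / real (Suc m) + (\<integral>x. f x * ws m x \<partial>lebesgue))"])
    show "AE z in \<nu>. (\<lambda>m. epow (ws m) z) \<longlonglongrightarrow> epow w z"
      using AE_nu_w_fst_snd[OF w(3)]
    proof eventually_elim
      case (elim z)
      then have "(\<lambda>m. incr (ws m) z) \<longlonglongrightarrow> incr w z" by (intro tendsto_diff) auto
      then show ?case by (rule isCont_tendsto_compose[OF isCont_abs_powr[OF p_gt_1]])
    qed
    show "(\<integral>z. epow (ws m) z \<partial>\<nu>) \<le> 2 * p * (j + 1 / real (Suc m) + (\<integral>x. f x * ws m x \<partial>lebesgue))" for m
    proof -
      have "Q (ws m) / (2 * p) - (\<integral>x. f x * ws m x \<partial>lebesgue) \<le> j + 1 / real (Suc m)"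
        using w(1)[of m] by (simp add: C_def J_def)
      then have "Q (ws m) / (2 * p) \<le> j + 1 / real (Suc m) + (\<integral>x. f x * ws m x \<partial>lebesgue)" by (smt (verit))
      then have "Q (ws m) \<le> (j + 1 / real (Suc m) + (\<integral>x. f x * ws m x \<partial>lebesgue)) * (2 * p)"
        using p_pos by (subst (asm) pos_divide_le_eq) auto
      then show ?thesis by (simp only: Q_def mult.commute)
    qed
    show "(\<lambda>m. 2 * p * (j + 1 / real (Suc m) + (\<integral>x. f x * ws m x \<partial>lebesgue))) \<longlonglongrightarrow>
        2 * p * (j + 0 + (\<integral>x. f x * w x \<partial>lebesgue))"
      by (intro tendsto_intros fl LIMSEQ_Suc[OF lim_1_over_n])
    show "integrable \<nu> (\<lambda>z. epow (ws m) z)" for m by (rule En_integrable[OF X_En[OF wsX]])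
    show "(\<lambda>z. epow w z) \<in> borel_measurable \<nu>" by measurable
  qed auto
  then have "Q w / (2 * p) \<le> j + (\<integral>x. f x * w x \<partial>lebesgue)"
    using p_pos by (subst pos_divide_le_eq) (auto simp: Q_def mult.commute)
  then have "J w \<le> j" by (simp add: J_def)
  then show ?thesis using w(2) j_le by (meson order_trans)
qed

text \<open>Minimality is used along the segment from w to v. The tangent inequality is taken at the
  displaced point y, where it bounds Q y - Q w from above; dividing by t n and letting t n tend to 0
  moves the form back to w.\<close>

lemma variational_inequality:
  assumes w: "w \<in> X k" and min: "\<And>v. v \<in> X k \<Longrightarrow> J w \<le> J v" and v: "v \<in> X k"
  shows "(\<integral>x. f x * (v x - w x) \<partial>lebesgue) \<le> (1/2) * (\<integral>z. Lp_phi p (incr w z) * (incr v z - incr w z) \<partial>\<nu>)"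
proof -
  note [measurable] = X_measurable[OF w] X_measurable[OF v]
  define t where "t n = 1 / real (Suc n)" for n
  have t: "0 < t n" "t n \<le> 1" for n by (auto simp: t_def)
  have t0: "t \<longlonglongrightarrow> 0" unfolding t_def[abs_def] by (rule LIMSEQ_Suc[OF lim_1_over_n])
  have ib: "integrable \<nu> (\<lambda>z. \<bar>incr v z - incr w z\<bar> powr p)"
    using En_integrable[OF En_diff[OF X_En[OF v] X_En[OF w]]] by (simp add: algebra_simps)
  have step: "(\<integral>x. f x * (v x - w x) \<partial>lebesgue) \<le>
      (1/2) * (\<integral>z. Lp_phi p (incr w z + t n * (incr v z - incr w z)) * (incr v z - incr w z) \<partial>\<nu>)" for n
  proof -
    define y where "y x = (1 - t n) * w x + t n * v x" for x
    have yX: "y \<in> X k" unfolding y_def[abs_def] using t by (intro X_convex w v) (auto simp: less_imp_le)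
    have iy: "incr y z = incr w z + t n * (incr v z - incr w z)" for z
      by (simp add: y_def algebra_simps)
    have [measurable]: "y \<in> borel_measurable lebesgue" by (rule X_measurable[OF yX])
    have int1: "integrable \<nu> (\<lambda>z. Lp_phi p (incr y z) * (incr v z - incr w z))"
      by (rule integrable_Lp_phi_mult[OF _ _ En_integrable[OF X_En[OF yX]] ib]) measurable
    have "Q y - Q w = (\<integral>z. epow y z - epow w z \<partial>\<nu>)"
      unfolding Q_def by (rule Bochner_Integration.integral_diff[symmetric]) 
        (rule En_integrable[OF X_En[OF yX]], rule En_integrable[OF X_En[OF w]])
    also have "\<dots> \<le> (\<integral>z. p * t n * (Lp_phi p (incr y z) * (incr v z - incr w z)) \<partial>\<nu>)"
    proof (rule integral_mono)
      show "integrable \<nu> (\<lambda>z. epow y z - epow w z)"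
        by (rule Bochner_Integration.integrable_diff[OF En_integrable[OF X_En[OF yX]] En_integrable[OF X_En[OF w]]])
      show "epow y z - epow w z \<le> p * t n * (Lp_phi p (incr y z) * (incr v z - incr w z))" for z
      proof -
        have "epow y z + p * Lp_phi p (incr y z) * (incr w z - incr y z) \<le> epow w z"
          by (rule abs_powr_tangent[OF p_gt_1])
        moreover have "incr w z - incr y z = - (t n * (incr v z - incr w z))" unfolding iy by simp
        ultimately have "epow y z + p * Lp_phi p (incr y z) * (- (t n * (incr v z - incr w z))) \<le> epow w z"
          by (simp only:)
        moreover have "p * Lp_phi p (incr y z) * (- (t n * (incr v z - incr w z))) =
            - (p * t n * (Lp_phi p (incr y z) * (incr v z - incr w z)))" by (simp add: mult_ac)
        ultimately show ?thesis by (smt (verit))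
      qed
    qed (intro integrable_mult_right int1)
    also have "\<dots> = p * t n * (\<integral>z. Lp_phi p (incr y z) * (incr v z - incr w z) \<partial>\<nu>)" by simp
    finally have Qd: "Q y - Q w \<le> p * t n * (\<integral>z. Lp_phi p (incr y z) * (incr v z - incr w z) \<partial>\<nu>)" .
    have fd: "(\<integral>x. f x * y x \<partial>lebesgue) - (\<integral>x. f x * w x \<partial>lebesgue) = t n * (\<integral>x. f x * (v x - w x) \<partial>lebesgue)"
    proof -
      have "(\<integral>x. f x * y x \<partial>lebesgue) - (\<integral>x. f x * w x \<partial>lebesgue) = (\<integral>x. f x * y x - f x * w x \<partial>lebesgue)"
        by (rule Bochner_Integration.integral_diff[symmetric]) (intro X_f_integrable[OF yX] X_f_integrable[OF w])+
      also have "(\<lambda>x. f x * y x - f x * w x) = (\<lambda>x. t n * (f x * (v x - w x)))"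
        by (rule ext) (simp add: y_def algebra_simps)
      finally show ?thesis by simp
    qed
    have "J w \<le> J y" by (rule min[OF yX])
    then have "t n * (\<integral>x. f x * (v x - w x) \<partial>lebesgue) \<le> (Q y - Q w) / (2 * p)"
      unfolding J_def fd[symmetric] diff_divide_distrib by (smt (verit))
    also have "\<dots> \<le> (p * t n * (\<integral>z. Lp_phi p (incr y z) * (incr v z - incr w z) \<partial>\<nu>)) / (2 * p)"
      using Qd p_pos by (intro divide_right_mono) auto
    also have "\<dots> = t n * ((1/2) * (\<integral>z. Lp_phi p (incr y z) * (incr v z - incr w z) \<partial>\<nu>))"
      using p_pos by simp
    finally have "(\<integral>x. f x * (v x - w x) \<partial>lebesgue) \<le> (1/2) * (\<integral>z. Lp_phi p (incr y z) * (incr v z - incr w z) \<partial>\<nu>)"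
      using t(1)[of n] by (simp only: mult_le_cancel_left_pos)
    then show ?thesis unfolding iy .
  qed
  have "(\<lambda>n. \<integral>z. Lp_phi p (incr w z + t n * (incr v z - incr w z)) * (incr v z - incr w z) \<partial>\<nu>) \<longlonglongrightarrow>
      (\<integral>z. Lp_phi p (incr w z) * (incr v z - incr w z) \<partial>\<nu>)"
  proof (rule integral_dominated_convergence[where w = "\<lambda>z. 2 powr p * (epow w z + \<bar>incr v z - incr w z\<bar> powr p) + \<bar>incr v z - incr w z\<bar> powr p"])
    show "integrable \<nu> (\<lambda>z. 2 powr p * (epow w z + \<bar>incr v z - incr w z\<bar> powr p) + \<bar>incr v z - incr w z\<bar> powr p)"
      by (intro Bochner_Integration.integrable_add integrable_mult_right ib En_integrable X_En[OF w])
    show "AE z in \<nu>. (\<lambda>n. Lp_phi p (incr w z + t n * (incr v z - incr w z)) * (incr v z - incr w z)) \<longlonglongrightarrow>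
        Lp_phi p (incr w z) * (incr v z - incr w z)"
    proof (intro always_eventually allI tendsto_mult tendsto_const)
      fix z
      have "(\<lambda>n. incr w z + t n * (incr v z - incr w z)) \<longlonglongrightarrow> incr w z + 0 * (incr v z - incr w z)"
        by (intro tendsto_add tendsto_mult tendsto_const t0)
      then have "(\<lambda>n. incr w z + t n * (incr v z - incr w z)) \<longlonglongrightarrow> incr w z" by simp
      then show "(\<lambda>n. Lp_phi p (incr w z + t n * (incr v z - incr w z))) \<longlonglongrightarrow> Lp_phi p (incr w z)"
        by (rule isCont_tendsto_compose[OF isCont_Lp_phi[OF p_gt_1]])
    qed
    show "AE z in \<nu>. norm (Lp_phi p (incr w z + t n * (incr v z - incr w z)) * (incr v z - incr w z)) \<le>
        2 powr p * (epow w z + \<bar>incr v z - incr w z\<bar> powr p) + \<bar>incr v z - incr w z\<bar> powr p" for n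
    proof (intro always_eventually allI)
      fix z
      define a where "a = incr w z"
      define b where "b = incr v z - incr w z"
      have "norm (Lp_phi p (a + t n * b) * b) = \<bar>a + t n * b\<bar> powr (p - 1) * \<bar>b\<bar>"
        by (simp only: real_norm_def abs_mult abs_Lp_phi)
      also have "\<dots> \<le> \<bar>a + t n * b\<bar> powr p + \<bar>b\<bar> powr p" by (rule powr_minus_one_mult_le[OF p_gt_1]) auto
      also have "\<bar>a + t n * b\<bar> powr p \<le> 2 powr p * (\<bar>a\<bar> powr p + \<bar>t n * b\<bar> powr p)" by (rule abs_powr_add_le[OF p_pos])
      also have "\<bar>t n * b\<bar> powr p \<le> \<bar>b\<bar> powr p"
        using t[of n] p_pos by (intro powr_mono2) (auto simp: abs_mult mult_left_le_one_le)
      finally show "norm (Lp_phi p (incr w z + t n * (incr v z - incr w z)) * (incr v z - incr w z)) \<le>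
        2 powr p * (epow w z + \<bar>incr v z - incr w z\<bar> powr p) + \<bar>incr v z - incr w z\<bar> powr p"
        unfolding a_def b_def by simp
    qed
  qed measurable
  from tendsto_mult[OF tendsto_const[of "1/2"] this]
  show ?thesis by (rule LIMSEQ_le_const) (use step in blast)
qed

text \<open>The integrand is nonnegative, so it vanishes almost everywhere. On pairs of an interior
  and an exterior point it is (Lp_phi(u) - Lp_phi(v)) times the positive part of u - v, and this
  vanishes only if u \<le> v.\<close>

lemma comparison:
  assumes u: "u \<in> En" and v: "v \<in> En"
    and le: "(\<integral>z. (Lp_phi p (incr u z) - Lp_phi p (incr v z)) * incr (\<lambda>x. max 0 (u x - v x)) z \<partial>\<nu>) \<le> 0"
  shows "AE x in lebesgue. u x \<le> v x"
proof -
  let ?d = "\<lambda>x. max 0 (u x - v x)"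
  let ?F = "\<lambda>z. (Lp_phi p (incr u z) - Lp_phi p (incr v z)) * incr ?d z"
  have dE: "?d \<in> En" using En_lattice(1)[OF En_0 En_diff[OF u v]] .
  have "integrable \<nu> (\<lambda>z. flux u ?d z - flux v ?d z)"
    by (intro Bochner_Integration.integrable_diff En_integrable_Lp_phi u v dE)
  then have int: "integrable \<nu> ?F" by (simp only: left_diff_distrib)
  have nn: "0 \<le> ?F z" for z by (rule Lp_phi_monotone_pos_part[OF p_gt_1])
  have "0 \<le> (\<integral>z. ?F z \<partial>\<nu>)" by (intro integral_nonneg_AE always_eventually allI nn)
  with le have "(\<integral>z. ?F z \<partial>\<nu>) = 0" by (rule antisym)
  then have "AE z in \<nu>. ?F z = 0" using integral_nonneg_eq_0_iff_AE[OF int always_eventually[OF allI[OF nn]]] by blast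
  then have "AE x in lebesgue. x \<in> \<Omega> \<longrightarrow> u x \<le> v x"
  proof (intro AE_dom_if_AE_exterior, eventually_elim)
    case (elim z)
    show ?case
    proof
      assume z: "fst z \<in> \<Omega> \<and> snd z \<notin> \<Omega>"
      show "u (fst z) \<le> v (fst z)"
      proof (rule ccontr)
        assume neg: "\<not> u (fst z) \<le> v (fst z)"
        then have "0 < (Lp_phi p (u (fst z)) - Lp_phi p (v (fst z))) * (u (fst z) - v (fst z))"
          using Lp_phi_strict_mono[OF p_gt_1, of "v (fst z)" "u (fst z)"] by (intro mult_pos_pos) auto
        then show False
          using elim z neg W_zero[OF En_W[OF u]] W_zero[OF En_W[OF v]] by (simp add: max_def)
      qed
    qed
  qed
  then show ?thesis
    by (rule AE_lebesgue_if_dom) (simp add: W_zero[OF En_W[OF u]] W_zero[OF En_W[OF v]])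
qed

lemma J_cong_AE:
  assumes u: "u \<in> borel_measurable lebesgue" and v: "v \<in> borel_measurable lebesgue" and eq: "AE x in lebesgue. u x = v x"
  shows "J u = J v"
proof -
  note [measurable] = u v
  have "Q u = Q v"
    unfolding Q_def
  proof (rule integral_cong_AE)
    show "AE z in \<nu>. epow u z = epow v z"
      using AE_nu_w_fst_snd[OF eq] by eventually_elim simp
  qed measurable
  moreover have "(\<integral>x. f x * u x \<partial>lebesgue) = (\<integral>x. f x * v x \<partial>lebesgue)"
    using eq by (intro integral_cong_AE) (auto elim!: AE_mp)
  ultimately show ?thesis by (simp add: J_def)
qed

text \<open>Testing a minimiser with its positive part shows, because f \<ge> 0, that it is
  nonnegative almost everywhere. Its positive part is then a minimiser too, and nonnegative at every
  point.\<close>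

lemma nonneg_minimizer_exists:
  assumes k: "0 \<le> k"
  shows "\<exists>w\<in>X k. (\<forall>x. 0 \<le> w x) \<and> (\<forall>v\<in>X k. J w \<le> J v)"
proof -
  obtain w where w: "w \<in> X k" "\<And>v. v \<in> X k \<Longrightarrow> J w \<le> J v" using minimizer_exists[OF k] by blast
  define v where "v x = max 0 (w x)" for x
  have vX: "v \<in> X k"
    using En_lattice(1)[OF En_0 X_En[OF w(1)]] X_bound[OF w(1)] k by (auto simp: X_def v_def[abs_def] abs_le_iff max_def)
  let ?d = "\<lambda>x. max 0 (0 - w x)"
  have dE: "?d \<in> En" using En_lattice(1)[OF En_0 En_diff[OF En_0 X_En[OF w(1)]]] .
  have vw: "v x - w x = ?d x" for x by (simp add: v_def max_def)
  have ivw: "incr v z - incr w z = incr ?d z" for z using vw[of "fst z"] vw[of "snd z"] by simp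
  have "0 \<le> (\<integral>x. f x * ?d x \<partial>lebesgue)" by (intro integral_nonneg_AE) (simp add: f_nonneg)
  also have "\<dots> \<le> (1/2) * (\<integral>z. flux w ?d z \<partial>\<nu>)"
    using variational_inequality[OF w vX] unfolding vw ivw .
  finally have "(\<integral>z. (Lp_phi p (incr (\<lambda>_. 0) z) - Lp_phi p (incr w z)) * incr ?d z \<partial>\<nu>) \<le> 0"
    by simp
  then have AE: "AE x in lebesgue. 0 \<le> w x" by (rule comparison[OF En_0 X_En[OF w(1)]])
  have "J v = J w"
    by (rule J_cong_AE[OF X_measurable[OF vX] X_measurable[OF w(1)]])
      (use AE in \<open>eventually_elim, simp add: v_def\<close>)
  then show ?thesis using vX w(2) by (intro bexI[of _ v]) (auto simp: v_def)
qed

definition sol :: "nat \<Rightarrow> 'a \<Rightarrow> real" where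
  "sol n = (SOME w. w \<in> X (real n) \<and> (\<forall>x. 0 \<le> w x) \<and> (\<forall>v\<in>X (real n). J w \<le> J v))"

lemma sol_spec: "sol n \<in> X (real n) \<and> (\<forall>x. 0 \<le> sol n x) \<and> (\<forall>v\<in>X (real n). J (sol n) \<le> J v)"
proof -
  have "\<exists>w. w \<in> X (real n) \<and> (\<forall>x. 0 \<le> w x) \<and> (\<forall>v\<in>X (real n). J w \<le> J v)"
    using nonneg_minimizer_exists[of "real n"] by auto
  then show ?thesis unfolding sol_def by (rule someI_ex)
qed

lemma sol_X: "sol n \<in> X (real n)" and sol_nonneg: "0 \<le> sol n x"
  using sol_spec by auto

lemma sol_measurable [measurable]: "sol n \<in> borel_measurable lebesgue"
  by (rule X_measurable[OF sol_X])

lemma sol_zero: "x \<notin> \<Omega> \<Longrightarrow> sol n x = 0"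
  by (rule X_zero[OF sol_X])

lemma sol_En: "sol n \<in> En" by (rule X_En[OF sol_X])

lemma sol_VI:
  assumes "v \<in> X (real n)"
  shows "(\<integral>x. f x * (v x - sol n x) \<partial>lebesgue) \<le> (1/2) * (\<integral>z. Lp_phi p (incr (sol n) z) * (incr v z - incr (sol n) z) \<partial>\<nu>)"
  using sol_spec[of n] by (intro variational_inequality[OF sol_X _ assms]) auto

lemma sol_truncated_test:
  assumes psi: "\<psi> \<in> X (real n)" and k: "0 < k"
  shows "(1/2) * (\<integral>z. flux (sol n) (\<lambda>x. Tk k (sol n x - \<psi> x)) z \<partial>\<nu>)
    \<le> (\<integral>x. f x * Tk k (sol n x - \<psi> x) \<partial>lebesgue)"
proof -
  let ?T = "\<lambda>x. Tk k (sol n x - \<psi> x)"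
  define v where "v x = sol n x - ?T x" for x
  have TE: "?T \<in> En" using k by (intro En_Tk En_diff sol_En X_En[OF psi]) auto
  have "\<bar>v x\<bar> \<le> real n" for x
  proof -
    \<comment> \<open>Moving from \<open>sol n x\<close> towards \<open>\<psi> x\<close> by at most
      k never overshoots, so the bound n is kept and v is admissible.\<close>
    have "min (sol n x) (\<psi> x) \<le> v x \<and> v x \<le> max (sol n x) (\<psi> x)"
      using k by (auto simp: v_def Tk_def)
    then show ?thesis using X_bound[OF sol_X, of n x] X_bound[OF psi, of x] by (auto simp: abs_le_iff)
  qed
  then have vX: "v \<in> X (real n)" using En_diff[OF sol_En TE] by (simp add: X_def v_def[abs_def])
  have 1: "v x - sol n x = - ?T x" for x by (simp add: v_def)
  have 2: "incr v z - incr (sol n) z = - incr ?T z" for z by (simp add: v_def)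
  show ?thesis using sol_VI[OF vX] unfolding 1 2 mult_minus_right Bochner_Integration.integral_minus neg_le_iff_le .
qed

text \<open>The minimum of the two solutions competes at level n, by their nonnegativity, and the
  maximum at level m. Both variational inequalities contain the same integral of f, which cancels
  and leaves the hypothesis of \<open>comparison\<close>.\<close>

lemma sol_mono:
  assumes "n \<le> m" shows "AE x in lebesgue. sol n x \<le> sol m x"
proof (rule comparison[OF sol_En sol_En])
  let ?d = "\<lambda>x. max 0 (sol n x - sol m x)"
  have dE: "?d \<in> En" using En_lattice(1)[OF En_0 En_diff[OF sol_En sol_En]] .
  have bn: "sol n x \<le> real n" "sol m x \<le> real m" for x
    using X_bound[OF sol_X, of n x] X_bound[OF sol_X, of m x] by auto
  have minX: "(\<lambda>x. min (sol n x) (sol m x)) \<in> X (real n)"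
  proof -
    have "\<bar>min (sol n x) (sol m x)\<bar> \<le> real n" for x
      using bn(1)[of x] sol_nonneg[of n x] sol_nonneg[of m x] by (auto simp: min_def)
    then show ?thesis using En_lattice(2)[OF sol_En sol_En, of n m] by (simp add: X_def)
  qed
  have maxX: "(\<lambda>x. max (sol n x) (sol m x)) \<in> X (real m)"
  proof -
    have "\<bar>max (sol n x) (sol m x)\<bar> \<le> real m" for x
      using bn[of x] sol_nonneg[of n x] sol_nonneg[of m x] assms by (auto simp: max_def)
    then show ?thesis using En_lattice(1)[OF sol_En sol_En, of n m] by (simp add: X_def)
  qed
  have e1: "min (sol n x) (sol m x) - sol n x = - ?d x" for x by (auto simp: min_def max_def)
  have e2: "max (sol n x) (sol m x) - sol m x = ?d x" for x by (auto simp: max_def)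
  have i1: "incr (\<lambda>x. min (sol n x) (sol m x)) z - incr (sol n) z = - incr ?d z" for z
    using e1[of "fst z"] e1[of "snd z"] by (smt (verit))
  have i2: "incr (\<lambda>x. max (sol n x) (sol m x)) z - incr (sol m) z = incr ?d z" for z
    using e2[of "fst z"] e2[of "snd z"] by (smt (verit))
  have "(1/2) * (\<integral>z. flux (sol n) ?d z \<partial>\<nu>) \<le> (\<integral>x. f x * ?d x \<partial>lebesgue)"
    using sol_VI[OF minX] unfolding e1 i1 mult_minus_right Bochner_Integration.integral_minus neg_le_iff_le .
  also have "\<dots> \<le> (1/2) * (\<integral>z. flux (sol m) ?d z \<partial>\<nu>)"
    using sol_VI[OF maxX] unfolding e2 i2 .
  finally show "(\<integral>z. (Lp_phi p (incr (sol n) z) - Lp_phi p (incr (sol m) z)) * incr ?d z \<partial>\<nu>) \<le> 0"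
    unfolding left_diff_distrib
    by (subst Bochner_Integration.integral_diff) (auto intro!: En_integrable_Lp_phi sol_En dE)
qed

end

section \<open>Interaction with the exterior\<close>

context weighted_domain
begin

definition ext :: "('a \<times> 'a) set" where "ext = (\<Omega> \<times> (- \<Omega>)) \<union> ((- \<Omega>) \<times> \<Omega>)"

lemma compl_dom_lebesgue [measurable]: "- \<Omega> \<in> sets lebesgue"
  by (simp add: Compl_in_sets_lebesgue)

lemma ext_sets [measurable]: "ext \<in> sets \<nu>"
  unfolding ext_def sets_nu_w by (intro sets.Un pair_measureI dom_lebesgue compl_dom_lebesgue)

lemma nu_kernel_swap: "nu_kernel s p \<beta> (x, y) = nu_kernel s p \<beta> (y, x)"
  by (simp add: nu_kernel_def norm_minus_commute mult_ac)

lemma Cc_inf_bounded: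
  assumes "\<phi> \<in> Cc_inf \<Omega>" obtains B where "0 \<le> B" "\<And>x. \<bar>\<phi> x\<bar> \<le> B"
proof -
  have "compact (closure {x. \<phi> x \<noteq> 0})" using assms by (simp add: Cc_inf_def)
  then have "bounded (\<phi> ` closure {x. \<phi> x \<noteq> 0})"
    by (intro compact_imp_bounded compact_continuous_image continuous_on_subset[OF Cc_inf_continuous[OF assms]]) auto
  then obtain B where B: "0 < B" "\<And>x. x \<in> closure {x. \<phi> x \<noteq> 0} \<Longrightarrow> \<bar>\<phi> x\<bar> \<le> B"
    unfolding bounded_pos by auto
  have "\<bar>\<phi> x\<bar> \<le> B" for x
    using B(1) B(2)[OF subsetD[OF closure_subset[of "{x. \<phi> x \<noteq> 0}"]], of x] by (cases "\<phi> x = 0") auto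
  then show ?thesis using B(1) by (intro that[of B]) auto
qed

text \<open>The support stays at a distance d from the exterior, so the kernel has an integrable
  tail, uniformly in the interior point. The weight of the exterior point is bounded because a ball
  about the origin lies in \<Omega>, and |x| powr (- \<beta>) is integrable over \<Omega>. Pairs
  inside \<Omega> are covered by \<open>fin\<close>.\<close>

lemma Cc_inf_En:
  assumes phi: "\<phi> \<in> Cc_inf \<Omega>" and fin: "Wpow \<phi> < \<infinity>"
  shows "\<phi> \<in> En"
proof -
  define b where "b = real DIM('a) + p * s"
  note [measurable] = Cc_inf_measurable[OF phi]
  obtain B where B: "0 \<le> B" "\<And>x. \<bar>\<phi> x\<bar> \<le> B" using Cc_inf_bounded[OF phi] by blast
  let ?S = "closure {x. \<phi> x \<noteq> 0}"
  have S: "compact ?S" "?S \<subseteq> \<Omega>" using phi by (auto simp: Cc_inf_def)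
  have "closed (- \<Omega>)" "?S \<inter> - \<Omega> = {}" using open_dom S(2) by auto
  from separate_compact_closed[OF S(1) this]
  obtain d where d: "0 < d" "\<And>x y. x \<in> ?S \<Longrightarrow> y \<in> - \<Omega> \<Longrightarrow> d \<le> dist x y" by blast
  obtain r0 where r0: "0 < r0" "ball 0 r0 \<subseteq> \<Omega>" using open_dom zero_in_dom openE by blast
  have b: "real DIM('a) < b" using p_pos s_pos by (simp add: b_def)
  obtain C where C: "C < \<infinity>"
    "\<And>x :: 'a. (\<integral>\<^sup>+y\<in>{y. d \<le> norm (x - y)}. ennreal (1 / norm (x - y) powr b) \<partial>lebesgue) \<le> C"
    using nn_integral_norm_powr_tail_bounded[OF b d(1)] by blast
  define A where "A x = ennreal (B powr p * (1 / r0 powr \<beta>)) * (ennreal (1 / norm x powr \<beta>) * indicator \<Omega> x)" for x :: 'a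
  have idm [measurable]: "(\<lambda>x. x) \<in> lebesgue \<rightarrow>\<^sub>M (borel :: 'a measure)" by (rule measurable_id_lebesgue_borel)
  have Am [measurable]: "A \<in> borel_measurable lebesgue" unfolding A_def by measurable
  have Afin: "(\<integral>\<^sup>+x. A x * C \<partial>lebesgue) < \<infinity>"
  proof -
    obtain R where R: "0 < R" "\<Omega> \<subseteq> ball 0 R" using bounded_subset_ballD[OF bounded_dom, of 0] by blast
    have "(\<integral>\<^sup>+x. ennreal (1 / norm x powr \<beta>) * indicator \<Omega> x \<partial>lebesgue) \<le>
        (\<integral>\<^sup>+x\<in>ball (0::'a) R. ennreal (1 / norm x powr \<beta>) \<partial>lebesgue)"
      using R by (intro nn_integral_mono mult_left_mono) (auto split: split_indicator)
    also have "\<dots> < \<infinity>"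
      by (rule nn_integral_norm_powr_ball_finite) (use beta_nonneg beta_less R in auto)
    finally have 1: "(\<integral>\<^sup>+x. ennreal (1 / norm x powr \<beta>) * indicator \<Omega> x \<partial>lebesgue) < \<infinity>" .
    have "(\<integral>\<^sup>+x. A x \<partial>lebesgue) = ennreal (B powr p * (1 / r0 powr \<beta>)) * (\<integral>\<^sup>+x. ennreal (1 / norm x powr \<beta>) * indicator \<Omega> x \<partial>lebesgue)"
      unfolding A_def by (rule nn_integral_cmult) measurable
    also have "\<dots> < \<infinity>" using 1 by (simp add: ennreal_mult_less_top)
    finally have "(\<integral>\<^sup>+x. A x \<partial>lebesgue) * C < \<infinity>" using C(1) by (simp add: ennreal_mult_less_top)
    then show ?thesis by (subst nn_integral_multc) auto
  qed
  have point: "nu_kernel s p \<beta> (x, y) * ennreal (\<bar>\<phi> x\<bar> powr p) \<le>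
      A x * (ennreal (1 / norm (x - y) powr b) * indicator {y. d \<le> norm (x - y)} y)" if y: "y \<notin> \<Omega>" for x y
  proof (cases "\<phi> x = 0")
    case False
    then have xS: "x \<in> ?S" using closure_subset[of "{x. \<phi> x \<noteq> 0}"] by auto
    then have dxy: "d \<le> norm (x - y)" using d(2) y by (simp add: dist_norm)
    have ry: "r0 \<le> norm y" using r0(2) y by (meson mem_ball_0 not_le subsetD)
    have "1 / norm y powr \<beta> \<le> 1 / r0 powr \<beta>"
      using ry r0(1) beta_nonneg by (intro divide_left_mono powr_mono2 mult_pos_pos) auto
    moreover have "\<bar>\<phi> x\<bar> powr p \<le> B powr p" using B p_pos by (intro powr_mono2) auto
    ultimately have "1 / norm (x - y) powr b * (1 / norm x powr \<beta>) * ((1 / norm y powr \<beta>) * \<bar>\<phi> x\<bar> powr p) \<le>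
        1 / norm (x - y) powr b * (1 / norm x powr \<beta>) * ((1 / r0 powr \<beta>) * B powr p)"
      by (intro mult_left_mono mult_mono) auto
    then have "ennreal (1 / (norm (x - y) powr b * norm x powr \<beta> * norm y powr \<beta>) * \<bar>\<phi> x\<bar> powr p) \<le>
        ennreal (B powr p * (1 / r0 powr \<beta>) * (1 / norm x powr \<beta> * (1 / norm (x - y) powr b)))"
      by (intro ennreal_leI) (simp add: mult_ac)
    then have "ennreal (1 / (norm (x - y) powr b * norm x powr \<beta> * norm y powr \<beta>)) * ennreal (\<bar>\<phi> x\<bar> powr p) \<le>
        ennreal (B powr p * (1 / r0 powr \<beta>)) * (ennreal (1 / norm x powr \<beta>) * ennreal (1 / norm (x - y) powr b))"
      by (simp only: ennreal_mult'' ennreal_mult' powr_ge_zero zero_le_divide_1_iff mult_nonneg_nonneg)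
    then show ?thesis
      using dxy S(2) xS unfolding A_def nu_kernel_def b_def by (auto simp: mult.assoc)
  qed simp
  have inner: "(\<integral>\<^sup>+y. A x * (ennreal (1 / norm (x - y) powr b) * indicator {y. d \<le> norm (x - y)} y) \<partial>lebesgue) \<le> A x * C" for x
  proof -
    have "(\<integral>\<^sup>+y. A x * (ennreal (1 / norm (x - y) powr b) * indicator {y. d \<le> norm (x - y)} y) \<partial>lebesgue) =
        A x * (\<integral>\<^sup>+y. ennreal (1 / norm (x - y) powr b) * indicator {y. d \<le> norm (x - y)} y \<partial>lebesgue)"
      by (rule nn_integral_cmult) measurable
    also have "\<dots> \<le> A x * C" by (intro mult_left_mono C(2)) simp
    finally show ?thesis .
  qed
  have fst_part: "(\<integral>\<^sup>+z. ennreal (epow \<phi> z) * indicator (\<Omega> \<times> (- \<Omega>)) z \<partial>\<nu>) < \<infinity>"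
  proof -
    have [measurable]: "\<Omega> \<times> (- \<Omega>) \<in> sets (lebesgue \<Otimes>\<^sub>M lebesgue)" by (intro pair_measureI dom_lebesgue compl_dom_lebesgue)
    have "(\<integral>\<^sup>+z. ennreal (epow \<phi> z) * indicator (\<Omega> \<times> (- \<Omega>)) z \<partial>\<nu>) =
        (\<integral>\<^sup>+z. nu_kernel s p \<beta> z * (ennreal (epow \<phi> z) * indicator (\<Omega> \<times> (- \<Omega>)) z) \<partial>(lebesgue \<Otimes>\<^sub>M lebesgue))"
      unfolding nu_w_eq_density by (rule nn_integral_density) measurable
    also have "\<dots> = (\<integral>\<^sup>+x. \<integral>\<^sup>+y. nu_kernel s p \<beta> (x, y) * (ennreal (\<bar>incr \<phi> (x, y)\<bar> powr p) * indicator (\<Omega> \<times> (- \<Omega>)) (x, y)) \<partial>lebesgue \<partial>lebesgue)"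
      by (rule sigma_finite_measure.nn_integral_fst[OF sigma_finite_lebesgue, symmetric]) measurable
    also have "\<dots> \<le> (\<integral>\<^sup>+x. \<integral>\<^sup>+y. A x * (ennreal (1 / norm (x - y) powr b) * indicator {y. d \<le> norm (x - y)} y) \<partial>lebesgue \<partial>lebesgue)"
    proof (intro nn_integral_mono)
      fix x y
      show "nu_kernel s p \<beta> (x, y) * (ennreal (\<bar>incr \<phi> (x, y)\<bar> powr p) * indicator (\<Omega> \<times> (- \<Omega>)) (x, y)) \<le>
          A x * (ennreal (1 / norm (x - y) powr b) * indicator {y. d \<le> norm (x - y)} y)"
        using point[of y x] Cc_inf_zero[OF phi, of y] by (cases "x \<in> \<Omega> \<and> y \<notin> \<Omega>") auto
    qed
    also have "\<dots> \<le> (\<integral>\<^sup>+x. A x * C \<partial>lebesgue)" by (intro nn_integral_mono inner)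
    finally show ?thesis using Afin by (rule le_less_trans)
  qed
  have snd_part: "(\<integral>\<^sup>+z. ennreal (epow \<phi> z) * indicator ((- \<Omega>) \<times> \<Omega>) z \<partial>\<nu>) < \<infinity>"
  proof -
    have [measurable]: "(- \<Omega>) \<times> \<Omega> \<in> sets (lebesgue \<Otimes>\<^sub>M lebesgue)" by (intro pair_measureI dom_lebesgue compl_dom_lebesgue)
    have "(\<integral>\<^sup>+z. ennreal (epow \<phi> z) * indicator ((- \<Omega>) \<times> \<Omega>) z \<partial>\<nu>) =
        (\<integral>\<^sup>+z. nu_kernel s p \<beta> z * (ennreal (epow \<phi> z) * indicator ((- \<Omega>) \<times> \<Omega>) z) \<partial>(lebesgue \<Otimes>\<^sub>M lebesgue))"
      unfolding nu_w_eq_density by (rule nn_integral_density) measurable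
    also have "\<dots> = (\<integral>\<^sup>+x. \<integral>\<^sup>+y. nu_kernel s p \<beta> (y, x) * (ennreal (\<bar>incr \<phi> (y, x)\<bar> powr p) * indicator ((- \<Omega>) \<times> \<Omega>) (y, x)) \<partial>lebesgue \<partial>lebesgue)"
      by (rule lebesgue_pair.nn_integral_snd[symmetric]) measurable
    also have "\<dots> \<le> (\<integral>\<^sup>+x. \<integral>\<^sup>+y. A x * (ennreal (1 / norm (x - y) powr b) * indicator {y. d \<le> norm (x - y)} y) \<partial>lebesgue \<partial>lebesgue)"
    proof (intro nn_integral_mono)
      fix x y
      show "nu_kernel s p \<beta> (y, x) * (ennreal (\<bar>incr \<phi> (y, x)\<bar> powr p) * indicator ((- \<Omega>) \<times> \<Omega>) (y, x)) \<le>
          A x * (ennreal (1 / norm (x - y) powr b) * indicator {y. d \<le> norm (x - y)} y)"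
        using point[of y x] Cc_inf_zero[OF phi, of y] nu_kernel_swap[of x y]
        by (cases "x \<in> \<Omega> \<and> y \<notin> \<Omega>") auto
    qed
    also have "\<dots> \<le> (\<integral>\<^sup>+x. A x * C \<partial>lebesgue)" by (intro nn_integral_mono inner)
    finally show ?thesis using Afin by (rule le_less_trans)
  qed
  have [measurable]: "\<Omega> \<times> (- \<Omega>) \<in> sets \<nu>" "(- \<Omega>) \<times> \<Omega> \<in> sets \<nu>"
    unfolding sets_nu_w by (intro pair_measureI dom_lebesgue compl_dom_lebesgue)+
  have "(\<integral>\<^sup>+z. ennreal (epow \<phi> z) \<partial>\<nu>) =
      (\<integral>\<^sup>+z. ennreal (epow \<phi> z * indicator (\<Omega> \<times> \<Omega>) z) +
        (ennreal (epow \<phi> z) * indicator (\<Omega> \<times> (- \<Omega>)) z + ennreal (epow \<phi> z) * indicator ((- \<Omega>) \<times> \<Omega>) z) \<partial>\<nu>)"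
  proof (rule nn_integral_cong)
    fix z :: "'a \<times> 'a"
    show "ennreal (epow \<phi> z) = ennreal (epow \<phi> z * indicator (\<Omega> \<times> \<Omega>) z) +
        (ennreal (epow \<phi> z) * indicator (\<Omega> \<times> (- \<Omega>)) z + ennreal (epow \<phi> z) * indicator ((- \<Omega>) \<times> \<Omega>) z)"
      using Cc_inf_zero[OF phi, of "fst z"] Cc_inf_zero[OF phi, of "snd z"]
      by (cases z; cases "fst z \<in> \<Omega>"; cases "snd z \<in> \<Omega>") auto
  qed
  also have "\<dots> = (\<integral>\<^sup>+z. ennreal (epow \<phi> z * indicator (\<Omega> \<times> \<Omega>) z) \<partial>\<nu>) +
        ((\<integral>\<^sup>+z. ennreal (epow \<phi> z) * indicator (\<Omega> \<times> (- \<Omega>)) z \<partial>\<nu>) +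
        (\<integral>\<^sup>+z. ennreal (epow \<phi> z) * indicator ((- \<Omega>) \<times> \<Omega>) z \<partial>\<nu>))"
    by (subst nn_integral_add, measurable, subst nn_integral_add, measurable)
  also have "\<dots> < \<infinity>"
  proof -
    have "(\<integral>\<^sup>+z. ennreal (epow \<phi> z * indicator (\<Omega> \<times> \<Omega>) z) \<partial>\<nu>) < \<infinity>"
      using fin unfolding Wpow_def by simp
    then show ?thesis using fst_part snd_part by simp
  qed
  finally have "integrable \<nu> (\<lambda>z. epow \<phi> z)"
    by (intro integrableI_nonneg powr_incr_measurable Cc_inf_measurable[OF phi]) auto
  then show ?thesis using Cc_inf_in_W[OF phi fin] by (simp add: En_def)
qed

lemma En_cong_AE:
  assumes "w \<in> En" "AE x in lebesgue. v x = w x" "v \<in> borel_measurable lebesgue" "\<And>x. x \<notin> \<Omega> \<Longrightarrow> v x = 0"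
  shows "v \<in> En"
proof -
  note [measurable] = En_measurable[OF assms(1)] assms(3)
  have "AE z in \<nu>. epow v z = epow w z"
    using AE_nu_w_fst_snd[OF assms(2)] by eventually_elim simp
  then have "integrable \<nu> (\<lambda>z. epow v z) = integrable \<nu> (\<lambda>z. epow w z)"
    by (intro integrable_cong_AE powr_incr_measurable assms(3) En_measurable[OF assms(1)])
  then show ?thesis
    using En_integrable[OF assms(1)] W_cong_AE[OF En_W[OF assms(1)] assms(2-4)] by (simp add: En_def)
qed

lemma incr_Tk_ext:
  assumes "\<And>x. x \<notin> \<Omega> \<Longrightarrow> w x = 0" "z \<in> ext" "0 \<le> k"
  shows "incr (\<lambda>x. Tk k (w x)) z = Tk k (incr w z)"
  using assms Tk_minus[OF assms(3), of "w (snd z)"] by (cases z) (auto simp: ext_def Tk_0)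

text \<open>Testing with \<open>T\<^sub>k w / k\<close> and letting \<open>k\<close> tend to \<open>0\<close> bounds the flux into the exterior.\<close>
lemma exterior_flux:
  assumes w: "w \<in> borel_measurable lebesgue" "\<And>x. x \<notin> \<Omega> \<Longrightarrow> w x = 0"
    and int: "\<And>k. 0 < k \<Longrightarrow> integrable \<nu> (\<lambda>z. flux w (\<lambda>x. Tk k (w x)) z)"
    and le: "\<And>k. 0 < k \<Longrightarrow> (\<integral>z. flux w (\<lambda>x. Tk k (w x)) z \<partial>\<nu>) \<le> k * A"
  shows "integrable \<nu> (\<lambda>z. \<bar>incr w z\<bar> powr (p - 1) * indicator ext z)"
    "(\<integral>z. \<bar>incr w z\<bar> powr (p - 1) * indicator ext z \<partial>\<nu>) \<le> A"
proof -
  note [measurable] = w(1)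
  define k where "k i = 1 / real (Suc i)" for i
  have k: "0 < k i" for i by (simp add: k_def)
  have k0: "k \<longlonglongrightarrow> 0" unfolding k_def[abs_def] by (rule LIMSEQ_Suc[OF lim_1_over_n])
  define F where "F i z = ((1 / k i) * (flux w (\<lambda>x. Tk (k i) (w x)) z)) * indicator ext z" for i z
  have nn: "0 \<le> flux w (\<lambda>x. Tk (k i) (w x)) z" for i z
    using Lp_phi_mult_Tk_ge[OF p_gt_1, of "k i" "w (fst z)" "w (snd z)"] powr_ge_zero order_trans by blast
  have intF: "integrable \<nu> (F i)" for i
    unfolding F_def by (intro integrable_real_mult_indicator ext_sets integrable_mult_right int k)
  have lim: "(\<lambda>i. F i z) \<longlonglongrightarrow> \<bar>incr w z\<bar> powr (p - 1) * indicator ext z" for z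
  proof (cases "z \<in> ext \<and> incr w z \<noteq> 0")
    case False
    then have "F i z = \<bar>incr w z\<bar> powr (p - 1) * indicator ext z" for i
      by (cases "z \<in> ext") (auto simp: F_def)
    then show ?thesis by simp
  next
    case True
    define a where "a = incr w z"
    have a: "0 < \<bar>a\<bar>" using True by (simp add: a_def)
    have "\<forall>\<^sub>F i in sequentially. k i < \<bar>a\<bar>" using k0 a by (rule order_tendstoD)
    then have "\<forall>\<^sub>F i in sequentially. F i z = \<bar>incr w z\<bar> powr (p - 1) * indicator ext z"
    proof eventually_elim
      case (elim i)
      \<comment> \<open>Once k i is below |a|, the truncation divided by k i is exactly the sign, so
        the sequence is eventually constant.\<close>
      have "Tk (k i) a = k i * sgn a" using elim k[of i] by (auto simp: Tk_def sgn_if)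
      then have "F i z = (1 / k i) * (Lp_phi p a * (k i * sgn a))"
        using True incr_Tk_ext[where w = w and z = z and k = "k i", OF w(2)] k[of i] by (simp add: F_def a_def)
      also have "\<dots> = Lp_phi p a * sgn a" using k[of i] by simp
      also have "\<dots> = \<bar>a\<bar> powr (p - 1)" using a by (auto simp: Lp_phi_eq_sgn sgn_if)
      finally show ?case using True by (simp add: a_def)
    qed
    then show ?thesis by (rule tendsto_eventually)
  qed
  have leF: "(\<integral>z. F i z \<partial>\<nu>) \<le> A" for i
  proof -
    have "(\<integral>z. F i z \<partial>\<nu>) \<le> (\<integral>z. (1 / k i) * (flux w (\<lambda>x. Tk (k i) (w x)) z) \<partial>\<nu>)"
    proof (rule integral_mono[OF intF])
      show "integrable \<nu> (\<lambda>z. (1 / k i) * (flux w (\<lambda>x. Tk (k i) (w x)) z))"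
        by (intro integrable_mult_right int k)
      show "F i z \<le> (1 / k i) * (flux w (\<lambda>x. Tk (k i) (w x)) z)" for z
      proof -
        have "0 \<le> (1 / k i) * (flux w (\<lambda>x. Tk (k i) (w x)) z)"
          by (rule mult_nonneg_nonneg[OF _ nn]) (use k[of i] in auto)
        then show ?thesis unfolding F_def by (cases "z \<in> ext") auto
      qed
    qed
    also have "\<dots> = (1 / k i) * (\<integral>z. flux w (\<lambda>x. Tk (k i) (w x)) z \<partial>\<nu>)" by simp
    also have "\<dots> \<le> (1 / k i) * (k i * A)" using le[OF k[of i]] k[of i] by (intro mult_left_mono) auto
    also have "\<dots> = A" using k[of i] by simp
    finally show ?thesis .
  qed
  have "0 \<le> F i z" for i z
    unfolding F_def by (rule mult_nonneg_nonneg[OF mult_nonneg_nonneg[OF _ nn]]) (use k[of i] in auto)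
  then have F0: "0 \<le> F i z + 0 + 0" for i z by simp
  have meas: "(\<lambda>z. \<bar>incr w z\<bar> powr (p - 1) * indicator ext z) \<in> borel_measurable \<nu>" by measurable
  have zero: "integrable \<nu> (\<lambda>_. 0 :: real)" "AE z in \<nu>. (\<lambda>n :: nat. 0 :: real) \<longlonglongrightarrow> 0"
    "(\<lambda>n :: nat. \<integral>z. (0 :: real) \<partial>\<nu>) \<longlonglongrightarrow> 0" by auto
  note fatou = integral_fatou_le[where G = "\<lambda>_. 0" and H = "\<lambda>_ _. 0", OF intF zero(1) zero(1) meas
      always_eventually[OF allI[OF F0]] always_eventually[OF allI[OF lim]] zero(2,3) leF tendsto_const]
  show "integrable \<nu> (\<lambda>z. \<bar>incr w z\<bar> powr (p - 1) * indicator ext z)" by (rule fatou(1))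
  show "(\<integral>z. \<bar>incr w z\<bar> powr (p - 1) * indicator ext z \<partial>\<nu>) \<le> A" by (rule fatou(2))
qed

end

section \<open>The limit of the minimisers and its entropy inequality\<close>

context entropy_data
begin

lemma sol_Tk_test:
  assumes "0 < k"
  shows "(\<integral>z. flux (sol n) (\<lambda>x. Tk k (sol n x)) z \<partial>\<nu>) \<le> 2 * (\<integral>x. f x * Tk k (sol n x) \<partial>lebesgue)"
  using sol_truncated_test[OF X_0[of "real n"] assms] by simp

lemma sol_Tk_test_le:
  assumes "0 < k"
  shows "(\<integral>z. flux (sol n) (\<lambda>x. Tk k (sol n x)) z \<partial>\<nu>) \<le> k * (2 * normf)"
proof -
  have "(\<integral>x. f x * Tk k (sol n x) \<partial>lebesgue) \<le> k * normf"
  proof (rule f_mult_integral_le)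
    show "(\<lambda>x. Tk k (sol n x)) \<in> borel_measurable lebesgue" by measurable
    show "\<bar>Tk k (sol n x)\<bar> \<le> k" for x using assms by (intro abs_Tk_le) simp
  qed
  then show ?thesis using sol_Tk_test[OF assms, of n] by simp
qed

lemma sol_flux:
  "integrable \<nu> (\<lambda>z. \<bar>incr (sol n) z\<bar> powr (p - 1) * indicator ext z)"
  "(\<integral>z. \<bar>incr (sol n) z\<bar> powr (p - 1) * indicator ext z \<partial>\<nu>) \<le> 2 * normf"
proof -
  have int: "integrable \<nu> (\<lambda>z. flux (sol n) (\<lambda>x. Tk k (sol n x)) z)" if "0 < k" for k
    using that by (intro En_integrable_Lp_phi sol_En En_Tk) auto
  show "integrable \<nu> (\<lambda>z. \<bar>incr (sol n) z\<bar> powr (p - 1) * indicator ext z)"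
    "(\<integral>z. \<bar>incr (sol n) z\<bar> powr (p - 1) * indicator ext z \<partial>\<nu>) \<le> 2 * normf"
    by (rule exterior_flux[OF sol_measurable sol_zero int sol_Tk_test_le]; assumption)+
qed

text \<open>\<open>lim\<close> is arbitrary where the sequence diverges; the maximum makes u
  nonnegative at every point.\<close>

definition u :: "'a \<Rightarrow> real" where "u x = max 0 (lim (\<lambda>n. sol n x))"

lemma u_measurable [measurable]: "u \<in> borel_measurable lebesgue"
  unfolding u_def by measurable

lemma u_nonneg: "0 \<le> u x" by (simp add: u_def)

lemma u_zero: "x \<notin> \<Omega> \<Longrightarrow> u x = 0" by (simp add: u_def sol_zero lim_const)

lemma sol_incseq: "AE x in lebesgue. incseq (\<lambda>n. sol n x)"
proof -
  have "AE x in lebesgue. \<forall>n. sol n x \<le> sol (Suc n) x"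
    unfolding AE_all_countable using sol_mono by auto
  then show ?thesis by eventually_elim (rule incseq_SucI, blast)
qed

lemma convergent_if_liminf_finite:
  fixes a :: "nat \<Rightarrow> real"
  assumes inc: "incseq a" and nn: "\<And>n. 0 \<le> a n" and fin: "liminf (\<lambda>n. ennreal (a n powr (p - 1))) \<noteq> \<infinity>"
  shows "convergent a"
proof (rule ccontr)
  assume "\<not> convergent a"
  then have unb: "\<exists>n. K < a n" for K
    using incseq_convergent[OF inc, of K] by (meson convergent_def not_le)
  have "ennreal K \<le> liminf (\<lambda>n. ennreal (a n powr (p - 1)))" if "0 \<le> K" for K
  proof (rule Liminf_bounded)
    obtain m where m: "K powr (1 / (p - 1)) < a m" using unb by blast
    have "K \<le> a n powr (p - 1)" if n: "m \<le> n" for n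
    proof -
      have "K powr (1 / (p - 1)) \<le> a n" using m incseqD[OF inc n] by linarith
      then have "(K powr (1 / (p - 1))) powr (p - 1) \<le> a n powr (p - 1)"
        using p_gt_1 by (intro powr_mono2) auto
      then show ?thesis using p_gt_1 \<open>0 \<le> K\<close> by (simp add: powr_powr)
    qed
    then show "\<forall>\<^sub>F n in sequentially. ennreal K \<le> ennreal (a n powr (p - 1))"
      unfolding eventually_sequentially by (intro exI[of _ m]) (auto intro: ennreal_leI)
  qed
  moreover obtain c where c: "0 \<le> c" "liminf (\<lambda>n. ennreal (a n powr (p - 1))) = ennreal c"
    using fin by (cases "liminf (\<lambda>n. ennreal (a n powr (p - 1)))" rule: ennreal_cases) auto
  ultimately have "ennreal (c + 1) \<le> ennreal c" by (metis add_nonneg_nonneg zero_le_one)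
  then show False using c(1) by (simp add: ennreal_le_iff)
qed

text \<open>An increasing sequence could diverge to infinity. The exterior flux is bounded uniformly
  in n, so by Fatou's lemma the values have a finite liminf of their (p-1)-th powers on almost every
  pair across the boundary, hence at almost every interior point.\<close>

lemma sol_tendsto: "AE x in lebesgue. (\<lambda>n. sol n x) \<longlonglongrightarrow> u x"
proof -
  have "(\<integral>\<^sup>+z. liminf (\<lambda>n. ennreal (\<bar>incr (sol n) z\<bar> powr (p - 1) * indicator ext z)) \<partial>\<nu>) \<le>
      liminf (\<lambda>n. \<integral>\<^sup>+z. ennreal (\<bar>incr (sol n) z\<bar> powr (p - 1) * indicator ext z) \<partial>\<nu>)"
    by (rule nn_integral_liminf) measurable
  also have "\<dots> \<le> liminf (\<lambda>n. ennreal (2 * normf))"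
  proof (intro Liminf_mono always_eventually allI)
    fix n
    have "(\<integral>\<^sup>+z. ennreal (\<bar>incr (sol n) z\<bar> powr (p - 1) * indicator ext z) \<partial>\<nu>) =
        ennreal (\<integral>z. \<bar>incr (sol n) z\<bar> powr (p - 1) * indicator ext z \<partial>\<nu>)"
      by (rule nn_integral_eq_integral[OF sol_flux(1)]) simp
    then show "(\<integral>\<^sup>+z. ennreal (\<bar>incr (sol n) z\<bar> powr (p - 1) * indicator ext z) \<partial>\<nu>) \<le> ennreal (2 * normf)"
      using sol_flux(2) by (simp add: ennreal_leI)
  qed
  also have "\<dots> < \<infinity>" by (simp add: Liminf_const)
  finally have fin: "(\<integral>\<^sup>+z. liminf (\<lambda>n. ennreal (\<bar>incr (sol n) z\<bar> powr (p - 1) * indicator ext z)) \<partial>\<nu>) \<noteq> \<infinity>"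
    by simp
  have "(\<lambda>z. liminf (\<lambda>n. ennreal (\<bar>incr (sol n) z\<bar> powr (p - 1) * indicator ext z))) \<in> borel_measurable \<nu>"
    by measurable
  from nn_integral_PInf_AE[OF this fin]
  have "AE z in \<nu>. liminf (\<lambda>n. ennreal (\<bar>incr (sol n) z\<bar> powr (p - 1) * indicator ext z)) \<noteq> \<infinity>" .
  with AE_nu_w_fst_snd[OF sol_incseq]
  have "AE z in \<nu>. fst z \<in> \<Omega> \<and> snd z \<notin> \<Omega> \<longrightarrow> convergent (\<lambda>n. sol n (fst z))"
  proof eventually_elim
    case (elim z)
    show ?case
    proof
      assume z: "fst z \<in> \<Omega> \<and> snd z \<notin> \<Omega>"
      then have "z \<in> ext" by (cases z) (simp add: ext_def)
      then have "\<bar>incr (sol n) z\<bar> powr (p - 1) * indicator ext z = sol n (fst z) powr (p - 1)" for n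
        using z by (simp add: sol_zero sol_nonneg)
      then show "convergent (\<lambda>n. sol n (fst z))"
        using elim by (intro convergent_if_liminf_finite) (auto simp: sol_nonneg)
    qed
  qed
  then have "AE x in lebesgue. x \<in> \<Omega> \<longrightarrow> convergent (\<lambda>n. sol n x)" by (rule AE_dom_if_AE_exterior)
  then have "AE x in lebesgue. convergent (\<lambda>n. sol n x)"
    by (rule AE_lebesgue_if_dom) (simp add: sol_zero convergent_const)
  then show ?thesis
  proof eventually_elim
    case (elim x)
    then have l: "(\<lambda>n. sol n x) \<longlonglongrightarrow> lim (\<lambda>n. sol n x)" by (simp add: convergent_LIMSEQ_iff)
    have "0 \<le> lim (\<lambda>n. sol n x)" by (rule LIMSEQ_le_const[OF l]) (use sol_nonneg in blast)
    then show ?case using l by (simp add: u_def max_def)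
  qed
qed

lemma sol_le_u: "AE x in lebesgue. \<forall>n. sol n x \<le> u x"
  using sol_tendsto sol_incseq by eventually_elim (auto intro: incseq_le)

lemma incr_sol_tendsto: "AE z in \<nu>. (\<lambda>n. incr (sol n) z) \<longlonglongrightarrow> incr u z"
  using AE_nu_w_fst_snd[OF sol_tendsto] by eventually_elim (intro tendsto_diff, auto)

text \<open>The truncated minimisers have bounded energy, but energy bounds and pointwise
  convergence do not yet give convergence in norm. The functions between \<open>Tk k (sol m)\<close>
  and \<open>Tk k u\<close> of energy at most B form convex sets, decreasing because the minimisers
  increase, and squeezing identifies the limit that \<open>nested_convex_limit\<close>
  provides.\<close>

lemma Tk_u_X:
  assumes k: "0 < k" shows "(\<lambda>x. Tk k (u x)) \<in> X k"
proof -
  define B where "B = k * (2 * normf)"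
  define C where "C m = {w \<in> X k. Q w \<le> B \<and> (AE x in lebesgue. Tk k (sol m x) \<le> w x \<and> w x \<le> Tk k (u x))}" for m
  have TX: "(\<lambda>x. Tk k (sol m x)) \<in> X k" for m
    using k En_Tk[OF sol_En, of k m] by (simp add: X_def abs_Tk_le)
  have TQ: "Q (\<lambda>x. Tk k (sol m x)) \<le> B" for m
  proof -
    have "Q (\<lambda>x. Tk k (sol m x)) \<le> (\<integral>z. flux (sol m) (\<lambda>x. Tk k (sol m x)) z \<partial>\<nu>)"
      unfolding Q_def
    proof (rule integral_mono[OF En_integrable[OF X_En[OF TX]] En_integrable_Lp_phi[OF sol_En X_En[OF TX]]])
      show "epow (\<lambda>x. Tk k (sol m x)) z \<le> flux (sol m) (\<lambda>x. Tk k (sol m x)) z" for z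
        by (rule Lp_phi_mult_Tk_ge[OF p_gt_1])
    qed
    then show ?thesis using sol_Tk_test_le[OF k, of m] by (simp add: B_def)
  qed
  have TC: "(\<lambda>x. Tk k (sol m x)) \<in> C m" for m
    using TX TQ sol_le_u by (auto simp: C_def intro: Tk_mono elim!: AE_mp)
  obtain ws w where w: "\<And>m. ws m \<in> C m" "w \<in> X k" "AE x in lebesgue. (\<lambda>m. ws m x) \<longlonglongrightarrow> w x"
  proof (rule nested_convex_limit[of C k B])
    show "C m \<subseteq> X k" for m by (auto simp: C_def)
    show "C (Suc m) \<subseteq> C m" for m
    proof
      fix w assume w: "w \<in> C (Suc m)"
      then have "AE x in lebesgue. Tk k (sol (Suc m) x) \<le> w x \<and> w x \<le> Tk k (u x)" by (simp add: C_def)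
      with sol_mono[of m "Suc m", simplified] have "AE x in lebesgue. Tk k (sol m x) \<le> w x \<and> w x \<le> Tk k (u x)"
        by eventually_elim (meson Tk_mono order_trans)
      then show "w \<in> C m" using w by (simp add: C_def)
    qed
    show "(\<lambda>x. (v x + w x) / 2) \<in> C m" if v: "v \<in> C m" and w: "w \<in> C m" for m v w
    proof -
      have vX: "v \<in> X k" "Q v \<le> B" "AE x in lebesgue. Tk k (sol m x) \<le> v x \<and> v x \<le> Tk k (u x)"
        and wX: "w \<in> X k" "Q w \<le> B" "AE x in lebesgue. Tk k (sol m x) \<le> w x \<and> w x \<le> Tk k (u x)"
        using v w by (auto simp: C_def)
      have "Q (\<lambda>x. (v x + w x) / 2) \<le> (Q v + Q w) / 2" by (rule Q_midpoint[OF X_En[OF vX(1)] X_En[OF wX(1)]])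
      also have "\<dots> \<le> B" using vX(2) wX(2) by simp
      finally have "Q (\<lambda>x. (v x + w x) / 2) \<le> B" .
      moreover have "AE x in lebesgue. Tk k (sol m x) \<le> (v x + w x) / 2 \<and> (v x + w x) / 2 \<le> Tk k (u x)"
        using vX(3) wX(3) by eventually_elim (simp add: field_simps)
      ultimately show ?thesis using X_midpoint[OF vX(1) wX(1)] by (simp add: C_def)
    qed
    show "\<exists>w\<in>C m. Q w \<le> B" for m using TC TQ by blast
  qed auto
  have "AE x in lebesgue. \<forall>m. Tk k (sol m x) \<le> ws m x \<and> ws m x \<le> Tk k (u x)"
    unfolding AE_all_countable using w(1) by (auto simp: C_def)
  with w(3) sol_tendsto have eq: "AE x in lebesgue. Tk k (u x) = w x"
  proof eventually_elim
    case (elim x)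
    have "(\<lambda>m. Tk k (sol m x)) \<longlonglongrightarrow> Tk k (u x)"
      using elim(2) by (rule isCont_tendsto_compose[OF isCont_Tk])
    then have "(\<lambda>m. ws m x) \<longlonglongrightarrow> Tk k (u x)"
      by (rule tendsto_sandwich[OF _ _ _ tendsto_const, rotated 2]) (use elim(3) in auto)
    then show ?case using elim(1) by (rule LIMSEQ_unique)
  qed
  have "(\<lambda>x. Tk k (u x)) \<in> En"
    by (rule En_cong_AE[OF X_En[OF w(2)] eq]) (use k in \<open>auto simp: u_zero Tk_0\<close>)
  then show ?thesis using k by (simp add: X_def abs_Tk_le)
qed

lemma u_flux:
  "integrable \<nu> (\<lambda>z. \<bar>incr u z\<bar> powr (p - 1) * indicator ext z)"
proof (rule integral_fatou_le(1)[where F = "\<lambda>n z. \<bar>incr (sol n) z\<bar> powr (p - 1) * indicator ext z"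
      and G = "\<lambda>_. 0" and H = "\<lambda>_ _. 0" and c = "\<lambda>_. 2 * normf"])
  show "AE z in \<nu>. (\<lambda>n. \<bar>incr (sol n) z\<bar> powr (p - 1) * indicator ext z) \<longlonglongrightarrow> \<bar>incr u z\<bar> powr (p - 1) * indicator ext z"
    using incr_sol_tendsto
  proof eventually_elim
    case (elim z)
    have "(\<lambda>n. \<bar>Lp_phi p (incr (sol n) z)\<bar>) \<longlonglongrightarrow> \<bar>Lp_phi p (incr u z)\<bar>"
      by (intro tendsto_rabs isCont_tendsto_compose[OF isCont_Lp_phi[OF p_gt_1]] elim)
    then show ?case unfolding abs_Lp_phi by (rule tendsto_mult[OF _ tendsto_const])
  qed
  show "(\<lambda>z. \<bar>incr u z\<bar> powr (p - 1) * indicator ext z) \<in> borel_measurable \<nu>" by measurable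
qed (use sol_flux in auto)

lemma u_entropy_energy:
  assumes phi: "\<phi> \<in> X M" and k: "0 < k"
  shows "integrable \<nu> (\<lambda>z. flux u (\<lambda>x. Tk k (u x - \<phi> x)) z)"
    "(\<integral>z. flux u (\<lambda>x. Tk k (u x - \<phi> x)) z \<partial>\<nu>) \<le> 2 * (\<integral>x. f x * Tk k (u x - \<phi> x) \<partial>lebesgue)"
proof -
  note [measurable] = X_measurable[OF phi]
  \<comment> \<open>Only the obstacle problems of level at least M admit \<phi>, so the sequence
    starts at N.\<close>
  obtain N :: nat where "M \<le> real N" using real_arch_simple by blast
  then have phiX: "\<phi> \<in> X (real (n + N))" for n using phi X_mono[of M "real (n + N)"] by auto
  define F where "F n z = flux (sol (n + N)) (\<lambda>x. Tk k (sol (n + N) x - \<phi> x)) z" for n z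
  have intF: "integrable \<nu> (F n)" for n
    unfolding F_def using k by (intro En_integrable_Lp_phi sol_En En_Tk En_diff X_En[OF phi]) auto
  have lim: "AE z in \<nu>. (\<lambda>n. F n z) \<longlonglongrightarrow> flux u (\<lambda>x. Tk k (u x - \<phi> x)) z"
    using AE_nu_w_fst_snd[OF sol_tendsto]
  proof eventually_elim
    case (elim z)
    then have 1: "(\<lambda>n. sol (n + N) (fst z)) \<longlonglongrightarrow> u (fst z)" "(\<lambda>n. sol (n + N) (snd z)) \<longlonglongrightarrow> u (snd z)"
      using LIMSEQ_ignore_initial_segment by blast+
    show ?case unfolding F_def
      by (intro tendsto_mult isCont_tendsto_compose[OF isCont_Lp_phi[OF p_gt_1]]
          isCont_tendsto_compose[OF isCont_Tk] tendsto_diff 1 tendsto_const)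
  qed
  have ge: "0 \<le> F n z + epow \<phi> z + 0" for n z
    using Lp_phi_mult_Tk_shift_ge[OF p_gt_1, of "\<phi> (fst z)" "\<phi> (snd z)" "sol (n + N) (fst z)" "sol (n + N) (snd z)" k]
    unfolding F_def by (smt (verit))
  have leF: "(\<integral>z. F n z \<partial>\<nu>) \<le> 2 * (\<integral>x. f x * Tk k (sol (n + N) x - \<phi> x) \<partial>lebesgue)" for n
    using sol_truncated_test[OF phiX k, of n] unfolding F_def by simp
  have cl: "(\<lambda>n. 2 * (\<integral>x. f x * Tk k (sol (n + N) x - \<phi> x) \<partial>lebesgue)) \<longlonglongrightarrow> 2 * (\<integral>x. f x * Tk k (u x - \<phi> x) \<partial>lebesgue)"
  proof (intro tendsto_mult tendsto_const f_mult_tendsto[where k = k])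
    show "AE x in lebesgue. (\<lambda>n. Tk k (sol (n + N) x - \<phi> x)) \<longlonglongrightarrow> Tk k (u x - \<phi> x)"
      using sol_tendsto
    proof eventually_elim
      case (elim x)
      show ?case
        by (intro isCont_tendsto_compose[OF isCont_Tk] tendsto_diff tendsto_const LIMSEQ_ignore_initial_segment[OF elim])
    qed
  qed (use k in \<open>auto intro: abs_Tk_le\<close>)
  have meas: "(\<lambda>z. flux u (\<lambda>x. Tk k (u x - \<phi> x)) z) \<in> borel_measurable \<nu>" by measurable
  show "integrable \<nu> (\<lambda>z. flux u (\<lambda>x. Tk k (u x - \<phi> x)) z)"
    "(\<integral>z. flux u (\<lambda>x. Tk k (u x - \<phi> x)) z \<partial>\<nu>) \<le> 2 * (\<integral>x. f x * Tk k (u x - \<phi> x) \<partial>lebesgue)"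
    by (rule integral_fatou_le[where F = F and G = "\<lambda>z. epow \<phi> z" and H = "\<lambda>_ _. 0",
          OF intF En_integrable[OF X_En[OF phi]] _ meas always_eventually[OF allI[OF ge]] lim _ _ leF cl]; simp)+
qed

text \<open>\<phi> is approximated by test functions, for which the energy version applies. Across
  the boundary their energies may blow up in the limit, so a lower bound through the test function
  works inside \<Omega> x \<Omega> only.\<close>

lemma u_entropy:
  assumes phi: "\<phi> \<in> W" and k: "0 < k"
  shows "integrable \<nu> (\<lambda>z. flux u (\<lambda>x. Tk k (u x - \<phi> x)) z)"
    "(\<integral>z. flux u (\<lambda>x. Tk k (u x - \<phi> x)) z \<partial>\<nu>) \<le> 2 * (\<integral>x. f x * Tk k (u x - \<phi> x) \<partial>lebesgue)"
proof -
  note phim [measurable] = W_measurable[OF phi]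
  obtain \<eta> where eta: "\<And>n. \<eta> n \<in> Cc_inf \<Omega>" "(\<lambda>n. Wpow (\<lambda>x. \<eta> n x - \<phi> x)) \<longlonglongrightarrow> 0"
    using W_approx[OF phi] by blast
  obtain r where r: "strict_mono r" "AE x in lebesgue. (\<lambda>n. \<eta> (r n) x - \<phi> x) \<longlonglongrightarrow> 0"
    using Wpow_tendsto_0_AE_subseq[OF _ _ eta(2)] phim Cc_inf_measurable[OF eta(1)] Cc_inf_zero[OF eta(1)] W_zero[OF phi]
    by auto
  have rl: "(\<lambda>n. Wpow (\<lambda>x. \<eta> (r n) x - \<phi> x)) \<longlonglongrightarrow> 0"
    using LIMSEQ_subseq_LIMSEQ[OF eta(2) r(1)] by (simp add: o_def)
  have "\<forall>\<^sub>F n in sequentially. Wpow (\<lambda>x. \<eta> (r n) x - \<phi> x) < 1" using rl by (rule order_tendstoD) simp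
  \<comment> \<open>Past this index the approximants have finite \<open>Wpow\<close>, which is what
    \<open>Cc_inf_En\<close> asks for.\<close>
  then obtain m where m: "\<And>n. m \<le> n \<Longrightarrow> Wpow (\<lambda>x. \<eta> (r n) x - \<phi> x) < 1" by (auto simp: eventually_sequentially)
  define \<psi> where "\<psi> n = \<eta> (r (n + m))" for n
  have psiC: "\<psi> n \<in> Cc_inf \<Omega>" for n by (simp add: \<psi>_def eta)
  have psim [measurable]: "\<psi> n \<in> borel_measurable lebesgue" for n by (rule Cc_inf_measurable[OF psiC])
  have psi1: "Wpow (\<lambda>x. \<psi> n x - \<phi> x) < 1" for n using m[of "n + m"] by (simp add: \<psi>_def)
  have psi0: "(\<lambda>n. Wpow (\<lambda>x. \<psi> n x - \<phi> x)) \<longlonglongrightarrow> 0"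
    using LIMSEQ_ignore_initial_segment[OF rl, of m] by (simp add: \<psi>_def)
  have psiAE: "AE x in lebesgue. (\<lambda>n. \<psi> n x) \<longlonglongrightarrow> \<phi> x"
    using r(2)
  proof eventually_elim
    case (elim x)
    from LIMSEQ_ignore_initial_segment[OF elim, of m] show ?case by (simp add: \<psi>_def LIM_zero_iff)
  qed
  have psiX: "\<exists>M. \<psi> n \<in> X M" for n
  proof -
    have "Wpow (\<psi> n) \<le> ennreal (2 powr p) * (Wpow (\<lambda>x. \<psi> n x - \<phi> x) + Wpow \<phi>)"
      using Wpow_add_le[of "\<lambda>x. \<psi> n x - \<phi> x" \<phi>] by simp
    also have "\<dots> < \<infinity>" using psi1[of n] W_Wpow[OF phi] by (auto simp: ennreal_mult_less_top intro: less_trans)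
    finally have "\<psi> n \<in> En" by (rule Cc_inf_En[OF psiC])
    moreover obtain B where "\<And>x. \<bar>\<psi> n x\<bar> \<le> B" using Cc_inf_bounded[OF psiC] by blast
    ultimately show ?thesis by (auto simp: X_def)
  qed
  define F where "F n z = flux u (\<lambda>x. Tk k (u x - \<psi> n x)) z" for n z
  \<comment> \<open>Inside \<Omega> x \<Omega> the lower bound through the increments of \<psi> n
    splits into a fixed part, from \<phi>, and the vanishing part H n. On \<open>ext\<close> the
    truncated increment is at most k in modulus, which leaves k times the flux of u.\<close>
  define G where "G z = 2 powr p * (epow \<phi> z * indicator (\<Omega> \<times> \<Omega>) z) + k * (\<bar>incr u z\<bar> powr (p - 1) * indicator ext z)" for z
  define H where "H n z = 2 powr p * (epow (\<lambda>x. \<psi> n x - \<phi> x) z * indicator (\<Omega> \<times> \<Omega>) z)" for n z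
  have intF: "integrable \<nu> (F n)" and leF: "(\<integral>z. F n z \<partial>\<nu>) \<le> 2 * (\<integral>x. f x * Tk k (u x - \<psi> n x) \<partial>lebesgue)" for n
    using psiX[of n] u_entropy_energy[OF _ k] unfolding F_def by blast+
  have gag: "integrable \<nu> (\<lambda>z. epow w z * indicator (\<Omega> \<times> \<Omega>) z)"
    if "Wpow w < \<infinity>" and [measurable]: "w \<in> borel_measurable lebesgue" for w
  proof (rule integrableI_nonneg)
    show "(\<lambda>z. epow w z * indicator (\<Omega> \<times> \<Omega>) z) \<in> borel_measurable \<nu>" by measurable
    show "(\<integral>\<^sup>+z. ennreal (epow w z * indicator (\<Omega> \<times> \<Omega>) z) \<partial>\<nu>) < \<infinity>"
      using that(1) unfolding Wpow_def by simp
  qed simp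
  have intG: "integrable \<nu> G"
    unfolding G_def by (intro Bochner_Integration.integrable_add integrable_mult_right gag W_Wpow[OF phi] phim u_flux)
  have difm: "(\<lambda>x. \<psi> n x - \<phi> x) \<in> borel_measurable lebesgue" for n by measurable
  have fin1: "Wpow (\<lambda>x. \<psi> n x - \<phi> x) < \<infinity>" for n using psi1[of n] by (rule less_trans) simp
  have intH: "integrable \<nu> (H n)" for n
    unfolding H_def by (intro integrable_mult_right gag fin1 difm)
  have limH: "(\<lambda>n. \<integral>z. H n z \<partial>\<nu>) \<longlonglongrightarrow> 0"
  proof -
    have g: "(\<lambda>n. \<integral>\<^sup>+z. ennreal (epow (\<lambda>x. \<psi> n x - \<phi> x) z * indicator (\<Omega> \<times> \<Omega>) z) \<partial>\<nu>) \<longlonglongrightarrow> 0"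
      by (rule tendsto_sandwich[OF _ _ tendsto_const psi0]; simp add: Wpow_def)
    have eq: "(\<integral>\<^sup>+z. ennreal (epow (\<lambda>x. \<psi> n x - \<phi> x) z * indicator (\<Omega> \<times> \<Omega>) z) \<partial>\<nu>) =
        ennreal (\<integral>z. epow (\<lambda>x. \<psi> n x - \<phi> x) z * indicator (\<Omega> \<times> \<Omega>) z \<partial>\<nu>)" for n
      by (rule nn_integral_eq_integral[OF gag[OF fin1 difm]]) simp
    have "(\<lambda>n. \<integral>z. epow (\<lambda>x. \<psi> n x - \<phi> x) z * indicator (\<Omega> \<times> \<Omega>) z \<partial>\<nu>) \<longlonglongrightarrow> 0"
      using g unfolding eq by (subst (asm) ennreal_tendsto_0_iff) (auto intro: integral_nonneg_AE)
    from tendsto_mult[OF tendsto_const[of "2 powr p"] this] show ?thesis by (simp add: H_def)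
  qed
  have lims: "AE z in \<nu>. (\<lambda>n. F n z) \<longlonglongrightarrow> flux u (\<lambda>x. Tk k (u x - \<phi> x)) z \<and> (\<lambda>n. H n z) \<longlonglongrightarrow> 0"
    using AE_nu_w_fst_snd[OF psiAE]
  proof eventually_elim
    case (elim z)
    have "(\<lambda>n. incr (\<lambda>x. \<psi> n x - \<phi> x) z) \<longlonglongrightarrow> incr (\<lambda>x. \<phi> x - \<phi> x) z"
      using elim by (intro tendsto_diff tendsto_const) auto
    from isCont_tendsto_compose[OF isCont_abs_powr[OF p_gt_1] this]
    have "(\<lambda>n. epow (\<lambda>x. \<psi> n x - \<phi> x) z) \<longlonglongrightarrow> 0" by simp
    from tendsto_mult[OF tendsto_const[of "2 powr p"] tendsto_mult[OF this tendsto_const[of "indicator (\<Omega> \<times> \<Omega>) z"]]]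
    have "(\<lambda>n. H n z) \<longlonglongrightarrow> 0" by (simp add: H_def)
    moreover have "(\<lambda>n. F n z) \<longlonglongrightarrow> flux u (\<lambda>x. Tk k (u x - \<phi> x)) z"
      unfolding F_def using elim
      by (intro tendsto_mult tendsto_const isCont_tendsto_compose[OF isCont_Tk] tendsto_diff) auto
    ultimately show ?case by blast
  qed
  have ge: "0 \<le> F n z + G z + H n z" for n z
  proof -
    consider "z \<in> \<Omega> \<times> \<Omega>" "z \<notin> ext" | "z \<in> ext" "z \<notin> \<Omega> \<times> \<Omega>" | "fst z \<notin> \<Omega>" "snd z \<notin> \<Omega>"
      by (cases z) (auto simp: ext_def)
    then show ?thesis
    proof cases
      case 1
      have "- (epow (\<psi> n) z) \<le> F n z"
        unfolding F_def by (rule Lp_phi_mult_Tk_shift_ge[OF p_gt_1])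
      moreover have "epow (\<psi> n) z \<le> 2 powr p * (epow (\<lambda>x. \<psi> n x - \<phi> x) z + epow \<phi> z)"
        using abs_powr_add_le[OF p_pos, of "incr (\<lambda>x. \<psi> n x - \<phi> x) z" "incr \<phi> z"] by simp
      moreover have "G z + H n z = 2 powr p * (epow (\<lambda>x. \<psi> n x - \<phi> x) z + epow \<phi> z)"
        using 1 by (simp add: G_def H_def distrib_left)
      ultimately show ?thesis by (smt (verit))
    next
      case 2
      have "\<bar>incr (\<lambda>x. Tk k (u x - \<psi> n x)) z\<bar> \<le> k"
        using incr_Tk_ext[of "\<lambda>x. u x - \<psi> n x" z k] 2 k abs_Tk_le[of k "incr (\<lambda>x. u x - \<psi> n x) z"]
          u_zero Cc_inf_zero[OF psiC] by simp
      then have "\<bar>F n z\<bar> \<le> \<bar>incr u z\<bar> powr (p - 1) * k"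
        unfolding F_def abs_mult abs_Lp_phi by (intro mult_left_mono) auto
      moreover have "G z + H n z = \<bar>incr u z\<bar> powr (p - 1) * k" using 2 by (simp add: G_def H_def)
      ultimately show ?thesis by (smt (verit))
    next
      case 3
      then have "F n z = 0" by (simp add: F_def u_zero)
      moreover have "0 \<le> G z" "0 \<le> H n z" using k by (simp_all add: G_def H_def)
      ultimately show ?thesis by simp
    qed
  qed
  have cl: "(\<lambda>n. 2 * (\<integral>x. f x * Tk k (u x - \<psi> n x) \<partial>lebesgue)) \<longlonglongrightarrow> 2 * (\<integral>x. f x * Tk k (u x - \<phi> x) \<partial>lebesgue)"
  proof (intro tendsto_mult tendsto_const f_mult_tendsto[where k = k])
    show "AE x in lebesgue. (\<lambda>n. Tk k (u x - \<psi> n x)) \<longlonglongrightarrow> Tk k (u x - \<phi> x)"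
      using psiAE by eventually_elim (intro isCont_tendsto_compose[OF isCont_Tk] tendsto_diff tendsto_const)
  qed (use k in \<open>auto intro: abs_Tk_le\<close>)
  have limF: "AE z in \<nu>. (\<lambda>n. F n z) \<longlonglongrightarrow> flux u (\<lambda>x. Tk k (u x - \<phi> x)) z"
    and limH0: "AE z in \<nu>. (\<lambda>n. H n z) \<longlonglongrightarrow> 0" using lims by auto
  have meas: "(\<lambda>z. flux u (\<lambda>x. Tk k (u x - \<phi> x)) z) \<in> borel_measurable \<nu>" by measurable
  note fatou = integral_fatou_le[OF intF intG intH meas always_eventually[OF allI[OF ge]] limF limH0 limH leF cl]
  show "integrable \<nu> (\<lambda>z. flux u (\<lambda>x. Tk k (u x - \<phi> x)) z)" by (rule fatou(1))
  show "(\<integral>z. flux u (\<lambda>x. Tk k (u x - \<phi> x)) z \<partial>\<nu>) \<le> 2 * (\<integral>x. f x * Tk k (u x - \<phi> x) \<partial>lebesgue)"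
    by (rule fatou(2))
qed

end

section \<open>Stability and strong convergence of truncations\<close>

lemma integral_mult_bounded_tendsto:
  fixes g h :: "nat \<Rightarrow> 'b \<Rightarrow> real" and G :: "'b \<Rightarrow> real"
  assumes g: "\<And>n. g n \<in> borel_measurable M" "g' \<in> borel_measurable M" "\<And>n x. \<bar>g n x\<bar> \<le> G x" "integrable M G"
    and h: "\<And>n. h n \<in> borel_measurable M" "h' \<in> borel_measurable M" "\<And>n x. \<bar>h n x\<bar> \<le> k"
    and lim: "AE x in M. (\<lambda>n. g n x) \<longlonglongrightarrow> g' x" "AE x in M. (\<lambda>n. h n x) \<longlonglongrightarrow> h' x"
  shows "(\<lambda>n. \<integral>x. g n x * h n x \<partial>M) \<longlonglongrightarrow> (\<integral>x. g' x * h' x \<partial>M)"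
proof (rule integral_dominated_convergence[where w = "\<lambda>x. G x * k"])
  note g(1,2)[measurable] h(1,2)[measurable]
  show "(\<lambda>x. g' x * h' x) \<in> borel_measurable M" "(\<lambda>x. g n x * h n x) \<in> borel_measurable M" for n by measurable
  show "integrable M (\<lambda>x. G x * k)" using g(4) by simp
  show "AE x in M. (\<lambda>n. g n x * h n x) \<longlonglongrightarrow> g' x * h' x"
    using lim by eventually_elim (rule tendsto_mult)
  show "AE x in M. norm (g n x * h n x) \<le> G x * k" for n
  proof (intro always_eventually allI)
    fix x
    have "0 \<le> G x" using g(3)[of n x] by linarith
    then show "norm (g n x * h n x) \<le> G x * k"
      unfolding real_norm_def abs_mult by (intro mult_mono g(3) h(3)) auto
  qed
qed

lemma Lp_phi_mult_eq_abs:
  assumes "0 \<le> a * d" shows "Lp_phi p a * d = \<bar>a\<bar> powr (p - 1) * \<bar>d\<bar>"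
proof (cases "a = 0")
  case False
  then have "sgn a * d = \<bar>d\<bar>" using assms by (auto simp: sgn_if zero_le_mult_iff)
  then show ?thesis unfolding Lp_phi_eq_sgn by (metis mult.assoc mult.commute)
qed simp

text \<open>Strict monotonicity made quantitative: at distance at least e from b the product is at
  least c > 0. Constant sequences give uniqueness, general ones convergence almost
  everywhere.\<close>

lemma Lp_phi_coercive_tendsto:
  assumes p: "1 < p" and lim: "(\<lambda>n. (Lp_phi p (a n) - Lp_phi p b) * Tk 1 (a n - b)) \<longlonglongrightarrow> 0"
  shows "a \<longlonglongrightarrow> b"
proof (rule LIMSEQ_I)
  fix r :: real assume r: "0 < r"
  define e where "e = min r 1"
  have e: "0 < e" "e \<le> 1" "e \<le> r" using r by (auto simp: e_def)
  define c where "c = min ((Lp_phi p (b + e) - Lp_phi p b) * e) ((Lp_phi p b - Lp_phi p (b - e)) * e)"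
  have c: "0 < c" using e Lp_phi_strict_mono[OF p, of b "b + e"] Lp_phi_strict_mono[OF p, of "b - e" b] by (simp add: c_def)
  have big: "c \<le> (Lp_phi p x - Lp_phi p b) * Tk 1 (x - b)" if "e \<le> \<bar>x - b\<bar>" for x
  proof (cases "b \<le> x")
    case True
    then have "b + e \<le> x" using that by simp
    then have "(Lp_phi p (b + e) - Lp_phi p b) * e \<le> (Lp_phi p x - Lp_phi p b) * Tk 1 (x - b)"
      using e Lp_phi_mono[OF p, of "b + e" x] Lp_phi_mono[OF p, of b "b + e"] by (intro mult_mono) (auto simp: Tk_def)
    then show ?thesis by (simp add: c_def)
  next
    case False
    then have "x \<le> b - e" using that by simp
    then have "(Lp_phi p b - Lp_phi p (b - e)) * e \<le> (Lp_phi p b - Lp_phi p x) * (- Tk 1 (x - b))"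
      using e Lp_phi_mono[OF p, of x "b - e"] Lp_phi_mono[OF p, of "b - e" b] by (intro mult_mono) (auto simp: Tk_def)
    then have "(Lp_phi p b - Lp_phi p (b - e)) * e \<le> (Lp_phi p x - Lp_phi p b) * Tk 1 (x - b)"
      by (simp add: algebra_simps)
    then show ?thesis by (simp add: c_def)
  qed
  have "\<forall>\<^sub>F n in sequentially. (Lp_phi p (a n) - Lp_phi p b) * Tk 1 (a n - b) < c"
    using lim c by (rule order_tendstoD)
  then have "\<forall>\<^sub>F n in sequentially. norm (a n - b) < r"
    by eventually_elim (use big e in \<open>smt (verit) real_norm_def\<close>)
  then show "\<exists>no. \<forall>n\<ge>no. norm (a n - b) < r" by (simp add: eventually_sequentially)
qed

lemma Tk_tendsto_id: "(\<lambda>n. Tk (real n) a) \<longlonglongrightarrow> a"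
proof -
  obtain N :: nat where "\<bar>a\<bar> \<le> real N" using real_arch_simple by blast
  then have "\<forall>\<^sub>F n in sequentially. Tk (real n) a = a"
    unfolding eventually_sequentially by (intro exI[of _ N]) (auto intro!: Tk_id)
  then show ?thesis by (rule tendsto_eventually)
qed

section \<open>Entropy inequalities for arbitrary integrable data\<close>

context weighted_domain
begin

text \<open>Condition (ii) multiplied by 2, with integrals over the whole space: outside
  \<open>D_set \<Omega>\<close> all increments vanish, and the datum is thought of as extended by 0.
  Entropy solutions and energy solutions both satisfy it, so a single stability estimate serves for
  uniqueness and for convergence.\<close>

definition entropic :: "('a \<Rightarrow> real) \<Rightarrow> ('a \<Rightarrow> real) \<Rightarrow> bool" where
  "entropic g v \<longleftrightarrow> v \<in> borel_measurable lebesgue \<and> (\<forall>x. x \<notin> \<Omega> \<longrightarrow> v x = 0) \<and>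
    (\<forall>k>0. (\<lambda>x. Tk k (v x)) \<in> W) \<and>
    (\<forall>k>0. \<forall>\<phi>\<in>W. ess_bounded \<phi> \<longrightarrow>
      integrable \<nu> (\<lambda>z. flux v (\<lambda>x. Tk k (v x - \<phi> x)) z) \<and>
      (\<integral>z. flux v (\<lambda>x. Tk k (v x - \<phi> x)) z \<partial>\<nu>) \<le> 2 * (\<integral>x. g x * Tk k (v x - \<phi> x) \<partial>lebesgue))"

lemma ess_boundedI: "(\<And>x. \<bar>\<phi> x\<bar> \<le> C) \<Longrightarrow> ess_bounded \<phi>"
  unfolding ess_bounded_def by (intro exI[of _ C] always_eventually allI)

lemma entropicD:
  assumes "entropic g v" "0 < k" "\<phi> \<in> W" "\<And>x. \<bar>\<phi> x\<bar> \<le> C"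
  shows "integrable \<nu> (\<lambda>z. flux v (\<lambda>x. Tk k (v x - \<phi> x)) z)"
    "(\<integral>z. flux v (\<lambda>x. Tk k (v x - \<phi> x)) z \<partial>\<nu>) \<le> 2 * (\<integral>x. g x * Tk k (v x - \<phi> x) \<partial>lebesgue)"
  using assms ess_boundedI[of \<phi> C] unfolding entropic_def by blast+

lemma entropic_measurable: "entropic g v \<Longrightarrow> v \<in> borel_measurable lebesgue"
  and entropic_zero: "entropic g v \<Longrightarrow> x \<notin> \<Omega> \<Longrightarrow> v x = 0"
  and entropic_Tk: "entropic g v \<Longrightarrow> 0 < k \<Longrightarrow> (\<lambda>x. Tk k (v x)) \<in> W"
  by (auto simp: entropic_def)

lemma entropic_Tk_test:
  assumes "entropic g v" "0 < k"
  shows "integrable \<nu> (\<lambda>z. flux v (\<lambda>x. Tk k (v x)) z)"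
    "(\<integral>z. flux v (\<lambda>x. Tk k (v x)) z \<partial>\<nu>) \<le> 2 * (\<integral>x. g x * Tk k (v x) \<partial>lebesgue)"
  using entropicD[OF assms W_0, of 0] by simp_all

text \<open>That the truncation lies in \<open>W\<close> says nothing about pairs across the
  boundary; their energy is bounded by the entropy inequality with test function 0.\<close>

lemma entropic_Tk_X:
  assumes v: "entropic g v" and k: "0 < k"
  shows "(\<lambda>x. Tk k (v x)) \<in> X k"
proof -
  note W = entropic_Tk[OF v k]
  have "integrable \<nu> (\<lambda>z. epow (\<lambda>x. Tk k (v x)) z)"
  proof (rule Bochner_Integration.integrable_bound[OF entropic_Tk_test(1)[OF v k] powr_incr_measurable[OF W_measurable[OF W]]],
      intro always_eventually allI)
    fix z
    have "epow (\<lambda>x. Tk k (v x)) z \<le> flux v (\<lambda>x. Tk k (v x)) z"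
      by (rule Lp_phi_mult_Tk_ge[OF p_gt_1])
    then show "norm (epow (\<lambda>x. Tk k (v x)) z) \<le> norm (flux v (\<lambda>x. Tk k (v x)) z)"
      unfolding real_norm_def using powr_ge_zero by (smt (verit))
  qed
  then show ?thesis using W k by (simp add: X_def En_def abs_Tk_le)
qed

text \<open>Converts the band energies left over by \<open>truncated_test_error\<close> into
  integrals that an entropy test bounds by the datum.\<close>

lemma excess_energy:
  assumes w [measurable]: "w \<in> borel_measurable lebesgue" and k: "0 \<le> k"
    and int: "integrable \<nu> (\<lambda>z. flux w (\<lambda>x. Tk k (w x - Tk h (w x))) z)"
  shows "integrable \<nu> (\<lambda>z. epow (\<lambda>x. Tk k (w x - Tk h (w x))) z)"
    "(\<integral>z. epow (\<lambda>x. Tk k (w x - Tk h (w x))) z \<partial>\<nu>) \<le>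
      (\<integral>z. flux w (\<lambda>x. Tk k (w x - Tk h (w x))) z \<partial>\<nu>)"
proof -
  have le: "epow (\<lambda>x. Tk k (w x - Tk h (w x))) z \<le> flux w (\<lambda>x. Tk k (w x - Tk h (w x))) z" for z
    by (rule Lp_phi_mult_Tk_excess_ge[OF p_gt_1 k])
  have m: "(\<lambda>z. epow (\<lambda>x. Tk k (w x - Tk h (w x))) z) \<in> borel_measurable \<nu>" by measurable
  show i: "integrable \<nu> (\<lambda>z. epow (\<lambda>x. Tk k (w x - Tk h (w x))) z)"
  proof (rule Bochner_Integration.integrable_bound[OF int m], intro always_eventually allI)
    fix z
    show "norm (epow (\<lambda>x. Tk k (w x - Tk h (w x))) z) \<le> norm (flux w (\<lambda>x. Tk k (w x - Tk h (w x))) z)"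
      unfolding real_norm_def using powr_ge_zero le[of z] by (smt (verit))
  qed
  show "(\<integral>z. epow (\<lambda>x. Tk k (w x - Tk h (w x))) z \<partial>\<nu>) \<le>
      (\<integral>z. flux w (\<lambda>x. Tk k (w x - Tk h (w x))) z \<partial>\<nu>)"
    by (rule integral_mono[OF i int le])
qed

end

section \<open>Stability, uniqueness and high levels of the limit\<close>

context entropy_data
begin

text \<open>v is compared with \<open>sol n\<close> rather than with u, because bounded minimisers
  are legitimate test functions. The integrand \<open>S n\<close> is nonnegative, so Fatou's lemma
  transfers the estimate to u once the errors have vanished.\<close>

lemma stability:
  assumes v: "entropic g v" and g: "integrable lebesgue g" and k: "0 < k"
  shows "(\<integral>\<^sup>+z. ennreal ((Lp_phi p (incr v z) - Lp_phi p (incr u z)) * incr (\<lambda>x. Tk k (v x - u x)) z) \<partial>\<nu>)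
    \<le> ennreal (2 * (\<integral>x. g x * Tk k (v x - u x) \<partial>lebesgue) + 2 * (\<integral>x. f x * Tk k (u x - v x) \<partial>lebesgue))"
proof -
  note vm [measurable] = entropic_measurable[OF v]
  have gm [measurable]: "g \<in> borel_measurable lebesgue" using g by auto
  obtain N :: nat where N: "k < real N" using reals_Archimedean2 by blast
  \<comment> \<open>The first two terms come from testing v with \<open>sol n\<close> and
    \<open>sol n\<close> with \<open>Tk (real n) v\<close>. The factor 3 multiplies the bounds for
    the band energies of v above n and of \<open>sol n\<close> above n - k; both tend to 0.\<close>
  define c where "c n = 2 * (\<integral>x. g x * Tk k (v x - sol n x) \<partial>lebesgue) + 2 * (\<integral>x. f x * Tk k (sol n x - Tk (real n) (v x)) \<partial>lebesgue)
    + 3 * (2 * (\<integral>x. g x * Tk k (v x - Tk (real n) (v x)) \<partial>lebesgue) + 2 * (\<integral>x. f x * Tk k (sol n x - Tk (real n - k) (sol n x)) \<partial>lebesgue))" for n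
  define S where "S n z = (Lp_phi p (incr v z) - Lp_phi p (incr (sol n) z)) * incr (\<lambda>x. Tk k (v x - sol n x)) z" for n z
  have le: "(\<integral>\<^sup>+z. ennreal (S n z) \<partial>\<nu>) \<le> ennreal (c n)" if n: "N \<le> n" for n
  proof -
    have kn: "k < real n" using N n by (meson less_le_trans of_nat_le_iff)
    then have n0: "0 < real n" "0 < real n - k" using k by auto
    let ?A = "\<lambda>z. flux v (\<lambda>x. Tk k (v x - sol n x)) z"
    let ?B = "\<lambda>z. flux (sol n) (\<lambda>x. Tk k (sol n x - Tk (real n) (v x))) z"
    let ?t = "\<lambda>z. epow (\<lambda>x. Tk k (v x - Tk (real n) (v x))) z"
    let ?s = "\<lambda>z. epow (\<lambda>x. Tk k (sol n x - Tk (real n - k) (sol n x))) z"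
    have TvX: "(\<lambda>x. Tk (real n) (v x)) \<in> X (real n)" by (rule entropic_Tk_X[OF v n0(1)])
    have TsX: "(\<lambda>x. Tk (real n - k) (sol n x)) \<in> X (real n)"
    proof -
      have "\<bar>Tk (real n - k) (sol n x)\<bar> \<le> real n" for x
        using abs_Tk_le[of "real n - k" "sol n x"] n0 k by linarith
      then show ?thesis using En_Tk[OF sol_En, of "real n - k" n] n0 by (simp add: X_def)
    qed
    have A: "integrable \<nu> ?A" "(\<integral>z. ?A z \<partial>\<nu>) \<le> 2 * (\<integral>x. g x * Tk k (v x - sol n x) \<partial>lebesgue)"
      by (rule entropicD[OF v k En_W[OF sol_En] X_bound[OF sol_X]])+
    have B: "integrable \<nu> ?B" "(\<integral>z. ?B z \<partial>\<nu>) \<le> 2 * (\<integral>x. f x * Tk k (sol n x - Tk (real n) (v x)) \<partial>lebesgue)"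
      using sol_truncated_test[OF TvX k] k
      by (auto intro!: En_integrable_Lp_phi sol_En En_Tk En_diff X_En[OF TvX])
    have t1: "integrable \<nu> (\<lambda>z. flux v (\<lambda>x. Tk k (v x - Tk (real n) (v x))) z)"
      "(\<integral>z. flux v (\<lambda>x. Tk k (v x - Tk (real n) (v x))) z \<partial>\<nu>) \<le> 2 * (\<integral>x. g x * Tk k (v x - Tk (real n) (v x)) \<partial>lebesgue)"
      by (rule entropicD[OF v k En_W[OF X_En[OF TvX]] X_bound[OF TvX]])+
    have s1: "integrable \<nu> (\<lambda>z. flux (sol n) (\<lambda>x. Tk k (sol n x - Tk (real n - k) (sol n x))) z)"
      "(\<integral>z. flux (sol n) (\<lambda>x. Tk k (sol n x - Tk (real n - k) (sol n x))) z \<partial>\<nu>) \<le>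
        2 * (\<integral>x. f x * Tk k (sol n x - Tk (real n - k) (sol n x)) \<partial>lebesgue)"
      using sol_truncated_test[OF TsX k] k
      by (auto intro!: En_integrable_Lp_phi sol_En En_Tk En_diff X_En[OF TsX])
    note t = excess_energy[OF vm less_imp_le[OF k] t1(1)]
    note s = excess_energy[OF sol_measurable less_imp_le[OF k] s1(1)]
    let ?Z = "\<lambda>z. ?A z + ?B z + 3 * (?t z + ?s z)"
    have Zint: "integrable \<nu> ?Z"
      by (intro Bochner_Integration.integrable_add integrable_mult_right A(1) B(1) t(1) s(1))
    have SZ: "S n z \<le> ?Z z" for z
      using truncated_test_error[OF p_gt_1 k less_imp_le[OF kn], of "sol n (fst z)" "sol n (snd z)" "v (fst z)" "v (snd z)"]
        sol_nonneg[of n] X_bound[OF sol_X, of n "fst z"] X_bound[OF sol_X, of n "snd z"]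
      unfolding S_def abs_le_iff by (smt (verit))
    have S0: "0 \<le> S n z" for z unfolding S_def by (rule Lp_phi_monotone_Tk[OF p_gt_1])
    have "(\<integral>\<^sup>+z. ennreal (S n z) \<partial>\<nu>) \<le> (\<integral>\<^sup>+z. ennreal (?Z z) \<partial>\<nu>)"
      by (intro nn_integral_mono ennreal_leI SZ)
    also have "\<dots> = ennreal (\<integral>z. ?Z z \<partial>\<nu>)"
      by (rule nn_integral_eq_integral[OF Zint always_eventually[OF allI[OF order_trans[OF S0 SZ]]]])
    also have "(\<integral>z. ?Z z \<partial>\<nu>) = (\<integral>z. ?A z \<partial>\<nu>) + (\<integral>z. ?B z \<partial>\<nu>) + 3 * ((\<integral>z. ?t z \<partial>\<nu>) + (\<integral>z. ?s z \<partial>\<nu>))"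
      using A(1) B(1) t(1) s(1) by simp
    also have "\<dots> \<le> c n"
      unfolding c_def using A(2) B(2) order_trans[OF t(2) t1(2)] order_trans[OF s(2) s1(2)]
      by (intro add_mono mult_left_mono) auto
    finally show ?thesis by (simp add: ennreal_leI)
  qed
  have gl: "(\<lambda>n. \<integral>x. h x * y n x \<partial>lebesgue) \<longlonglongrightarrow> (\<integral>x. h x * y' x \<partial>lebesgue)"
    if "integrable lebesgue h" "\<And>n. y n \<in> borel_measurable lebesgue" "y' \<in> borel_measurable lebesgue"
      "\<And>n x. \<bar>y n x\<bar> \<le> k" "AE x in lebesgue. (\<lambda>n. y n x) \<longlonglongrightarrow> y' x" for h y y'
    using that by (intro integral_mult_bounded_tendsto[where G = "\<lambda>x. \<bar>h x\<bar>" and k = k]) auto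
  have bd: "\<bar>Tk k a\<bar> \<le> k" for a using k by (intro abs_Tk_le) simp
  have cl: "c \<longlonglongrightarrow> 2 * (\<integral>x. g x * Tk k (v x - u x) \<partial>lebesgue) + 2 * (\<integral>x. f x * Tk k (u x - v x) \<partial>lebesgue)
      + 3 * (2 * (\<integral>x. g x * 0 \<partial>lebesgue) + 2 * (\<integral>x. f x * 0 \<partial>lebesgue))"
    unfolding c_def
  proof (intro tendsto_add tendsto_mult tendsto_const gl g f_integrable bd)
    show "AE x in lebesgue. (\<lambda>n. Tk k (v x - sol n x)) \<longlonglongrightarrow> Tk k (v x - u x)"
      using sol_tendsto by eventually_elim (intro isCont_tendsto_compose[OF isCont_Tk] tendsto_diff tendsto_const)
    show "AE x in lebesgue. (\<lambda>n. Tk k (sol n x - Tk (real n) (v x))) \<longlonglongrightarrow> Tk k (u x - v x)"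
      using sol_tendsto by eventually_elim (intro isCont_tendsto_compose[OF isCont_Tk] tendsto_diff Tk_tendsto_id)
    show "AE x in lebesgue. (\<lambda>n. Tk k (v x - Tk (real n) (v x))) \<longlonglongrightarrow> 0"
    proof (intro always_eventually allI)
      fix x
      have "(\<lambda>n. Tk k (v x - Tk (real n) (v x))) \<longlonglongrightarrow> Tk k (v x - v x)"
        by (intro isCont_tendsto_compose[OF isCont_Tk] tendsto_diff tendsto_const Tk_tendsto_id)
      then show "(\<lambda>n. Tk k (v x - Tk (real n) (v x))) \<longlonglongrightarrow> 0" using k by (simp add: Tk_0)
    qed
    show "AE x in lebesgue. (\<lambda>n. Tk k (sol n x - Tk (real n - k) (sol n x))) \<longlonglongrightarrow> 0"
      using sol_le_u
    proof eventually_elim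
      case (elim x)
      obtain K :: nat where K: "u x + k \<le> real K" using real_arch_simple by blast
      have "Tk k (sol n x - Tk (real n - k) (sol n x)) = 0" if "K \<le> n" for n
      proof -
        have "u x + k \<le> real n" using K that by (meson of_nat_le_iff order_trans)
        then have "\<bar>sol n x\<bar> \<le> real n - k" using elim sol_nonneg[of n x] by (smt (verit))
        then show ?thesis using k by (simp add: Tk_id Tk_0)
      qed
      then show ?case by (intro tendsto_eventually) (auto simp: eventually_sequentially)
    qed
  qed measurable
  have "(\<integral>\<^sup>+z. ennreal ((Lp_phi p (incr v z) - Lp_phi p (incr u z)) * incr (\<lambda>x. Tk k (v x - u x)) z) \<partial>\<nu>) =
      (\<integral>\<^sup>+z. liminf (\<lambda>n. ennreal (S n z)) \<partial>\<nu>)"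
  proof (rule nn_integral_cong_AE)
    show "AE z in \<nu>. ennreal ((Lp_phi p (incr v z) - Lp_phi p (incr u z)) * incr (\<lambda>x. Tk k (v x - u x)) z) =
        liminf (\<lambda>n. ennreal (S n z))"
      using AE_nu_w_fst_snd[OF sol_tendsto]
    proof eventually_elim
      case (elim z)
      then have "(\<lambda>n. S n z) \<longlonglongrightarrow> (Lp_phi p (incr v z) - Lp_phi p (incr u z)) * incr (\<lambda>x. Tk k (v x - u x)) z"
        unfolding S_def
        by (intro tendsto_mult tendsto_diff tendsto_const isCont_tendsto_compose[OF isCont_Lp_phi[OF p_gt_1]]
            isCont_tendsto_compose[OF isCont_Tk]) auto
      then show ?case by (intro lim_imp_Liminf[symmetric] tendsto_ennrealI) auto
    qed
  qed
  also have "\<dots> \<le> liminf (\<lambda>n. \<integral>\<^sup>+z. ennreal (S n z) \<partial>\<nu>)"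
    unfolding S_def by (rule nn_integral_liminf) measurable
  also have "\<dots> \<le> liminf (\<lambda>n. ennreal (c n))"
    using le by (intro Liminf_mono) (auto simp: eventually_sequentially)
  also have "\<dots> = ennreal (2 * (\<integral>x. g x * Tk k (v x - u x) \<partial>lebesgue) + 2 * (\<integral>x. f x * Tk k (u x - v x) \<partial>lebesgue))"
    using tendsto_ennrealI[OF cl] by (intro lim_imp_Liminf) auto
  finally show ?thesis .
qed

lemma stability_gap_eq:
  assumes g: "integrable lebesgue g" and v: "v \<in> borel_measurable lebesgue" and k: "0 < k"
  shows "2 * (\<integral>x. g x * Tk k (v x - u x) \<partial>lebesgue) + 2 * (\<integral>x. f x * Tk k (u x - v x) \<partial>lebesgue) =
    2 * (\<integral>x. (g x - f x) * Tk k (v x - u x) \<partial>lebesgue)"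
proof -
  note [measurable] = v
  have int: "integrable lebesgue (\<lambda>x. h x * Tk k (v x - u x))" if h: "integrable lebesgue h" for h
  proof (rule Bochner_Integration.integrable_bound[of _ "\<lambda>x. k * h x"])
    show "integrable lebesgue (\<lambda>x. k * h x)" using h by simp
    show "(\<lambda>x. h x * Tk k (v x - u x)) \<in> borel_measurable lebesgue" using h by measurable
    show "AE x in lebesgue. norm (h x * Tk k (v x - u x)) \<le> norm (k * h x)"
    proof (intro always_eventually allI)
      fix x
      have "\<bar>h x\<bar> * \<bar>Tk k (v x - u x)\<bar> \<le> \<bar>h x\<bar> * k" using k by (intro mult_left_mono abs_Tk_le) auto
      then show "norm (h x * Tk k (v x - u x)) \<le> norm (k * h x)" using k by (simp add: abs_mult mult.commute)
    qed
  qed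
  have "Tk k (u x - v x) = - Tk k (v x - u x)" for x
    using Tk_minus[of k "v x - u x"] k by simp
  then show ?thesis using int[OF g] int[OF f_integrable] by (simp add: left_diff_distrib)
qed

lemma u_entropic: "entropic f u"
  unfolding entropic_def using u_zero u_entropy Tk_u_X by (auto intro!: En_W X_En)

lemma entropic_unique:
  assumes v: "entropic f v" shows "AE x in lebesgue. v x = u x"
proof -
  note vm [measurable] = entropic_measurable[OF v]
  let ?S = "\<lambda>z. (Lp_phi p (incr v z) - Lp_phi p (incr u z)) * incr (\<lambda>x. Tk 1 (v x - u x)) z"
  have "(\<integral>\<^sup>+z. ennreal (?S z) \<partial>\<nu>) \<le> 0"
    using stability[OF v f_integrable zero_less_one] unfolding stability_gap_eq[OF f_integrable vm zero_less_one] by simp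
  then have "(\<integral>\<^sup>+z. ennreal (?S z) \<partial>\<nu>) = 0" by simp
  moreover have "(\<lambda>z. ennreal (?S z)) \<in> borel_measurable \<nu>" by measurable
  ultimately have "AE z in \<nu>. ennreal (?S z) = 0" using nn_integral_0_iff_AE by blast
  then have "AE z in \<nu>. ?S z = 0"
    by eventually_elim (use Lp_phi_monotone_Tk[OF p_gt_1] in \<open>metis ennreal_eq_0_iff order_antisym\<close>)
  then have "AE x in lebesgue. x \<in> \<Omega> \<longrightarrow> v x = u x"
  proof (intro AE_dom_if_AE_exterior, eventually_elim)
    case (elim z)
    show ?case
    proof
      assume z: "fst z \<in> \<Omega> \<and> snd z \<notin> \<Omega>"
      then have "(Lp_phi p (v (fst z)) - Lp_phi p (u (fst z))) * Tk 1 (v (fst z) - u (fst z)) = 0"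
        using elim by (simp add: entropic_zero[OF v] u_zero Tk_0)
      then have "(\<lambda>n :: nat. (Lp_phi p (v (fst z)) - Lp_phi p (u (fst z))) * Tk 1 (v (fst z) - u (fst z))) \<longlonglongrightarrow> 0"
        by (simp only: tendsto_const)
      then have "(\<lambda>n :: nat. v (fst z)) \<longlonglongrightarrow> u (fst z)"
        by (rule Lp_phi_coercive_tendsto[OF p_gt_1])
      then show "v (fst z) = u (fst z)" using LIMSEQ_unique tendsto_const by blast
    qed
  qed
  then show ?thesis by (rule AE_lebesgue_if_dom) (simp add: entropic_zero[OF v] u_zero)
qed

lemma u_excess_test:
  assumes k: "0 < k" and h: "0 < h"
  shows "integrable \<nu> (\<lambda>z. flux u (\<lambda>x. Tk k (u x - Tk h (u x))) z)"
    "(\<integral>z. flux u (\<lambda>x. Tk k (u x - Tk h (u x))) z \<partial>\<nu>) \<le> 2 * (\<integral>x. f x * Tk k (u x - Tk h (u x)) \<partial>lebesgue)"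
  by (rule u_entropy[OF En_W[OF X_En[OF Tk_u_X[OF h]]] k])+

lemma excess_incr_nonneg: "0 \<le> k \<Longrightarrow> 0 \<le> flux w (\<lambda>x. Tk k (w x - Tk h (w x))) z"
  using Lp_phi_mult_Tk_excess_ge[OF p_gt_1] powr_ge_zero order_trans by blast

text \<open>As u is nonnegative, a pair in \<open>R_set u h\<close> has one value at least h + 1 and
  one at most h. The excess over h cut at 1 then jumps by exactly 1, so the flux tested with it
  equals the integrand. The entropy inequality bounds it by an integral of f over high levels of
  u.\<close>

lemma u_flux_high_levels:
  "((\<lambda>h. \<integral>\<^sup>+z\<in>R_set u h. ennreal (\<bar>incr u z\<bar> powr (p - 1)) \<partial>\<nu>) \<longlongrightarrow> 0) at_top"
proof -
  have "((\<lambda>h. \<integral>x. f x * Tk 1 (u x - Tk h (u x)) \<partial>lebesgue) \<longlongrightarrow> (\<integral>x. 0 \<partial>(lebesgue :: 'a measure))) at_top"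
  proof (rule integral_dominated_convergence_at_top[where w = f])
    show "AE x in lebesgue. ((\<lambda>h. f x * Tk 1 (u x - Tk h (u x))) \<longlongrightarrow> 0) at_top"
    proof (intro always_eventually allI)
      fix x
      have "\<forall>\<^sub>F h in at_top. f x * Tk 1 (u x - Tk h (u x)) = 0"
        using eventually_ge_at_top[of "u x"]
      proof eventually_elim
        case (elim h)
        then have "Tk h (u x) = u x" using u_nonneg[of x] by (intro Tk_id) simp
        then show ?case by (simp add: Tk_0)
      qed
      then show "((\<lambda>h. f x * Tk 1 (u x - Tk h (u x))) \<longlongrightarrow> 0) at_top" by (rule tendsto_eventually)
    qed
    show "\<forall>\<^sub>F h in at_top. AE x in lebesgue. norm (f x * Tk 1 (u x - Tk h (u x))) \<le> f x"
    proof (intro always_eventually allI)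
      fix h x
      have "norm (f x * Tk 1 (u x - Tk h (u x))) = f x * \<bar>Tk 1 (u x - Tk h (u x))\<bar>" using f_nonneg[of x] by (simp add: abs_mult)
      also have "\<dots> \<le> f x * 1" by (intro mult_left_mono abs_Tk_le f_nonneg) simp
      finally show "norm (f x * Tk 1 (u x - Tk h (u x))) \<le> f x" by simp
    qed
  qed (use f_integrable in auto)
  then have "((\<lambda>h. ennreal (2 * (\<integral>x. f x * Tk 1 (u x - Tk h (u x)) \<partial>lebesgue))) \<longlongrightarrow> ennreal (2 * 0)) at_top"
    by (intro tendsto_ennrealI tendsto_mult tendsto_const) simp
  then have up: "((\<lambda>h. ennreal (2 * (\<integral>x. f x * Tk 1 (u x - Tk h (u x)) \<partial>lebesgue))) \<longlongrightarrow> 0) at_top" by simp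
  have "\<forall>\<^sub>F h in at_top. (\<integral>\<^sup>+z\<in>R_set u h. ennreal (\<bar>incr u z\<bar> powr (p - 1)) \<partial>\<nu>) \<le>
      ennreal (2 * (\<integral>x. f x * Tk 1 (u x - Tk h (u x)) \<partial>lebesgue))"
    using eventually_gt_at_top[of 0]
  proof eventually_elim
    case (elim h)
    let ?T = "\<lambda>x. Tk 1 (u x - Tk h (u x))"
    have "(\<integral>\<^sup>+z\<in>R_set u h. ennreal (\<bar>incr u z\<bar> powr (p - 1)) \<partial>\<nu>) \<le> (\<integral>\<^sup>+z. ennreal (flux u ?T z) \<partial>\<nu>)"
    proof (rule nn_integral_mono)
      fix z :: "'a \<times> 'a"
      show "ennreal (\<bar>incr u z\<bar> powr (p - 1)) * indicator (R_set u h) z \<le> ennreal (flux u ?T z)"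
      proof (cases "z \<in> R_set u h")
        case True
        obtain x y where z: "z = (x, y)" by (cases z)
        have nn: "0 \<le> u x" "0 \<le> u y" by (rule u_nonneg)+
        then have "\<not> u x * u y < 0" by (simp add: not_less)
        then have R: "h + 1 \<le> max (u x) (u y)" "min (u x) (u y) \<le> h" using True nn unfolding z R_set_def by auto
        have hi: "Tk 1 (a - Tk h a) = 1" if "h + 1 \<le> a" for a using that elim by (auto simp: Tk_def)
        have lo: "Tk 1 (a - Tk h a) = 0" if "a \<le> h" "0 \<le> a" for a using that elim by (auto simp: Tk_def)
        have "\<bar>incr ?T z\<bar> = 1"
        proof (cases "u x \<le> u y")
          case True
          then show ?thesis using R nn hi[of "u y"] lo[of "u x"] by (simp add: z max_def min_def)
        next
          case False
          then show ?thesis using R nn hi[of "u x"] lo[of "u y"] by (simp add: z max_def min_def)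
        qed
        moreover have "0 \<le> incr u z * incr ?T z" by (rule Tk_excess_incr_nonneg) simp
        ultimately have "flux u ?T z = \<bar>incr u z\<bar> powr (p - 1)"
          using Lp_phi_mult_eq_abs[of "incr u z" "incr ?T z" p] by simp
        then show ?thesis using True by simp
      qed simp
    qed
    also have "\<dots> = ennreal (\<integral>z. flux u ?T z \<partial>\<nu>)"
      by (rule nn_integral_eq_integral[OF u_excess_test(1)]) (use elim in \<open>auto intro!: excess_incr_nonneg\<close>)
    also have "\<dots> \<le> ennreal (2 * (\<integral>x. f x * ?T x \<partial>lebesgue))"
      using elim by (intro ennreal_leI u_excess_test(2)) auto
    finally show ?case .
  qed
  then show ?thesis by (intro tendsto_sandwich[OF _ _ tendsto_const up]) auto
qed

text \<open>The entropy inequality is reversed by a test function that makes the truncated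
  difference equal to - \<open>Tk k u\<close> below a high level. With the opposite inequality this
  is the equality required for Scheffe's lemma.\<close>

lemma u_Tk_test_ge:
  assumes k: "0 < k"
  shows "2 * (\<integral>x. f x * Tk k (u x) \<partial>lebesgue) \<le> (\<integral>z. flux u (\<lambda>x. Tk k (u x)) z \<partial>\<nu>)"
proof -
  let ?I = "\<integral>z. flux u (\<lambda>x. Tk k (u x)) z \<partial>\<nu>"
  have intk: "integrable \<nu> (\<lambda>z. flux u (\<lambda>x. Tk k (u x)) z)"
    by (rule entropic_Tk_test(1)[OF u_entropic k])
  have step: "2 * (\<integral>x. f x * Tk k (u x) \<partial>lebesgue) - 2 * (\<integral>x. f x * Tk (2 * k) (u x - Tk (real n) (u x)) \<partial>lebesgue) \<le> ?I"
    if n: "k < real n" for n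
  proof -
    let ?h = "real n"
    let ?E = "\<lambda>x. Tk (2 * k) (u x - Tk ?h (u x))"
    \<comment> \<open>Below level n, u - \<phi> is - \<open>Tk k u\<close>. Above it u - \<phi> is u
      - n - k, and cutting this at k gives the excess u - n cut at 2 * k, minus k. This is where the
      height 2 * k comes from.\<close>
    define \<phi> where "\<phi> x = Tk ?h (u x) + Tk k (u x)" for x
    have h: "0 < ?h" using n k by simp
    have phiW: "\<phi> \<in> W"
      unfolding \<phi>_def[abs_def] by (intro W_add En_W X_En[OF Tk_u_X[OF h]] X_En[OF Tk_u_X[OF k]])
    have id: "Tk k (u x - \<phi> x) = ?E x - Tk k (u x)" for x
    proof (cases "u x \<le> ?h")
      case True
      then have "Tk ?h (u x) = u x" using u_nonneg[of x] by (intro Tk_id) simp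
      moreover have "Tk k (- Tk k (u x)) = - Tk k (u x)" using k by (intro Tk_id) (simp add: abs_Tk_le)
      ultimately show ?thesis using k by (simp add: \<phi>_def Tk_0)
    next
      case False
      then have "Tk ?h (u x) = ?h" "Tk k (u x) = k" using n h k by (auto simp: Tk_def)
      then show ?thesis using False k by (auto simp: \<phi>_def Tk_def)
    qed
    have iid: "incr (\<lambda>x. Tk k (u x - \<phi> x)) z = incr ?E z - incr (\<lambda>x. Tk k (u x)) z" for z
      unfolding id by simp
    have prod: "flux u (\<lambda>x. Tk k (u x - \<phi> x)) z =
        flux u ?E z - flux u (\<lambda>x. Tk k (u x)) z" for z
      unfolding iid by (rule right_diff_distrib)
    have k2: "0 < 2 * k" using k by simp
    note E = u_excess_test(1)[OF k2 h]
    have "(\<integral>z. flux u ?E z \<partial>\<nu>) - ?I = (\<integral>z. flux u (\<lambda>x. Tk k (u x - \<phi> x)) z \<partial>\<nu>)"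
      unfolding prod
      by (rule Bochner_Integration.integral_diff[OF E intk, symmetric])
    also have "\<dots> \<le> 2 * (\<integral>x. f x * Tk k (u x - \<phi> x) \<partial>lebesgue)" by (rule u_entropy(2)[OF phiW k])
    also have "\<dots> = 2 * ((\<integral>x. f x * ?E x \<partial>lebesgue) - (\<integral>x. f x * Tk k (u x) \<partial>lebesgue))"
    proof -
      have i1: "integrable lebesgue (\<lambda>x. f x * ?E x)"
        by (rule f_mult_integrable[where k = "2 * k"]) (measurable, use k in \<open>simp add: abs_Tk_le\<close>)
      have i2: "integrable lebesgue (\<lambda>x. f x * Tk k (u x))"
        by (rule f_mult_integrable[where k = k]) (measurable, use k in \<open>simp add: abs_Tk_le\<close>)
      show ?thesis unfolding id right_diff_distrib using i1 i2 by simp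
    qed
    finally have "(\<integral>z. flux u ?E z \<partial>\<nu>) - ?I \<le>
      2 * ((\<integral>x. f x * ?E x \<partial>lebesgue) - (\<integral>x. f x * Tk k (u x) \<partial>lebesgue))" .
    moreover have "0 \<le> (\<integral>z. flux u ?E z \<partial>\<nu>)"
      using k by (intro integral_nonneg_AE always_eventually allI excess_incr_nonneg) simp
    ultimately show ?thesis by (smt (verit))
  qed
  have lim: "(\<lambda>n. \<integral>x. f x * Tk (2 * k) (u x - Tk (real n) (u x)) \<partial>lebesgue) \<longlonglongrightarrow> (\<integral>x. f x * 0 \<partial>lebesgue)"
  proof (rule f_mult_tendsto[where k = "2 * k"])
    show "AE x in lebesgue. (\<lambda>n. Tk (2 * k) (u x - Tk (real n) (u x))) \<longlonglongrightarrow> 0"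
    proof (intro always_eventually allI)
      fix x
      have "(\<lambda>n. Tk (2 * k) (u x - Tk (real n) (u x))) \<longlonglongrightarrow> Tk (2 * k) (u x - u x)"
        by (intro isCont_tendsto_compose[OF isCont_Tk] tendsto_diff tendsto_const Tk_tendsto_id)
      then show "(\<lambda>n. Tk (2 * k) (u x - Tk (real n) (u x))) \<longlonglongrightarrow> 0" using k by (simp add: Tk_0)
    qed
  qed (use k in \<open>auto simp: abs_Tk_le\<close>)
  have "(\<lambda>n. 2 * (\<integral>x. f x * Tk k (u x) \<partial>lebesgue) - 2 * (\<integral>x. f x * Tk (2 * k) (u x - Tk (real n) (u x)) \<partial>lebesgue)) \<longlonglongrightarrow>
      2 * (\<integral>x. f x * Tk k (u x) \<partial>lebesgue) - 2 * (\<integral>x. f x * 0 \<partial>lebesgue)"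
    by (intro tendsto_diff tendsto_mult tendsto_const lim)
  then have "(\<lambda>n. 2 * (\<integral>x. f x * Tk k (u x) \<partial>lebesgue) - 2 * (\<integral>x. f x * Tk (2 * k) (u x - Tk (real n) (u x)) \<partial>lebesgue)) \<longlonglongrightarrow>
      2 * (\<integral>x. f x * Tk k (u x) \<partial>lebesgue)" by simp
  then show ?thesis
  proof (rule LIMSEQ_le_const2)
    obtain N :: nat where "k < real N" using reals_Archimedean2 by blast
    then show "\<exists>N. \<forall>n\<ge>N. 2 * (\<integral>x. f x * Tk k (u x) \<partial>lebesgue) - 2 * (\<integral>x. f x * Tk (2 * k) (u x - Tk (real n) (u x)) \<partial>lebesgue) \<le> ?I"
      by (intro exI[of _ N] allI impI step) (meson less_le_trans of_nat_le_iff)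
  qed
qed

end

section \<open>Strong convergence of the truncations\<close>

context entropy_data
begin

text \<open>Convergence almost everywhere is available along subsequences only, since it is
  extracted from L^1 convergence of the monotonicity gap; the subsequence principle restores the
  full sequence.\<close>

lemma strong_convergence:
  assumes v: "\<And>n. entropic (g n) (v n)" and gm: "\<And>n. g n \<in> borel_measurable lebesgue"
    and g: "\<And>n x. \<bar>g n x\<bar> \<le> f x" and gl: "\<And>x. (\<lambda>n. g n x) \<longlonglongrightarrow> f x" and k: "0 < k"
  shows "(\<lambda>n. Wpow (\<lambda>x. Tk k (v n x) - Tk k (u x))) \<longlonglongrightarrow> 0"
proof (rule tendsto_subseq_principle)
  fix r :: "nat \<Rightarrow> nat" assume r: "strict_mono r"
  note [measurable] = gm entropic_measurable[OF v]
  have gint: "integrable lebesgue (g n)" for n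
    by (rule Bochner_Integration.integrable_bound[OF f_integrable gm]) (use g f_nonneg in auto)
  define d where "d n = (\<integral>x. \<bar>g n x - f x\<bar> \<partial>lebesgue)" for n
  have "d \<longlonglongrightarrow> (\<integral>x. 0 \<partial>(lebesgue :: 'a measure))"
    unfolding d_def
  proof (rule integral_dominated_convergence[where w = "\<lambda>x. 2 * f x"])
    show "AE x in lebesgue. (\<lambda>n. \<bar>g n x - f x\<bar>) \<longlonglongrightarrow> 0"
    proof (intro always_eventually allI)
      fix x
      from tendsto_rabs[OF LIM_zero[OF gl[of x]]] show "(\<lambda>n. \<bar>g n x - f x\<bar>) \<longlonglongrightarrow> 0" by simp
    qed
    show "AE x in lebesgue. norm \<bar>g n x - f x\<bar> \<le> 2 * f x" for n
    proof (intro always_eventually allI)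
      fix x show "norm \<bar>g n x - f x\<bar> \<le> 2 * f x" using g[of n x] by auto
    qed
  qed (use f_integrable in auto)
  then have d0: "d \<longlonglongrightarrow> 0" by simp
  define S where "S n z = (Lp_phi p (incr (v n) z) - Lp_phi p (incr u z)) * incr (\<lambda>x. Tk 1 (v n x - u x)) z" for n z
  have S0: "0 \<le> S n z" for n z unfolding S_def by (rule Lp_phi_monotone_Tk[OF p_gt_1])
  have Sm: "S n \<in> borel_measurable \<nu>" for n unfolding S_def by measurable
  have Sd: "(\<integral>\<^sup>+z. ennreal (S n z) \<partial>\<nu>) \<le> ennreal (2 * d n)" for n
  proof -
    have "(\<integral>x. (g n x - f x) * Tk 1 (v n x - u x) \<partial>lebesgue) \<le> d n"
      unfolding d_def
    proof (rule integral_mono)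
      have "integrable lebesgue (\<lambda>x. g n x - f x)" using gint f_integrable by simp
      then show i: "integrable lebesgue (\<lambda>x. \<bar>g n x - f x\<bar>)" by simp
      show le: "(g n x - f x) * Tk 1 (v n x - u x) \<le> \<bar>g n x - f x\<bar>" for x
      proof -
        have "(g n x - f x) * Tk 1 (v n x - u x) \<le> \<bar>g n x - f x\<bar> * \<bar>Tk 1 (v n x - u x)\<bar>"
          by (metis abs_ge_self abs_mult)
        also have "\<dots> \<le> \<bar>g n x - f x\<bar> * 1" by (intro mult_left_mono abs_Tk_le) auto
        finally show ?thesis by simp
      qed
      show "integrable lebesgue (\<lambda>x. (g n x - f x) * Tk 1 (v n x - u x))"
      proof (rule Bochner_Integration.integrable_bound[OF i], measurable, intro always_eventually allI)
        fix x
        have "\<bar>g n x - f x\<bar> * \<bar>Tk 1 (v n x - u x)\<bar> \<le> \<bar>g n x - f x\<bar> * 1" by (intro mult_left_mono abs_Tk_le) auto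
        then show "norm ((g n x - f x) * Tk 1 (v n x - u x)) \<le> norm \<bar>g n x - f x\<bar>" by (simp add: abs_mult)
      qed
    qed
    then have "2 * (\<integral>x. (g n x - f x) * Tk 1 (v n x - u x) \<partial>lebesgue) \<le> 2 * d n" by simp
    then show ?thesis
      using stability[OF v[of n] gint zero_less_one]
      unfolding stability_gap_eq[OF gint entropic_measurable[OF v] zero_less_one] S_def
      by (meson ennreal_leI order_trans)
  qed
  have "(\<lambda>n. ennreal (2 * d (r n))) \<longlonglongrightarrow> ennreal (2 * 0)"
    using LIMSEQ_subseq_LIMSEQ[OF d0 r] by (intro tendsto_ennrealI tendsto_mult tendsto_const) (simp add: o_def)
  then have up: "(\<lambda>n. ennreal (2 * d (r n))) \<longlonglongrightarrow> 0" by simp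
  have "(\<lambda>n. \<integral>\<^sup>+z. ennreal (S (r n) z) \<partial>\<nu>) \<longlonglongrightarrow> 0"
    by (rule tendsto_sandwich[OF _ _ tendsto_const up]) (use Sd in auto)
  from nn_integral_tendsto_0_AE_subseq[OF Sm S0 this]
  obtain q where q: "strict_mono q" "AE z in \<nu>. (\<lambda>n. S (r (q n)) z) \<longlonglongrightarrow> 0" by blast
  define y where "y n = v (r (q n))" for n
  define G where "G n = g (r (q n))" for n
  have y: "entropic (G n) (y n)" for n unfolding y_def G_def by (rule v)
  note ym [measurable] = entropic_measurable[OF y]
  have Gm [measurable]: "G n \<in> borel_measurable lebesgue" for n unfolding G_def by (rule gm)
  have "AE x in lebesgue. x \<in> \<Omega> \<longrightarrow> (\<lambda>n. y n x) \<longlonglongrightarrow> u x"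
    using q(2)
  proof (intro AE_dom_if_AE_exterior, eventually_elim)
    case (elim z)
    show ?case
    proof
      assume z: "fst z \<in> \<Omega> \<and> snd z \<notin> \<Omega>"
      have "(\<lambda>n. (Lp_phi p (y n (fst z)) - Lp_phi p (u (fst z))) * Tk 1 (y n (fst z) - u (fst z))) \<longlonglongrightarrow> 0"
        using elim z by (simp add: S_def y_def entropic_zero[OF v] u_zero Tk_0)
      then show "(\<lambda>n. y n (fst z)) \<longlonglongrightarrow> u (fst z)" by (rule Lp_phi_coercive_tendsto[OF p_gt_1])
    qed
  qed
  then have yl: "AE x in lebesgue. (\<lambda>n. y n x) \<longlonglongrightarrow> u x"
    by (rule AE_lebesgue_if_dom) (simp add: entropic_zero[OF y] u_zero)
  have Tyl: "AE x in lebesgue. (\<lambda>n. Tk k (y n x)) \<longlonglongrightarrow> Tk k (u x)"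
    using yl by eventually_elim (rule isCont_tendsto_compose[OF isCont_Tk])
  have bd: "\<bar>Tk k a\<bar> \<le> k" for a using k by (intro abs_Tk_le) simp
  define P where "P n z = flux (y n) (\<lambda>x. Tk k (y n x)) z" for n z
  define P' where "P' z = flux u (\<lambda>x. Tk k (u x)) z" for z
  have P0: "epow (\<lambda>x. Tk k (y n x)) z \<le> P n z" "epow (\<lambda>x. Tk k (u x)) z \<le> P' z" for n z
    unfolding P_def P'_def by (rule Lp_phi_mult_Tk_ge[OF p_gt_1])+
  have Pnn: "0 \<le> P n z" "0 \<le> P' z" for n z using P0 powr_ge_zero order_trans by blast+
  have Pint: "integrable \<nu> (P n)" "integrable \<nu> P'" for n
    unfolding P_def P'_def by (rule entropic_Tk_test(1)[OF y k], rule entropic_Tk_test(1)[OF u_entropic k])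
  have Pm [measurable]: "P n \<in> borel_measurable \<nu>" "P' \<in> borel_measurable \<nu>" for n using Pint by auto
  have Plim: "AE z in \<nu>. (\<lambda>n. P n z) \<longlonglongrightarrow> P' z"
    using AE_nu_w_fst_snd[OF yl]
  proof eventually_elim
    case (elim z)
    then show ?case unfolding P_def P'_def
      by (intro tendsto_mult isCont_tendsto_compose[OF isCont_Lp_phi[OF p_gt_1]] tendsto_diff
          isCont_tendsto_compose[OF isCont_Tk]) auto
  qed
  have "(\<lambda>n. \<integral>\<^sup>+z. norm (P n z - P' z) \<partial>\<nu>) \<longlonglongrightarrow> 0"
  proof (rule Scheffe_lemma1[OF Pint Plim])
    have "(\<lambda>n. \<integral>x. G n x * Tk k (y n x) \<partial>lebesgue) \<longlonglongrightarrow> (\<integral>x. f x * Tk k (u x) \<partial>lebesgue)"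
    proof (rule integral_mult_bounded_tendsto[OF Gm f_measurable _ f_integrable])
      show "\<bar>G n x\<bar> \<le> f x" for n x unfolding G_def by (rule g)
      show "AE x in lebesgue. (\<lambda>n. G n x) \<longlonglongrightarrow> f x"
      proof (intro always_eventually allI)
        fix x
        from LIMSEQ_subseq_LIMSEQ[OF LIMSEQ_subseq_LIMSEQ[OF gl[of x] r] q(1)]
        show "(\<lambda>n. G n x) \<longlonglongrightarrow> f x" by (simp add: G_def o_def)
      qed
    qed (use bd Tyl in auto)
    then have lim: "(\<lambda>n. ennreal (2 * (\<integral>x. G n x * Tk k (y n x) \<partial>lebesgue))) \<longlonglongrightarrow> ennreal (2 * (\<integral>x. f x * Tk k (u x) \<partial>lebesgue))"
      by (intro tendsto_ennrealI tendsto_mult tendsto_const)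
    have nn: "(\<integral>\<^sup>+z. norm (P n z) \<partial>\<nu>) = ennreal (\<integral>z. P n z \<partial>\<nu>)" "(\<integral>\<^sup>+z. norm (P' z) \<partial>\<nu>) = ennreal (\<integral>z. P' z \<partial>\<nu>)" for n
      using Pnn Pint by (simp_all add: nn_integral_eq_integral)
    \<comment> \<open>The entropy inequality bounds the integrals of P n from above and the reversed
      one bounds that of P' from below. In the limit the two bounds meet, which is the limsup
      condition of Scheffe's lemma.\<close>
    have Ple: "(\<integral>z. P n z \<partial>\<nu>) \<le> 2 * (\<integral>x. G n x * Tk k (y n x) \<partial>lebesgue)"
      "2 * (\<integral>x. f x * Tk k (u x) \<partial>lebesgue) \<le> (\<integral>z. P' z \<partial>\<nu>)" for n
      unfolding P_def P'_def by (rule entropic_Tk_test(2)[OF y k], rule u_Tk_test_ge[OF k])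
    have "limsup (\<lambda>n. \<integral>\<^sup>+z. norm (P n z) \<partial>\<nu>) \<le> limsup (\<lambda>n. ennreal (2 * (\<integral>x. G n x * Tk k (y n x) \<partial>lebesgue)))"
      unfolding nn by (intro Limsup_mono always_eventually allI ennreal_leI Ple(1))
    also have "\<dots> = ennreal (2 * (\<integral>x. f x * Tk k (u x) \<partial>lebesgue))" using lim by (intro lim_imp_Limsup) auto
    also have "\<dots> \<le> (\<integral>\<^sup>+z. norm (P' z) \<partial>\<nu>)" unfolding nn by (intro ennreal_leI Ple(2))
    finally show "limsup (\<lambda>n. \<integral>\<^sup>+z. norm (P n z) \<partial>\<nu>) \<le> (\<integral>\<^sup>+z. norm (P' z) \<partial>\<nu>)" .
  qed
  then have PL1: "(\<lambda>n. \<integral>\<^sup>+z. ennreal \<bar>P n z - P' z\<bar> \<partial>\<nu>) \<longlonglongrightarrow> 0" by simp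
  have PL2: "(\<lambda>n. \<integral>\<^sup>+z. ennreal (2 powr p * \<bar>P n z - P' z\<bar>) \<partial>\<nu>) \<longlonglongrightarrow> 0"
  proof -
    have "(\<lambda>n. ennreal (2 powr p) * (\<integral>\<^sup>+z. ennreal \<bar>P n z - P' z\<bar> \<partial>\<nu>)) \<longlonglongrightarrow> ennreal (2 powr p) * 0"
      by (intro ennreal_tendsto_cmult PL1) auto
    moreover have "(\<integral>\<^sup>+z. ennreal (2 powr p * \<bar>P n z - P' z\<bar>) \<partial>\<nu>) = ennreal (2 powr p) * (\<integral>\<^sup>+z. ennreal \<bar>P n z - P' z\<bar> \<partial>\<nu>)" for n
    proof -
      have "(\<integral>\<^sup>+z. ennreal (2 powr p * \<bar>P n z - P' z\<bar>) \<partial>\<nu>) = (\<integral>\<^sup>+z. ennreal (2 powr p) * ennreal \<bar>P n z - P' z\<bar> \<partial>\<nu>)"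
        by (intro nn_integral_cong ennreal_mult') simp
      also have "\<dots> = ennreal (2 powr p) * (\<integral>\<^sup>+z. ennreal \<bar>P n z - P' z\<bar> \<partial>\<nu>)" by (rule nn_integral_cmult) measurable
      finally show ?thesis .
    qed
    ultimately show ?thesis by simp
  qed
  \<comment> \<open>P n dominates the energy density of its truncation, and P n \<le> P' + |P n -
    P'|. So L^1 convergence of P n supplies a fixed bound plus a vanishing error.\<close>
  have gag: "(\<lambda>n. \<integral>\<^sup>+z. ennreal (epow (\<lambda>x. Tk k (y n x) - Tk k (u x)) z) \<partial>\<nu>) \<longlonglongrightarrow> 0"
  proof (rule nn_integral_tendsto_0_dominated[where g = "\<lambda>z. 2 powr p * (2 * P' z)" and e = "\<lambda>n z. 2 powr p * \<bar>P n z - P' z\<bar>"])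
    show "(\<lambda>z. epow (\<lambda>x. Tk k (y n x) - Tk k (u x)) z) \<in> borel_measurable \<nu>" for n by measurable
    show "integrable \<nu> (\<lambda>z. 2 powr p * (2 * P' z))" using Pint by simp
    show "epow (\<lambda>x. Tk k (y n x) - Tk k (u x)) z \<le> 2 powr p * (2 * P' z) + 2 powr p * \<bar>P n z - P' z\<bar>" for n z
    proof -
      have "incr (\<lambda>x. Tk k (y n x) - Tk k (u x)) z = incr (\<lambda>x. Tk k (y n x)) z - incr (\<lambda>x. Tk k (u x)) z" by simp
      then have "epow (\<lambda>x. Tk k (y n x) - Tk k (u x)) z \<le>
          2 powr p * (epow (\<lambda>x. Tk k (y n x)) z + epow (\<lambda>x. Tk k (u x)) z)"
        using abs_powr_diff_le[OF p_pos, of "incr (\<lambda>x. Tk k (y n x)) z" "incr (\<lambda>x. Tk k (u x)) z"] by (simp only:)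
      also have "\<dots> \<le> 2 powr p * (P n z + P' z)" by (intro mult_left_mono add_mono P0) simp
      also have "\<dots> \<le> 2 powr p * (2 * P' z + \<bar>P n z - P' z\<bar>)" by (intro mult_left_mono) auto
      finally show ?thesis by (simp only: distrib_left)
    qed
    show "AE z in \<nu>. (\<lambda>n. epow (\<lambda>x. Tk k (y n x) - Tk k (u x)) z) \<longlonglongrightarrow> 0"
      using AE_nu_w_fst_snd[OF Tyl]
    proof eventually_elim
      case (elim z)
      then have "(\<lambda>n. incr (\<lambda>x. Tk k (y n x) - Tk k (u x)) z) \<longlonglongrightarrow> incr (\<lambda>x. Tk k (u x) - Tk k (u x)) z"
        by (intro tendsto_diff tendsto_const) auto
      from isCont_tendsto_compose[OF isCont_abs_powr[OF p_gt_1] this] show ?case by simp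
    qed
    show "(\<lambda>n. \<integral>\<^sup>+z. ennreal (2 powr p * \<bar>P n z - P' z\<bar>) \<partial>\<nu>) \<longlonglongrightarrow> 0" by (rule PL2)
    show "(\<lambda>z. 2 powr p * \<bar>P n z - P' z\<bar>) \<in> borel_measurable \<nu>" for n by measurable
  qed (use Pnn in auto)
  have Lp: "(\<lambda>n. \<integral>\<^sup>+x. ennreal (\<bar>Tk k (y n x) - Tk k (u x)\<bar> powr p * indicator \<Omega> x) \<partial>mu_w \<beta>) \<longlonglongrightarrow> 0"
  proof (rule Lp_tendsto_0_bounded[where K = "2 * k"])
    show "(\<lambda>x. Tk k (y n x) - Tk k (u x)) \<in> borel_measurable lebesgue" for n by measurable
    show "\<bar>Tk k (y n x) - Tk k (u x)\<bar> \<le> 2 * k" for n x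
      using abs_triangle_ineq4[of "Tk k (y n x)" "Tk k (u x)"] bd[of "y n x"] bd[of "u x"] by linarith
    show "AE x in lebesgue. (\<lambda>n. Tk k (y n x) - Tk k (u x)) \<longlonglongrightarrow> 0"
      using Tyl by eventually_elim (rule LIM_zero)
  qed
  have up2: "(\<lambda>n. (\<integral>\<^sup>+x. ennreal (\<bar>Tk k (y n x) - Tk k (u x)\<bar> powr p * indicator \<Omega> x) \<partial>mu_w \<beta>) +
      (\<integral>\<^sup>+z. ennreal (epow (\<lambda>x. Tk k (y n x) - Tk k (u x)) z) \<partial>\<nu>)) \<longlonglongrightarrow> 0"
    using tendsto_add[OF Lp gag] by simp
  have "(\<lambda>n. Wpow (\<lambda>x. Tk k (y n x) - Tk k (u x))) \<longlonglongrightarrow> 0"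
  proof (rule tendsto_sandwich[OF _ _ tendsto_const up2]; intro always_eventually allI)
    show "Wpow (\<lambda>x. Tk k (y n x) - Tk k (u x)) \<le> (\<integral>\<^sup>+x. ennreal (\<bar>Tk k (y n x) - Tk k (u x)\<bar> powr p * indicator \<Omega> x) \<partial>mu_w \<beta>) +
      (\<integral>\<^sup>+z. ennreal (epow (\<lambda>x. Tk k (y n x) - Tk k (u x)) z) \<partial>\<nu>)" for n
      by (rule Wpow_le_Lp_energy) measurable
  qed simp
  then show "\<exists>q :: nat \<Rightarrow> nat. strict_mono q \<and> (\<lambda>n. Wpow (\<lambda>x. Tk k (v (r (q n)) x) - Tk k (u x))) \<longlonglongrightarrow> 0"
    using q(1) by (auto simp: y_def)
qed

end

section \<open>Translation to the given notions of solution\<close>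

context weighted_domain
begin

lemma D_set_integral:
  fixes F :: "'a \<times> 'a \<Rightarrow> real"
  assumes "\<And>x y. x \<notin> \<Omega> \<Longrightarrow> y \<notin> \<Omega> \<Longrightarrow> F (x, y) = 0"
  shows "set_integrable \<nu> (D_set \<Omega>) F \<longleftrightarrow> integrable \<nu> F" "(LINT z : D_set \<Omega> | \<nu>. F z) = (\<integral>z. F z \<partial>\<nu>)"
proof -
  have "(\<lambda>z. indicator (D_set \<Omega>) z *\<^sub>R F z) = F"
  proof
    fix z show "indicator (D_set \<Omega>) z *\<^sub>R F z = F z"
      using assms[of "fst z" "snd z"] by (cases z) (auto simp: D_set_def indicator_def)
  qed
  then show "set_integrable \<nu> (D_set \<Omega>) F \<longleftrightarrow> integrable \<nu> F" "(LINT z : D_set \<Omega> | \<nu>. F z) = (\<integral>z. F z \<partial>\<nu>)"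
    by (simp_all add: set_integrable_def set_lebesgue_integral_def)
qed

text \<open>\<open>Tk k (w - \<phi>)\<close> is itself in \<open>W\<close>, so it may be inserted
  into the energy equation, which yields the entropy relation even with equality. H is the datum
  written as a function on the whole space.\<close>

lemma energy_solution_entropic:
  assumes w: "energy_solution \<Omega> s p \<beta> h w"
    and H: "\<And>T. T \<in> borel_measurable lebesgue \<Longrightarrow> (LINT x : \<Omega> | lebesgue. h x * T x) = (\<integral>x. H x * T x \<partial>lebesgue)"
  shows "entropic H w"
proof -
  have wW: "w \<in> W" using w by (simp add: energy_solution_def)
  have "integrable \<nu> (\<lambda>z. flux w (\<lambda>x. Tk k (w x - \<phi> x)) z) \<and>
      (\<integral>z. flux w (\<lambda>x. Tk k (w x - \<phi> x)) z \<partial>\<nu>) \<le> 2 * (\<integral>x. H x * Tk k (w x - \<phi> x) \<partial>lebesgue)"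
    if k: "0 < k" and phi: "\<phi> \<in> W" for k \<phi>
  proof -
    have T: "(\<lambda>x. Tk k (w x - \<phi> x)) \<in> W" using k by (intro W_Tk W_diff wW phi) simp
    let ?F = "\<lambda>z. flux w (\<lambda>x. Tk k (w x - \<phi> x)) z"
    have F0: "?F (x, y) = 0" if "x \<notin> \<Omega>" "y \<notin> \<Omega>" for x y using that by (simp add: W_zero[OF wW])
    note E = bspec[OF conjunct2[OF w[unfolded energy_solution_def]] T]
    have "set_integrable \<nu> (D_set \<Omega>) ?F" by (rule conjunct1[OF E])
    moreover have "(1/2) * (LINT z : D_set \<Omega> | \<nu>. ?F z) = (LINT x : \<Omega> | lebesgue. h x * Tk k (w x - \<phi> x))"
      by (rule conjunct2[OF conjunct2[OF E]])
    moreover have "set_integrable \<nu> (D_set \<Omega>) ?F \<longleftrightarrow> integrable \<nu> ?F"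
      by (rule D_set_integral(1)) (rule F0)
    moreover have "(LINT z : D_set \<Omega> | \<nu>. ?F z) = (\<integral>z. ?F z \<partial>\<nu>)"
      by (rule D_set_integral(2)) (rule F0)
    ultimately show ?thesis
      unfolding H[OF W_measurable[OF T]] by simp
  qed
  then show ?thesis
    unfolding entropic_def using W_measurable[OF wW] W_zero[OF wW] W_Tk[OF wW] by auto
qed

end

theorem theorem1p2:
  fixes \<Omega> :: "'a::euclidean_space set"
    and s p \<beta> :: real
    and f :: "'a \<Rightarrow> real"
  assumes "0 < s" "s < 1" "1 < p" "p < real DIM('a)" "p * s < real DIM('a)"
    and "0 \<le> \<beta>" "\<beta> < (real DIM('a) - p * s) / 2"
    and "smooth_bounded_domain \<Omega>" "0 \<in> \<Omega>"
    and "set_integrable lebesgue \<Omega> f"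
    and "AE x in lebesgue. x \<in> \<Omega> \<longrightarrow> f x \<ge> 0"
    and "\<not> (AE x in lebesgue. x \<in> \<Omega> \<longrightarrow> f x = 0)"
  shows "\<exists>u. entropy_solution \<Omega> s p \<beta> f u \<and> (AE x in lebesgue. u x \<ge> 0) \<and>
     (\<forall>v. entropy_solution \<Omega> s p \<beta> f v \<and> (AE x in lebesgue. v x \<ge> 0) \<longrightarrow>
          (AE x in lebesgue. v x = u x)) \<and>
     (\<forall>us :: nat \<Rightarrow> 'a \<Rightarrow> real.
        (\<forall>n\<ge>1. energy_solution \<Omega> s p \<beta> (\<lambda>x. Tk (real n) (f x)) (us n)) \<longrightarrow>
        (\<forall>k>0. W_conv \<Omega> s p \<beta> (\<lambda>n x. Tk k (us n x)) (\<lambda>x. Tk k (u x))))"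
proof -
  have ps: "0 < p * s" using assms(1,3) by simp
  have "2 * \<beta> < real DIM('a)" using assms(7) ps by (simp add: field_simps)
  then interpret weighted_domain \<Omega> s p \<beta>
    using assms(1,3,6,8,9) by unfold_locales (auto simp: smooth_bounded_domain_def)
  \<comment> \<open>A representative of f extended by 0 and nonnegative at every point, as the
    locale demands. It agrees with the extension of f almost everywhere.\<close>
  define F where "F x = max 0 (indicator \<Omega> x * f x)" for x
  have fint: "integrable lebesgue (\<lambda>x. indicator \<Omega> x * f x)"
    using assms(10) by (simp add: set_integrable_def)
  note fm [measurable] = borel_measurable_integrable[OF fint]
  have Fm [measurable]: "F \<in> borel_measurable lebesgue" unfolding F_def by measurable
  have "integrable lebesgue F"
    by (rule Bochner_Integration.integrable_bound[OF fint Fm]) (simp add: F_def)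
  then interpret entropy_data \<Omega> s p \<beta> F
    by unfold_locales (auto simp: F_def)
  have AEF: "AE x in lebesgue. indicator \<Omega> x * f x = F x"
    using assms(11) by eventually_elim (auto simp: F_def indicator_def)
  have rhs: "(LINT x : \<Omega> | lebesgue. f x * T x) = (\<integral>x. F x * T x \<partial>lebesgue)"
    if [measurable]: "T \<in> borel_measurable lebesgue" for T
  proof -
    have "(LINT x : \<Omega> | lebesgue. f x * T x) = (\<integral>x. (indicator \<Omega> x * f x) * T x \<partial>lebesgue)"
      by (simp add: set_lebesgue_integral_def mult.assoc)
    also have "\<dots> = (\<integral>x. F x * T x \<partial>lebesgue)"
    proof (rule integral_cong_AE)
      show "AE x in lebesgue. indicator \<Omega> x * f x * T x = F x * T x" using AEF by eventually_elim simp
    qed measurable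
    finally show ?thesis .
  qed
  have rhsn: "(LINT x : \<Omega> | lebesgue. Tk (real n) (f x) * T x) = (\<integral>x. Tk (real n) (F x) * T x \<partial>lebesgue)"
    if [measurable]: "T \<in> borel_measurable lebesgue" for T n
  proof -
    \<comment> \<open>Truncation fixes 0, so it commutes with extension by 0; this includes n =
      0.\<close>
    have eq: "indicator \<Omega> x *\<^sub>R (Tk (real n) (f x) * T x) = Tk (real n) (indicator \<Omega> x * f x) * T x" for x
      by (simp add: indicator_def Tk_0)
    have "(LINT x : \<Omega> | lebesgue. Tk (real n) (f x) * T x) = (\<integral>x. Tk (real n) (indicator \<Omega> x * f x) * T x \<partial>lebesgue)"
      unfolding set_lebesgue_integral_def eq ..
    also have "\<dots> = (\<integral>x. Tk (real n) (F x) * T x \<partial>lebesgue)"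
    proof (rule integral_cong_AE)
      show "AE x in lebesgue. Tk (real n) (indicator \<Omega> x * f x) * T x = Tk (real n) (F x) * T x"
        using AEF by eventually_elim simp
    qed measurable
    finally show ?thesis .
  qed
  have solution_iff: "entropy_solution \<Omega> s p \<beta> f v \<longleftrightarrow> entropic F v \<and>
      ((\<lambda>h. \<integral>\<^sup>+z\<in>R_set v h. ennreal (\<bar>incr v z\<bar> powr (p - 1)) \<partial>\<nu>) \<longlongrightarrow> 0) at_top" for v
  proof -
    have eqs: "(set_integrable \<nu> (D_set \<Omega>) (\<lambda>z. flux v (\<lambda>x. Tk k (v x - \<phi> x)) z) \<and>
        (1/2) * (LINT z : D_set \<Omega> | \<nu>. flux v (\<lambda>x. Tk k (v x - \<phi> x)) z)
          \<le> (LINT x : \<Omega> | lebesgue. f x * Tk k (v x - \<phi> x))) \<longleftrightarrow>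
       (integrable \<nu> (\<lambda>z. flux v (\<lambda>x. Tk k (v x - \<phi> x)) z) \<and>
        (\<integral>z. flux v (\<lambda>x. Tk k (v x - \<phi> x)) z \<partial>\<nu>) \<le> 2 * (\<integral>x. F x * Tk k (v x - \<phi> x) \<partial>lebesgue))"
      if v: "v \<in> borel_measurable lebesgue" "\<forall>x. x \<notin> \<Omega> \<longrightarrow> v x = 0" and phi: "\<phi> \<in> W" for k \<phi>
    proof -
      note [measurable] = v(1) W_measurable[OF phi]
      have "(\<lambda>x. Tk k (v x - \<phi> x)) \<in> borel_measurable lebesgue" by measurable
      note R = rhs[OF this]
      have F0: "Lp_phi p (incr v (x, y)) * incr (\<lambda>x. Tk k (v x - \<phi> x)) (x, y) = 0" if "x \<notin> \<Omega>" "y \<notin> \<Omega>" for x y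
        using v(2) that by simp
      have D: "set_integrable \<nu> (D_set \<Omega>) (\<lambda>z. flux v (\<lambda>x. Tk k (v x - \<phi> x)) z) \<longleftrightarrow>
          integrable \<nu> (\<lambda>z. flux v (\<lambda>x. Tk k (v x - \<phi> x)) z)"
        by (rule D_set_integral(1)) (rule F0)
      have D': "(LINT z : D_set \<Omega> | \<nu>. flux v (\<lambda>x. Tk k (v x - \<phi> x)) z) =
          (\<integral>z. flux v (\<lambda>x. Tk k (v x - \<phi> x)) z \<partial>\<nu>)"
        by (rule D_set_integral(2)) (rule F0)
      show ?thesis unfolding D D' R by auto
    qed
    show ?thesis
      unfolding entropy_solution_def entropic_def using eqs by blast
  qed
  show ?thesis
  proof (intro exI[of _ u] conjI allI impI)
    show "entropy_solution \<Omega> s p \<beta> f u"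
      unfolding solution_iff using u_entropic u_flux_high_levels by blast
    show "AE x in lebesgue. 0 \<le> u x" by (simp add: u_nonneg)
    show "AE x in lebesgue. v x = u x" if "entropy_solution \<Omega> s p \<beta> f v \<and> (AE x in lebesgue. 0 \<le> v x)" for v
      using that unfolding solution_iff by (blast intro: entropic_unique)
    fix us :: "nat \<Rightarrow> 'a \<Rightarrow> real" and k :: real
    assume us: "\<forall>n\<ge>1. energy_solution \<Omega> s p \<beta> (\<lambda>x. Tk (real n) (f x)) (us n)" and k: "0 < k"
    \<comment> \<open>The equations are given for n \<ge> 1 only, hence the shift by one;
      \<open>W_conv\<close> does not see the first term.\<close>
    have "(\<lambda>n. Wpow (\<lambda>x. Tk k (us (Suc n) x) - Tk k (u x))) \<longlonglongrightarrow> 0"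
    proof (rule strong_convergence[OF _ _ _ _ k])
      show "entropic (\<lambda>x. Tk (real (Suc n)) (F x)) (us (Suc n))" for n
        using us by (intro energy_solution_entropic[OF _ rhsn]) auto
      show "(\<lambda>x. Tk (real (Suc n)) (F x)) \<in> borel_measurable lebesgue" for n by measurable
      show "\<bar>Tk (real (Suc n)) (F x)\<bar> \<le> F x" for n x
        using abs_Tk_le_abs[of "real (Suc n)" "F x"] f_nonneg[of x] by simp
      show "(\<lambda>n. Tk (real (Suc n)) (F x)) \<longlonglongrightarrow> F x" for x
        by (rule LIMSEQ_Suc[OF Tk_tendsto_id])
    qed
    then show "W_conv \<Omega> s p \<beta> (\<lambda>n x. Tk k (us n x)) (\<lambda>x. Tk k (u x))"
      unfolding W_conv_iff by (rule LIMSEQ_imp_Suc)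
  qed
qed

end
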